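(* There is an algorithm solving Maximum Common Star Forest Subgraph (computing the maximum number of vertices of a common star forest subgraph of $G_1$ and $G_2$) in time $2^{2^{\mathcal{O}(k^2)}}\cdot n^{\mathcal{O}(1)}$ on inputs where every connected component of $G_1$ and of $G_2$ has at most $k$ vertices; here $n=|V(G_1)|+|V(G_2)|$.
   Context: A non-trivial star is a tree on at least $2$ vertices of diameter at most $2$. A star forest is a vertex-disjoint union of non-trivial stars. A graph $H$ is a subgraph of $G$ if there is an injective map $\phi:V(H)\to V(G)$ with $\{\phi(u),\phi(v)\}\in E(G)$ for all $\{u,v\}\in E(H)$. Maximum Common Star Forest Subgraph: given undirected simple graphs $G_1,G_2$ and an integer $h\ge 0$, decide whether there is a star forest on at least $h$ vertices that is a subgraph of both $G_1$ and $G_2$. *)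

theory Defs
  imports Complex_Main "HOL-Library.Landau_Symbols" "HOL-Library.Disjoint_Sets"
begin

section \<open>Graphs\<close>

type_synonym 'a graph = "'a set \<times> 'a set set"

abbreviation verts :: "'a graph \<Rightarrow> 'a set" where "verts G \<equiv> fst G"
abbreviation edges :: "'a graph \<Rightarrow> 'a set set" where "edges G \<equiv> snd G"

definition simple_graph :: "'a graph \<Rightarrow> bool" where
  "simple_graph G \<longleftrightarrow> finite (verts G) \<and> (\<forall>e\<in>edges G. e \<subseteq> verts G \<and> card e = 2)"

definition adj :: "'a graph \<Rightarrow> ('a \<times> 'a) set" where
  "adj G = {(u, v). {u, v} \<in> edges G}"

definition connected_graph :: "'a graph \<Rightarrow> bool" where
  "connected_graph G \<longleftrightarrow> verts G \<noteq> {} \<and> (\<forall>u\<in>verts G. \<forall>v\<in>verts G. (u, v) \<in> (adj G)\<^sup>*)"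

definition components :: "'a graph \<Rightarrow> 'a set set" where
  "components G = (\<lambda>v. {u. (v, u) \<in> (adj G)\<^sup>*}) ` verts G"

definition is_cycle :: "'a graph \<Rightarrow> 'a list \<Rightarrow> bool" where
  "is_cycle G vs \<longleftrightarrow> length vs \<ge> 3 \<and> distinct vs
     \<and> (\<forall>i<length vs. (vs ! i, vs ! (Suc i mod length vs)) \<in> adj G)"

definition tree :: "'a graph \<Rightarrow> bool" where
  "tree G \<longleftrightarrow> simple_graph G \<and> connected_graph G \<and> \<not> (\<exists>vs. is_cycle G vs)"

text \<open>Distance and diameter are only used for connected graphs, where the minima and
  maxima below are taken over nonempty (and, for the maximum, finite) sets.\<close>

definition distance :: "'a graph \<Rightarrow> 'a \<Rightarrow> 'a \<Rightarrow> nat" where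
  "distance G u v = (LEAST l. (u, v) \<in> adj G ^^ l)"

definition diameter :: "'a graph \<Rightarrow> nat" where
  "diameter G = Max {distance G u v | u v. u \<in> verts G \<and> v \<in> verts G}"

definition nontrivial_star :: "'a graph \<Rightarrow> bool" where
  "nontrivial_star S \<longleftrightarrow> tree S \<and> card (verts S) \<ge> 2 \<and> diameter S \<le> 2"

definition star_forest :: "'a graph \<Rightarrow> bool" where
  "star_forest H \<longleftrightarrow> (\<exists>\<S>. finite \<S> \<and> (\<forall>S\<in>\<S>. nontrivial_star S)
     \<and> disjoint_family_on verts \<S>
     \<and> H = (\<Union>S\<in>\<S>. verts S, \<Union>S\<in>\<S>. edges S))"

definition subgraph_of :: "'a graph \<Rightarrow> 'b graph \<Rightarrow> bool" where
  "subgraph_of H G \<longleftrightarrow> (\<exists>\<phi>. inj_on \<phi> (verts H) \<and> \<phi> ` verts H \<subseteq> verts G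
     \<and> (\<forall>u v. {u, v} \<in> edges H \<longrightarrow> {\<phi> u, \<phi> v} \<in> edges G))"

text \<open>Every finite graph has an isomorphic copy on natural numbers, so letting the common
  star forest range over graphs on \<open>nat\<close> is no restriction.\<close>

definition common_star_forest :: "'a graph \<Rightarrow> 'b graph \<Rightarrow> nat graph \<Rightarrow> bool" where
  "common_star_forest G\<^sub>1 G\<^sub>2 H \<longleftrightarrow> star_forest H \<and> subgraph_of H G\<^sub>1 \<and> subgraph_of H G\<^sub>2"

definition mcsf_decision :: "'a graph \<Rightarrow> 'b graph \<Rightarrow> nat \<Rightarrow> bool" where
  "mcsf_decision G\<^sub>1 G\<^sub>2 h \<longleftrightarrow> (\<exists>H. common_star_forest G\<^sub>1 G\<^sub>2 H \<and> card (verts H) \<ge> h)"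

definition mcsf_optimum :: "'a graph \<Rightarrow> 'b graph \<Rightarrow> nat" where
  "mcsf_optimum G\<^sub>1 G\<^sub>2 = Max {card (verts H) | H. common_star_forest G\<^sub>1 G\<^sub>2 H}"

text \<open>The set under \<open>Max\<close> is finite and nonempty (it contains the size of the empty forest).\<close>

lemma finite_common_star_forest_sizes:
  assumes "simple_graph G\<^sub>1"
  shows "finite {card (verts H) | H. common_star_forest G\<^sub>1 G\<^sub>2 H}"
proof (rule finite_subset)
  show "{card (verts H) | H. common_star_forest G\<^sub>1 G\<^sub>2 H} \<subseteq> {..card (verts G\<^sub>1)}"
    using assms
    by (auto simp: common_star_forest_def subgraph_of_def simple_graph_def intro: card_inj_on_le)
qed simp

lemma zero_common_star_forest_size:
  "0 \<in> {card (verts H) | H. common_star_forest G\<^sub>1 G\<^sub>2 H}"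
proof -
  have "common_star_forest G\<^sub>1 G\<^sub>2 ({}, {})"
    by (auto simp: common_star_forest_def star_forest_def subgraph_of_def disjoint_family_on_def
        intro!: exI[of _ "{}"])
  then show ?thesis by (force intro!: exI[of _ "({}, {})"])
qed

section \<open>Model of computation\<close>

text \<open>
  A first-order, call-by-value functional language over binary trees (Lisp S-expressions with
  a single atom), with a unit-cost measure that charges one step per evaluated expression node.
  Every construct only inspects, copies or allocates a constant number of pointers: programs are
  finite, and the only primitives are constructing a cell, projecting, testing for the atom, and
  calling a function of the program. Hence running times agree up to a polynomial with those of
  Turing machines and RAMs, and the class of bounds \<open>2 ^ 2 ^ O(k\<^sup>2) * n ^ O(1)\<close> is closed under
  polynomials.
\<close>

datatype data = Atom | Pair data data

datatype expr =
    Var nat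
  | EAtom
  | EPair expr expr
  | EFst expr
  | ESnd expr
  | EIf expr expr expr
  | ECall nat "expr list"

text \<open>Function \<open>i\<close> of a program has the body \<open>P ! i\<close>, in which \<open>Var j\<close> is the \<open>j\<close>-th argument.\<close>

type_synonym program = "expr list"

fun data_fst :: "data \<Rightarrow> data" where
  "data_fst Atom = Atom"
| "data_fst (Pair a b) = a"

fun data_snd :: "data \<Rightarrow> data" where
  "data_snd Atom = Atom"
| "data_snd (Pair a b) = b"

text \<open>\<open>eval P \<rho> e v t\<close>: in environment \<open>\<rho>\<close>, the expression \<open>e\<close> evaluates to \<open>v\<close> in exactly
  \<open>t\<close> steps. Nonterminating or ill-formed evaluations have no derivation.\<close>

inductive eval :: "program \<Rightarrow> data list \<Rightarrow> expr \<Rightarrow> data \<Rightarrow> nat \<Rightarrow> bool"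
  and evals :: "program \<Rightarrow> data list \<Rightarrow> expr list \<Rightarrow> data list \<Rightarrow> nat \<Rightarrow> bool"
  for P :: program
where
  eval_Var: "i < length \<rho> \<Longrightarrow> eval P \<rho> (Var i) (\<rho> ! i) 1"
| eval_Atom: "eval P \<rho> EAtom Atom 1"
| eval_Pair: "eval P \<rho> a v s \<Longrightarrow> eval P \<rho> b w t \<Longrightarrow> eval P \<rho> (EPair a b) (Pair v w) (Suc (s + t))"
| eval_Fst: "eval P \<rho> a v t \<Longrightarrow> eval P \<rho> (EFst a) (data_fst v) (Suc t)"
| eval_Snd: "eval P \<rho> a v t \<Longrightarrow> eval P \<rho> (ESnd a) (data_snd v) (Suc t)"
| eval_If_true: "eval P \<rho> c u s \<Longrightarrow> u \<noteq> Atom \<Longrightarrow> eval P \<rho> a v t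
    \<Longrightarrow> eval P \<rho> (EIf c a b) v (Suc (s + t))"
| eval_If_false: "eval P \<rho> c Atom s \<Longrightarrow> eval P \<rho> b v t \<Longrightarrow> eval P \<rho> (EIf c a b) v (Suc (s + t))"
| eval_Call: "evals P \<rho> es vs s \<Longrightarrow> i < length P \<Longrightarrow> eval P vs (P ! i) v t
    \<Longrightarrow> eval P \<rho> (ECall i es) v (Suc (s + t))"
| evals_Nil: "evals P \<rho> [] [] 0"
| evals_Cons: "eval P \<rho> e v s \<Longrightarrow> evals P \<rho> es vs t \<Longrightarrow> evals P \<rho> (e # es) (v # vs) (s + t)"

inductive_cases eval_VarE: "eval P \<rho> (Var i) v t"
inductive_cases eval_AtomE: "eval P \<rho> EAtom v t"
inductive_cases eval_PairE: "eval P \<rho> (EPair a b) v t"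
inductive_cases eval_FstE: "eval P \<rho> (EFst a) v t"
inductive_cases eval_SndE: "eval P \<rho> (ESnd a) v t"
inductive_cases eval_IfE: "eval P \<rho> (EIf c a b) v t"
inductive_cases eval_CallE: "eval P \<rho> (ECall i es) v t"
inductive_cases evals_NilE: "evals P \<rho> [] vs t"
inductive_cases evals_ConsE: "evals P \<rho> (e # es) vs t"

text \<open>Evaluation is deterministic, so result and step count are functions of the input.\<close>

lemma eval_deterministic:
  "eval P \<rho> e v t \<Longrightarrow> eval P \<rho> e v' t' \<Longrightarrow> v = v' \<and> t = t'"
  "evals P \<rho> es vs t \<Longrightarrow> evals P \<rho> es vs' t' \<Longrightarrow> vs = vs' \<and> t = t'"
proof (induction arbitrary: v' t' and vs' t' rule: eval_evals.inducts)
  case (eval_Var i \<rho>) then show ?case by (auto elim: eval_VarE)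
next
  case (eval_Atom \<rho>) then show ?case by (auto elim: eval_AtomE)
next
  case (eval_Pair \<rho> a v s b w t) then show ?case by (blast elim: eval_PairE)
next
  case (eval_Fst \<rho> a v t) then show ?case by (blast elim: eval_FstE)
next
  case (eval_Snd \<rho> a v t) then show ?case by (blast elim: eval_SndE)
next
  case (eval_If_true \<rho> c u s a v t b)
  from eval_If_true.prems show ?case
    by (rule eval_IfE) (use eval_If_true in blast)+
next
  case (eval_If_false \<rho> c s b v t a)
  from eval_If_false.prems show ?case
    by (rule eval_IfE) (use eval_If_false in blast)+
next
  case (eval_Call \<rho> es vs s i v t) then show ?case by (blast elim: eval_CallE)
next
  case (evals_Nil \<rho>) then show ?case by (auto elim: evals_NilE)
next
  case (evals_Cons \<rho> e v s es vs t) then show ?case by (blast elim: evals_ConsE)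
qed

text \<open>Function \<open>0\<close> is the entry point.\<close>

definition computes_in :: "program \<Rightarrow> data \<Rightarrow> data \<Rightarrow> nat \<Rightarrow> bool" where
  "computes_in P x y t \<longleftrightarrow> eval P [x] (ECall 0 [Var 0]) y t"

section \<open>Encoding of instances\<close>

fun enc_nat :: "nat \<Rightarrow> data" where
  "enc_nat 0 = Atom"
| "enc_nat (Suc n) = Pair Atom (enc_nat n)"

definition enc_bool :: "bool \<Rightarrow> data" where
  "enc_bool b = (if b then Pair Atom Atom else Atom)"

fun enc_list :: "('a \<Rightarrow> data) \<Rightarrow> 'a list \<Rightarrow> data" where
  "enc_list f [] = Atom"
| "enc_list f (x # xs) = Pair (f x) (enc_list f xs)"

text \<open>An input graph has vertices \<open>0, \<dots>, m - 1\<close> and is given by its adjacency matrix.\<close>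

definition input_graph :: "nat graph \<Rightarrow> bool" where
  "input_graph G \<longleftrightarrow> simple_graph G \<and> verts G = {..<card (verts G)}"

definition adj_matrix :: "nat graph \<Rightarrow> bool list list" where
  "adj_matrix G = (let m = card (verts G) in
     map (\<lambda>i. map (\<lambda>j. {i, j} \<in> edges G) [0..<m]) [0..<m])"

definition enc_graph :: "nat graph \<Rightarrow> data" where
  "enc_graph G = enc_list (enc_list enc_bool) (adj_matrix G)"

text \<open>\<open>runs_within T t G\<^sub>1 G\<^sub>2\<close>: the step count \<open>t\<close> obeys the bound \<open>T k n\<close> for every \<open>k\<close> that
  bounds the component sizes of both graphs, where \<open>n\<close> is their total number of vertices.\<close>

definition runs_within :: "(nat \<Rightarrow> nat \<Rightarrow> real) \<Rightarrow> nat \<Rightarrow> nat graph \<Rightarrow> nat graph \<Rightarrow> bool" where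
  "runs_within T t G\<^sub>1 G\<^sub>2 \<longleftrightarrow> (\<forall>k. (\<forall>C \<in> components G\<^sub>1 \<union> components G\<^sub>2. card C \<le> k)
     \<longrightarrow> real t \<le> T k (card (verts G\<^sub>1) + card (verts G\<^sub>2)))"

definition optimizes_within :: "program \<Rightarrow> (nat \<Rightarrow> nat \<Rightarrow> real) \<Rightarrow> bool" where
  "optimizes_within P T \<longleftrightarrow> (\<forall>G\<^sub>1 G\<^sub>2. input_graph G\<^sub>1 \<and> input_graph G\<^sub>2 \<longrightarrow>
     (\<exists>t. computes_in P (Pair (enc_graph G\<^sub>1) (enc_graph G\<^sub>2)) (enc_nat (mcsf_optimum G\<^sub>1 G\<^sub>2)) t
        \<and> runs_within T t G\<^sub>1 G\<^sub>2))"

definition decides_within :: "program \<Rightarrow> (nat \<Rightarrow> nat \<Rightarrow> real) \<Rightarrow> bool" where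
  "decides_within P T \<longleftrightarrow> (\<forall>G\<^sub>1 G\<^sub>2 h. input_graph G\<^sub>1 \<and> input_graph G\<^sub>2 \<longrightarrow>
     (\<exists>t. computes_in P (Pair (Pair (enc_graph G\<^sub>1) (enc_graph G\<^sub>2)) (enc_nat h))
             (enc_bool (mcsf_decision G\<^sub>1 G\<^sub>2 h)) t
        \<and> runs_within T t G\<^sub>1 G\<^sub>2))"

end

theory Submission
  imports Defs "HOL-Library.Multiset"
begin

text \<open>
  A star forest in a graph is an idempotent map sending each vertex to itself or to a neighbour;
  two star forests agree iff, for every \<open>j\<close>, they have equally many centres with more than \<open>j\<close>
  leaves. Each component of the first graph thus offers a finite set of vectors, each component
  of the second graph a set of negated vectors, and the task is to choose one vector per component
  so that the sum is zero and the number of covered vertices is maximal.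

  Two components that offer the same set are interchangeable, so in a list of components in which
  equal sets are adjacent one may also assume that equal choices are adjacent. Splitting such a list
  into its elements at odd and at even positions then yields two sums whose difference is at most the
  sum \<open>B\<close> of the sizes of all distinct offers. Hence a divide-and-conquer search that keeps only partial
  sums in the box \<open>[-B, B]\<close> loses no solution. As a component of size at most \<open>k\<close> offers one of at most
  \<open>2 ^ 2 ^ O(k\<^sup>2)\<close> lists of vectors of length at most \<open>k\<close>, both \<open>B\<close> and the number of states are
  within the bound.
\<close>

section \<open>Denotation and cost of programs\<close>

text \<open>A partial sum has up to k coordinates, each of which may grow with the number of
  components, so a table of all partial sums could have about n^k entries. The box therefore needs a
  radius that depends on k alone and survives the recursion. If a total lies in [-B, B] and the two
  halves of a choice differ by at most B, then each half lies in [-B, B] too, with the same B.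
  Taking every other element does not increase the bound on the difference either, because it can
  only shorten, merge or delete runs of equal choices. Regrouped choices occur in the completeness
  proof alone; the algorithm merely keeps equal offers adjacent.

  The second power of two comes from the number of possible offers: a component has at most (k +
  1)^k maps, and an offer is a list of that many vectors, so the number of vectors is raised to a
  power that is itself exponential.

  Covered vertices are counted in the first graph only, since equal star sizes force the same number
  in the second.\<close>

fun den :: "(nat \<Rightarrow> data list \<Rightarrow> data) \<Rightarrow> data list \<Rightarrow> expr \<Rightarrow> data" where
  "den F \<rho> (Var i) = \<rho> ! i"
| "den F \<rho> EAtom = Atom"
| "den F \<rho> (EPair a b) = Pair (den F \<rho> a) (den F \<rho> b)"
| "den F \<rho> (EFst a) = data_fst (den F \<rho> a)"
| "den F \<rho> (ESnd a) = data_snd (den F \<rho> a)"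
| "den F \<rho> (EIf c a b) = (if den F \<rho> c = Atom then den F \<rho> b else den F \<rho> a)"
| "den F \<rho> (ECall i es) = F i (map (den F \<rho>) es)"

fun cost :: "(nat \<Rightarrow> data list \<Rightarrow> data) \<Rightarrow> (nat \<Rightarrow> data list \<Rightarrow> nat) \<Rightarrow> data list \<Rightarrow> expr \<Rightarrow> nat" where
  "cost F C \<rho> (Var i) = 1"
| "cost F C \<rho> EAtom = 1"
| "cost F C \<rho> (EPair a b) = Suc (cost F C \<rho> a + cost F C \<rho> b)"
| "cost F C \<rho> (EFst a) = Suc (cost F C \<rho> a)"
| "cost F C \<rho> (ESnd a) = Suc (cost F C \<rho> a)"
| "cost F C \<rho> (EIf c a b) =
     Suc (cost F C \<rho> c + (if den F \<rho> c = Atom then cost F C \<rho> b else cost F C \<rho> a))"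
| "cost F C \<rho> (ECall i es) =
     Suc (sum_list (map (cost F C \<rho>) es) + C i (map (den F \<rho>) es))"

text \<open>\<open>den\<close> and \<open>cost\<close> are total and read \<open>\<rho> ! i\<close>
  even out of range, where \<open>eval\<close> is stuck. This check closes the gap, and fixing the
  arity at each call carries it into the bodies.\<close>

fun well_scoped :: "nat list \<Rightarrow> nat \<Rightarrow> expr \<Rightarrow> bool" where
  "well_scoped ar r (Var i) \<longleftrightarrow> i < r"
| "well_scoped ar r EAtom \<longleftrightarrow> True"
| "well_scoped ar r (EPair a b) \<longleftrightarrow> well_scoped ar r a \<and> well_scoped ar r b"
| "well_scoped ar r (EFst a) \<longleftrightarrow> well_scoped ar r a"
| "well_scoped ar r (ESnd a) \<longleftrightarrow> well_scoped ar r a"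
| "well_scoped ar r (EIf c a b) \<longleftrightarrow> well_scoped ar r c \<and> well_scoped ar r a \<and> well_scoped ar r b"
| "well_scoped ar r (ECall i es) \<longleftrightarrow>
     i < length ar \<and> length es = ar ! i \<and> (\<forall>e\<in>set es. well_scoped ar r e)"

lemma evals_of_eval:
  assumes "\<And>e. e \<in> set es \<Longrightarrow> \<exists>t\<le>c e. eval P \<rho> e (d e) t"
  shows "\<exists>t\<le>sum_list (map c es). evals P \<rho> es (map d es) t"
  using assms
proof (induction es)
  case Nil
  then show ?case by (auto intro: evals_Nil)
next
  case (Cons e es)
  obtain t where "t \<le> c e" "eval P \<rho> e (d e) t" using Cons.prems by auto
  moreover obtain s where "s \<le> sum_list (map c es)" "evals P \<rho> es (map d es) s"
    using Cons by auto
  ultimately show ?case by (auto intro!: exI[of _ "t + s"] evals_Cons)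
qed

text \<open>A cost bound that dominates the cost of every body is also a termination measure.\<close>

lemma eval_of_den:
  assumes len: "length ar = length P"
    and scoped: "\<And>i. i < length P \<Longrightarrow> well_scoped ar (ar ! i) (P ! i)"
    and den: "\<And>i vs. i < length P \<Longrightarrow> length vs = ar ! i \<Longrightarrow> F i vs = den F vs (P ! i)"
    and cost: "\<And>i vs. i < length P \<Longrightarrow> length vs = ar ! i \<Longrightarrow> cost F C vs (P ! i) \<le> C i vs"
    and i: "i < length P" "length vs = ar ! i"
  shows "\<exists>t\<le>C i vs. eval P vs (P ! i) (F i vs) t"
  using i
proof (induction "C i vs" arbitrary: i vs rule: less_induct)
  case less
  have "\<exists>t\<le>cost F C vs e. eval P vs e (den F vs e) t"
    if "well_scoped ar (length vs) e" "cost F C vs e \<le> C i vs" for e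
    using that
  proof (induction e)
    case (Var x)
    then show ?case by (auto intro!: exI[of _ 1] eval_Var)
  next
    case EAtom
    then show ?case by (auto intro!: exI[of _ 1] eval_Atom)
  next
    case (EPair a b)
    then obtain s t where "s \<le> cost F C vs a" "eval P vs a (den F vs a) s"
      "t \<le> cost F C vs b" "eval P vs b (den F vs b) t" by auto
    then show ?case by (auto intro!: exI[of _ "Suc (s + t)"] eval_Pair)
  next
    case (EFst a)
    then obtain s where "s \<le> cost F C vs a" "eval P vs a (den F vs a) s" by auto
    then show ?case by (auto intro!: exI[of _ "Suc s"] eval_Fst)
  next
    case (ESnd a)
    then obtain s where "s \<le> cost F C vs a" "eval P vs a (den F vs a) s" by auto
    then show ?case by (auto intro!: exI[of _ "Suc s"] eval_Snd)
  next
    case (EIf c a b)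
    then obtain s where s: "s \<le> cost F C vs c" "eval P vs c (den F vs c) s" by auto
    show ?case
    proof (cases "den F vs c = Atom")
      case True
      then obtain t where "t \<le> cost F C vs b" "eval P vs b (den F vs b) t" using EIf by auto
      then show ?thesis using s True by (auto intro!: exI[of _ "Suc (s + t)"] eval_If_false)
    next
      case False
      then obtain t where "t \<le> cost F C vs a" "eval P vs a (den F vs a) t" using EIf by auto
      then show ?thesis using s False by (auto intro!: exI[of _ "Suc (s + t)"] eval_If_true)
    qed
  next
    case (ECall j es)
    have "\<exists>t\<le>cost F C vs e. eval P vs e (den F vs e) t" if "e \<in> set es" for e
    proof -
      have "cost F C vs e \<le> sum_list (map (cost F C vs) es)"
        using that by (intro member_le_sum_list) auto
      then show ?thesis using ECall that by auto
    qed
    from evals_of_eval[OF this]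
    obtain s where s: "s \<le> sum_list (map (cost F C vs) es)"
      "evals P vs es (map (den F vs) es) s" by auto
    \<comment> \<open>\<open>cost\<close> charges one step for the call on top of the bound of the
      callee, so the callee is strictly smaller in the measure.\<close>
    have "C j (map (den F vs) es) < C i vs" "j < length P" "length (map (den F vs) es) = ar ! j"
      using ECall.prems len by auto
    from less.hyps[OF this] obtain t where "t \<le> C j (map (den F vs) es)"
      "eval P (map (den F vs) es) (P ! j) (F j (map (den F vs) es)) t" by auto
    then show ?case using s \<open>j < length P\<close>
      by (auto intro!: exI[of _ "Suc (s + t)"] eval_Call)
  qed
  from this[of "P ! i"] show ?case
    using scoped[OF less.prems(1)] den[OF less.prems] cost[OF less.prems] less.prems
    by (metis le_trans)
qed

section \<open>The program\<close>

text \<open>Every datum is a list of data, so all functions below get total specifications.\<close>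

fun dlist :: "data \<Rightarrow> data list" where
  "dlist Atom = []"
| "dlist (Pair a b) = a # dlist b"

fun dl :: "data list \<Rightarrow> data" where
  "dl [] = Atom"
| "dl (a # xs) = Pair a (dl xs)"

lemma dl_dlist [simp]: "dl (dlist d) = d"
  by (induction d) auto

lemma dlist_dl [simp]: "dlist (dl xs) = xs"
  by (induction xs) auto

lemma dl_eq_iff [simp]: "dl xs = dl ys \<longleftrightarrow> xs = ys"
  by (metis dlist_dl)

lemma dlist_eq_Nil_iff [simp]: "dlist d = [] \<longleftrightarrow> d = Atom"
  by (cases d) auto

lemma dl_eq_Atom_iff [simp]: "dl xs = Atom \<longleftrightarrow> xs = []"
  by (cases xs) auto

lemma dlist_inject: "dlist a = dlist b \<longleftrightarrow> a = b"
  by (metis dl_dlist)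

abbreviation dlen :: "data \<Rightarrow> nat" where "dlen d \<equiv> length (dlist d)"

fun pairs :: "data \<Rightarrow> nat" where
  "pairs Atom = 0"
| "pairs (Pair a b) = Suc (pairs a + pairs b)"

lemma enc_bool_eq_Atom_iff [simp]: "enc_bool b = Atom \<longleftrightarrow> \<not> b"
  by (simp add: enc_bool_def)

lemma enc_bool_simps [simp]: "enc_bool True = Pair Atom Atom" "enc_bool False = Atom"
  by (simp_all add: enc_bool_def)

section \<open>Connected components from an adjacency matrix\<close>

fun d_nth :: "data \<Rightarrow> data \<Rightarrow> data" where
  "d_nth L Atom = data_fst L"
| "d_nth L (Pair a i) = d_nth (data_snd L) i"

definition d_app :: "data \<Rightarrow> data \<Rightarrow> data" where
  "d_app x y = dl (dlist x @ dlist y)"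

definition d_adj :: "data \<Rightarrow> data \<Rightarrow> data \<Rightarrow> bool" where
  "d_adj M u v \<longleftrightarrow> d_nth (d_nth M u) v \<noteq> Atom"

definition touches :: "data \<Rightarrow> data \<Rightarrow> data \<Rightarrow> bool" where
  "touches M v b \<longleftrightarrow> (\<exists>u\<in>set (dlist b). d_adj M v u)"

text \<open>One round of building components incrementally: \<open>v\<close> joins all blocks that
  contain one of its neighbours. Joined blocks are collected in \<open>acc\<close>, untouched ones
  in \<open>rest\<close>.\<close>

fun d_merge :: "data \<Rightarrow> data \<Rightarrow> data \<Rightarrow> data \<Rightarrow> data \<Rightarrow> data" where
  "d_merge M v Atom acc rest = Pair acc rest"
| "d_merge M v (Pair b bs) acc rest =
    (if touches M v b then d_merge M v bs (d_app b acc) rest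
     else d_merge M v bs acc (Pair b rest))"

text \<open>The second argument acts as a counter: one round per row of the matrix, with the current
  vertex \<open>i\<close> kept beside it in unary.\<close>

fun d_build :: "data \<Rightarrow> data \<Rightarrow> data \<Rightarrow> data \<Rightarrow> data" where
  "d_build M Atom i bs = bs"
| "d_build M (Pair r rows) i bs =
    d_build M rows (Pair Atom i) (d_merge M i bs (Pair i Atom) Atom)"

section \<open>Enumerating the maps of a block\<close>

definition d_consall :: "data \<Rightarrow> data \<Rightarrow> data \<Rightarrow> data" where
  "d_consall x as acc = dl (map (Pair x) (dlist as) @ dlist acc)"

definition d_ext :: "data \<Rightarrow> data \<Rightarrow> data \<Rightarrow> data \<Rightarrow> data" where
  "d_ext M u cs as =
    dl (concat (map (\<lambda>c. map (Pair (Pair u c)) (dlist as))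
          (filter (\<lambda>c. u = c \<or> d_adj M u c) (dlist cs))))"

text \<open>The base value \<open>Pair Atom Atom\<close> is the list whose only member is the empty
  map. The images \<open>b\<close> stay fixed while the domain shrinks, hence two arguments that
  start out equal.\<close>

fun d_assigns :: "data \<Rightarrow> data \<Rightarrow> data \<Rightarrow> data" where
  "d_assigns M Atom b = Pair Atom Atom"
| "d_assigns M (Pair u us) b = d_ext M u b (d_assigns M us b)"

text \<open>Again two arguments that start out equal: the recursion consumes \<open>a\<close>, while
  \<open>a0\<close> remains the whole map, in which every image has to occur as a fixed
  point.\<close>

definition idem :: "data \<Rightarrow> data \<Rightarrow> bool" where
  "idem a a0 \<longleftrightarrow> (\<forall>x\<in>set (dlist a). Pair (data_snd x) (data_snd x) \<in> set (dlist a0))"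

text \<open>An entry of a vector is an integer, represented as the difference of a pair of unary numbers.\<close>

fun d_norm :: "data \<Rightarrow> data \<Rightarrow> data" where
  "d_norm (Pair a p) (Pair b q) = d_norm p q"
| "d_norm p q = Pair p q"

fun d_addvec :: "data \<Rightarrow> data \<Rightarrow> data" where
  "d_addvec Atom y = y"
| "d_addvec x Atom = x"
| "d_addvec (Pair a x) (Pair b y) =
    Pair (d_norm (d_app (data_fst a) (data_fst b)) (d_app (data_snd a) (data_snd b)))
      (d_addvec x y)"

section \<open>Vector and weight of a map\<close>

definition leaves :: "data \<Rightarrow> data \<Rightarrow> nat" where
  "leaves v a = length (filter (\<lambda>x. data_snd x = v \<and> data_fst x \<noteq> v) (dlist a))"

text \<open>A step vector with one unit per leaf of \<open>v\<close>. Summed over all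
  \<open>v\<close>, entry \<open>j\<close> counts the centres with more than \<open>j\<close>
  leaves.\<close>

definition d_leafvec :: "data \<Rightarrow> data \<Rightarrow> data \<Rightarrow> data" where
  "d_leafvec one v a = dl (replicate (leaves v a) one)"

fun d_vecs :: "data \<Rightarrow> data \<Rightarrow> data \<Rightarrow> data" where
  "d_vecs one Atom a0 = Atom"
| "d_vecs one (Pair x a) a0 = d_addvec (d_leafvec one (data_fst x) a0) (d_vecs one a a0)"

text \<open>The unit also switches the counting on and off: its first part has length one for the
  first graph and zero for the second.\<close>

fun d_wcount :: "data \<Rightarrow> data \<Rightarrow> data \<Rightarrow> data" where
  "d_wcount one Atom a0 = Atom"
| "d_wcount one (Pair x a) a0 =
    (if data_fst x \<noteq> data_snd x \<or> leaves (data_fst x) a0 > 0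
     then d_app (data_fst one) (d_wcount one a a0) else d_wcount one a a0)"

definition d_option :: "data \<Rightarrow> data \<Rightarrow> data" where
  "d_option one a = Pair (d_wcount one a a) (d_vecs one a a)"

definition d_opts :: "data \<Rightarrow> data \<Rightarrow> data" where
  "d_opts one as = dl (map (d_option one) (filter (\<lambda>a. idem a a) (dlist as)))"

section \<open>Grouped lists of offers and the radius of the box\<close>

fun ginsert :: "'a \<Rightarrow> 'a list \<Rightarrow> 'a list" where
  "ginsert x [] = [x]"
| "ginsert x (y # ys) = (if y = x then x # y # ys else y # ginsert x ys)"

definition d_ginsert :: "data \<Rightarrow> data \<Rightarrow> data" where
  "d_ginsert x L = dl (ginsert x (dlist L))"

definition block_opts :: "data \<Rightarrow> data \<Rightarrow> data \<Rightarrow> data" where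
  "block_opts M one b = d_opts one (d_assigns M b b)"

fun d_optlists :: "data \<Rightarrow> data \<Rightarrow> data \<Rightarrow> data \<Rightarrow> data" where
  "d_optlists M one Atom L = L"
| "d_optlists M one (Pair b bs) L = d_ginsert (block_opts M one b) (d_optlists M one bs L)"

definition d_size :: "data \<Rightarrow> data \<Rightarrow> data" where
  "d_size d acc = dl (replicate (pairs d) Atom @ dlist acc)"

text \<open>In a grouped list, comparing each element with the next counts every offer once, at the
  end of its group. At the end of the list the comparison is with
  \<open>data_fst Atom = Atom\<close>, which can skip only the offer \<open>Atom\<close>, of size
  zero.\<close>

fun d_bound :: "data \<Rightarrow> data" where
  "d_bound Atom = Atom"
| "d_bound (Pair x L) = (if x = data_fst L then d_bound L else d_size x (d_bound L))"

fun odds :: "'a list \<Rightarrow> 'a list" where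
  "odds [] = []"
| "odds [x] = [x]"
| "odds (x # y # xs) = x # odds xs"

definition d_odds :: "data \<Rightarrow> data" where
  "d_odds L = dl (odds (dlist L))"

section \<open>Search for sums inside the box\<close>

definition in_box :: "data \<Rightarrow> data \<Rightarrow> bool" where
  "in_box B v \<longleftrightarrow> (\<forall>e\<in>set (dlist v). dlen (data_fst e) \<le> dlen B \<and> dlen (data_snd e) \<le> dlen B)"

definition d_insert :: "data \<Rightarrow> data \<Rightarrow> data \<Rightarrow> data" where
  "d_insert B u acc = (if in_box B (data_snd u) \<and> u \<notin> set (dlist acc) then Pair u acc else acc)"

definition d_add :: "data \<Rightarrow> data \<Rightarrow> data" where
  "d_add s t = Pair (d_app (data_fst s) (data_fst t)) (d_addvec (data_snd s) (data_snd t))"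

fun d_comb1 :: "data \<Rightarrow> data \<Rightarrow> data \<Rightarrow> data \<Rightarrow> data" where
  "d_comb1 B s Atom acc = acc"
| "d_comb1 B s (Pair t T) acc = d_comb1 B s T (d_insert B (d_add s t) acc)"

fun d_comb :: "data \<Rightarrow> data \<Rightarrow> data \<Rightarrow> data \<Rightarrow> data" where
  "d_comb B Atom T acc = acc"
| "d_comb B (Pair s S) T acc = d_comb B S T (d_comb1 B s T acc)"

lemma length_odds: "length (odds xs) = Suc (length xs) div 2"
  by (induction xs rule: odds.induct) auto

lemma dlen_odds_less:
  assumes "data_snd L \<noteq> Atom"
  shows "dlen (d_odds L) < dlen L" "dlen (d_odds (data_snd L)) < dlen L"
  using assms by (cases L; cases "data_snd L"; auto simp: d_odds_def length_odds)+

text \<open>A single component passes its offer on unfiltered; the box test acts on sums. The empty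
  list yields no state, although the empty choice exists, so it is a separate case in the
  correctness proof.\<close>

function d_solve :: "data \<Rightarrow> data \<Rightarrow> data" where
  "d_solve B L = (if data_snd L = Atom then data_fst L
     else d_comb B (d_solve B (d_odds L)) (d_solve B (d_odds (data_snd L))) Atom)"
  by auto
termination by (relation "measure (\<lambda>(B, L). dlen L)") (auto dest: dlen_odds_less)
declare d_solve.simps [simp del]

definition zero_vec :: "data \<Rightarrow> bool" where
  "zero_vec v \<longleftrightarrow> (\<forall>e\<in>set (dlist v). data_fst e = Atom \<and> data_snd e = Atom)"

fun d_best :: "data \<Rightarrow> data \<Rightarrow> data" where
  "d_best Atom acc = acc"
| "d_best (Pair s S) acc =
    d_best S (if zero_vec (data_snd s) \<and> dlen acc \<le> dlen (data_fst s) then data_fst s else acc)"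

definition d_optimum :: "data \<Rightarrow> data" where
  "d_optimum L = d_best (d_solve (d_bound L) L) Atom"

text \<open>The differences 1 - 0 and 0 - 1. Opposite signs for the two graphs turn equality of the
  counts into a vanishing sum.\<close>

definition pos_one :: data where "pos_one = Pair (Pair Atom Atom) Atom"
definition neg_one :: data where "neg_one = Pair Atom (Pair Atom Atom)"

definition d_types :: "data \<Rightarrow> data \<Rightarrow> data" where
  "d_types M1 M2 = d_optlists M1 pos_one (d_build M1 M1 Atom Atom)
     (d_optlists M2 neg_one (d_build M2 M2 Atom Atom) Atom)"

text \<open>Step bounds of the functions whose cost is not bounded by a simple polynomial in the input
  sizes; the closed forms of the others are in \<open>time_table\<close>. All constants are generous.\<close>

fun t_build :: "data \<Rightarrow> data \<Rightarrow> data \<Rightarrow> data \<Rightarrow> nat" where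
  "t_build M Atom i bs = 10"
| "t_build M (Pair r rows) i bs = 100 + 300 * (pairs i + 1) * (pairs bs + 1)
    + t_build M rows (Pair Atom i) (d_merge M i bs (Pair i Atom) Atom)"

fun t_assigns :: "data \<Rightarrow> data \<Rightarrow> data \<Rightarrow> nat" where
  "t_assigns M Atom b = 10"
| "t_assigns M (Pair u us) b = 20 + t_assigns M us b
    + 300 * (pairs u + pairs (d_assigns M us b) + 1) * (pairs b + 1)"

fun t_vecs :: "data \<Rightarrow> data \<Rightarrow> data \<Rightarrow> nat" where
  "t_vecs one Atom a0 = 10"
| "t_vecs one (Pair x a) a0 = 100 + t_vecs one a a0 + 300 * (pairs a0 + 1)
    + 300 * (pairs (d_leafvec one (data_fst x) a0) + pairs (d_vecs one a a0) + 1)"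

fun t_opts :: "data \<Rightarrow> data \<Rightarrow> nat" where
  "t_opts one Atom = 10"
| "t_opts one (Pair a as) = 50 + 300 * (pairs a + 1) * (pairs a + 1)
    + 1000 * (pairs one + pairs a + 1) * (pairs a + 1) + t_vecs one a a + t_opts one as"

fun t_optlists :: "data \<Rightarrow> data \<Rightarrow> data \<Rightarrow> data \<Rightarrow> nat" where
  "t_optlists M one Atom L = 10"
| "t_optlists M one (Pair b bs) L = 50 + t_assigns M b b + t_opts one (d_assigns M b b)
    + t_optlists M one bs L + 100 * (pairs (d_optlists M one bs L) + 1)"

fun t_comb1 :: "data \<Rightarrow> data \<Rightarrow> data \<Rightarrow> data \<Rightarrow> nat" where
  "t_comb1 B s Atom acc = 10"
| "t_comb1 B s (Pair t T) acc = 100 + 1000 * (pairs s + pairs t + pairs acc + 1)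
    + t_comb1 B s T (d_insert B (d_add s t) acc)"

fun t_comb :: "data \<Rightarrow> data \<Rightarrow> data \<Rightarrow> data \<Rightarrow> nat" where
  "t_comb B Atom T acc = 10"
| "t_comb B (Pair s S) T acc = 30 + t_comb1 B s T acc + t_comb B S T (d_comb1 B s T acc)"

function t_solve :: "data \<Rightarrow> data \<Rightarrow> nat" where
  "t_solve B L = (if data_snd L = Atom then 30 else 100 + 300 * (pairs L + 1)
     + t_solve B (d_odds L) + t_solve B (d_odds (data_snd L))
     + t_comb B (d_solve B (d_odds L)) (d_solve B (d_odds (data_snd L))) Atom)"
  by auto
termination by (relation "measure (\<lambda>(B, L). dlen L)") (auto dest: dlen_odds_less)
declare t_solve.simps [simp del]

definition t_optimum :: "data \<Rightarrow> nat" where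
  "t_optimum L = 100 + 300 * (pairs L + 1) + t_solve (d_bound L) L
     + 200 * (pairs (d_solve (d_bound L) L) + 1)"

definition t_types :: "data \<Rightarrow> data \<Rightarrow> nat" where
  "t_types M1 M2 = 100 + t_build M1 M1 Atom Atom + t_build M2 M2 Atom Atom
     + t_optlists M2 neg_one (d_build M2 M2 Atom Atom) Atom
     + t_optlists M1 pos_one (d_build M1 M1 Atom Atom)
         (d_optlists M2 neg_one (d_build M2 M2 Atom Atom) Atom)"

text \<open>Function \<open>0\<close> is the main function, so entry \<open>i\<close> of the tables and of the library belongs to
  function \<open>i + 1\<close>.\<close>

definition sem_table :: "(data list \<Rightarrow> data) list" where
  "sem_table = [
    \<lambda>v. d_app (v!0) (v!1),
    \<lambda>v. enc_bool (v!0 = v!1),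
    \<lambda>v. enc_bool (dlen (v!0) \<le> dlen (v!1)),
    \<lambda>v. d_nth (v!0) (v!1),
    \<lambda>v. enc_bool (touches (v!0) (v!1) (v!2)),
    \<lambda>v. d_merge (v!0) (v!1) (v!2) (v!3) (v!4),
    \<lambda>v. d_build (v!0) (v!1) (v!2) (v!3),
    \<lambda>v. d_consall (v!0) (v!1) (v!2),
    \<lambda>v. d_ext (v!0) (v!1) (v!2) (v!3),
    \<lambda>v. d_assigns (v!0) (v!1) (v!2),
    \<lambda>v. enc_bool (v!0 \<in> set (dlist (v!1))),
    \<lambda>v. enc_bool (idem (v!0) (v!1)),
    \<lambda>v. d_norm (v!0) (v!1),
    \<lambda>v. d_addvec (v!0) (v!1),
    \<lambda>v. d_leafvec (v!0) (v!1) (v!2),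
    \<lambda>v. d_vecs (v!0) (v!1) (v!2),
    \<lambda>v. d_wcount (v!0) (v!1) (v!2),
    \<lambda>v. d_opts (v!0) (v!1),
    \<lambda>v. d_ginsert (v!0) (v!1),
    \<lambda>v. d_optlists (v!0) (v!1) (v!2) (v!3),
    \<lambda>v. d_size (v!0) (v!1),
    \<lambda>v. d_bound (v!0),
    \<lambda>v. d_odds (v!0),
    \<lambda>v. enc_bool (in_box (v!0) (v!1)),
    \<lambda>v. d_insert (v!0) (v!1) (v!2),
    \<lambda>v. d_comb1 (v!0) (v!1) (v!2) (v!3),
    \<lambda>v. d_comb (v!0) (v!1) (v!2) (v!3),
    \<lambda>v. d_solve (v!0) (v!1),
    \<lambda>v. enc_bool (zero_vec (v!0)),
    \<lambda>v. d_best (v!0) (v!1),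
    \<lambda>v. d_optimum (v!0),
    \<lambda>v. d_optimum (d_types (v!0) (v!1))]"

definition time_table :: "(data list \<Rightarrow> nat) list" where
  "time_table = [
    \<lambda>v. 20 * (pairs (v!0) + 1),
    \<lambda>v. 40 * pairs (v!0) + 20,
    \<lambda>v. 20 * (min (pairs (v!0)) (pairs (v!1)) + 1),
    \<lambda>v. 20 * (pairs (v!1) + 1),
    \<lambda>v. 100 * (pairs (v!1) + 1) * (pairs (v!2) + 1),
    \<lambda>v. 200 * (pairs (v!1) + 1) * (pairs (v!2) + 1),
    \<lambda>v. t_build (v!0) (v!1) (v!2) (v!3),
    \<lambda>v. 20 * (pairs (v!1) + 1),
    \<lambda>v. 300 * (pairs (v!1) + pairs (v!3) + 1) * (pairs (v!2) + 1),
    \<lambda>v. t_assigns (v!0) (v!1) (v!2),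
    \<lambda>v. 100 * (pairs (v!1) + 1),
    \<lambda>v. 300 * (pairs (v!1) + 1) * (pairs (v!0) + 1),
    \<lambda>v. 20 * (pairs (v!0) + 1),
    \<lambda>v. 300 * (pairs (v!0) + pairs (v!1) + 1),
    \<lambda>v. 300 * (pairs (v!2) + 1),
    \<lambda>v. t_vecs (v!0) (v!1) (v!2),
    \<lambda>v. 1000 * (pairs (v!0) + pairs (v!2) + 1) * (pairs (v!1) + 1),
    \<lambda>v. t_opts (v!0) (v!1),
    \<lambda>v. 100 * (pairs (v!1) + 1),
    \<lambda>v. t_optlists (v!0) (v!1) (v!2) (v!3),
    \<lambda>v. 40 * pairs (v!0) + 20,
    \<lambda>v. 300 * (pairs (v!0) + 1),
    \<lambda>v. 20 * (pairs (v!0) + 1),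
    \<lambda>v. 100 * (pairs (v!1) + 1),
    \<lambda>v. 300 * (pairs (v!1) + pairs (v!2) + 1),
    \<lambda>v. t_comb1 (v!0) (v!1) (v!2) (v!3),
    \<lambda>v. t_comb (v!0) (v!1) (v!2) (v!3),
    \<lambda>v. t_solve (v!0) (v!1),
    \<lambda>v. 40 * (pairs (v!0) + 1),
    \<lambda>v. 200 * (pairs (v!0) + 1),
    \<lambda>v. t_optimum (v!0),
    \<lambda>v. t_types (v!0) (v!1) + t_optimum (d_types (v!0) (v!1))]"

section \<open>Code of the library\<close>

abbreviation "V0 \<equiv> Var 0"
abbreviation "V1 \<equiv> Var 1"
abbreviation "V2 \<equiv> Var 2"
abbreviation "V3 \<equiv> Var 3"
abbreviation "V4 \<equiv> Var 4"
abbreviation "ETrue \<equiv> EPair EAtom EAtom"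
abbreviation "c_app x y \<equiv> ECall 1 [x, y]"
abbreviation "c_eq x y \<equiv> ECall 2 [x, y]"
abbreviation "c_le x y \<equiv> ECall 3 [x, y]"
abbreviation "c_nth x y \<equiv> ECall 4 [x, y]"
abbreviation "c_touches x y z \<equiv> ECall 5 [x, y, z]"
abbreviation "c_merge x y z u v \<equiv> ECall 6 [x, y, z, u, v]"
abbreviation "c_build x y z u \<equiv> ECall 7 [x, y, z, u]"
abbreviation "c_consall x y z \<equiv> ECall 8 [x, y, z]"
abbreviation "c_ext x y z u \<equiv> ECall 9 [x, y, z, u]"
abbreviation "c_assigns x y z \<equiv> ECall 10 [x, y, z]"
abbreviation "c_mem x y \<equiv> ECall 11 [x, y]"
abbreviation "c_idem x y \<equiv> ECall 12 [x, y]"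
abbreviation "c_norm x y \<equiv> ECall 13 [x, y]"
abbreviation "c_addvec x y \<equiv> ECall 14 [x, y]"
abbreviation "c_leafvec x y z \<equiv> ECall 15 [x, y, z]"
abbreviation "c_vecs x y z \<equiv> ECall 16 [x, y, z]"
abbreviation "c_wcount x y z \<equiv> ECall 17 [x, y, z]"
abbreviation "c_opts x y \<equiv> ECall 18 [x, y]"
abbreviation "c_ginsert x y \<equiv> ECall 19 [x, y]"
abbreviation "c_optlists x y z u \<equiv> ECall 20 [x, y, z, u]"
abbreviation "c_size x y \<equiv> ECall 21 [x, y]"
abbreviation "c_bound x \<equiv> ECall 22 [x]"
abbreviation "c_odds x \<equiv> ECall 23 [x]"
abbreviation "c_in_box x y \<equiv> ECall 24 [x, y]"
abbreviation "c_insert x y z \<equiv> ECall 25 [x, y, z]"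
abbreviation "c_comb1 x y z u \<equiv> ECall 26 [x, y, z, u]"
abbreviation "c_comb x y z u \<equiv> ECall 27 [x, y, z, u]"
abbreviation "c_solve x y \<equiv> ECall 28 [x, y]"
abbreviation "c_zero x \<equiv> ECall 29 [x]"
abbreviation "c_best x y \<equiv> ECall 30 [x, y]"
abbreviation "c_optimum x \<equiv> ECall 31 [x]"
abbreviation "c_mcsf x y \<equiv> ECall 32 [x, y]"

definition library :: "(nat \<times> expr) list" where
  "library = [
    (2, EIf V0 (EPair (EFst V0) (c_app (ESnd V0) V1)) V1),
    (2, EIf V0 (EIf V1 (EIf (c_eq (EFst V0) (EFst V1)) (c_eq (ESnd V0) (ESnd V1)) EAtom) EAtom)
          (EIf V1 EAtom ETrue)),
    (2, EIf V0 (EIf V1 (c_le (ESnd V0) (ESnd V1)) EAtom) ETrue),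
    (2, EIf V1 (c_nth (ESnd V0) (ESnd V1)) (EFst V0)),
    (3, EIf V2 (EIf (c_nth (c_nth V0 V1) (EFst V2)) ETrue (c_touches V0 V1 (ESnd V2))) EAtom),
    (5, EIf V2 (EIf (c_touches V0 V1 (EFst V2))
            (c_merge V0 V1 (ESnd V2) (c_app (EFst V2) V3) V4)
            (c_merge V0 V1 (ESnd V2) V3 (EPair (EFst V2) V4)))
          (EPair V3 V4)),
    (4, EIf V1 (c_build V0 (ESnd V1) (EPair EAtom V2) (c_merge V0 V2 V3 (EPair V2 EAtom) EAtom)) V3),
    (3, EIf V1 (EPair (EPair V0 (EFst V1)) (c_consall V0 (ESnd V1) V2)) V2),
    (4, EIf V2 (EIf (EIf (c_eq V1 (EFst V2)) ETrue (c_nth (c_nth V0 V1) (EFst V2)))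
            (c_consall (EPair V1 (EFst V2)) V3 (c_ext V0 V1 (ESnd V2) V3))
            (c_ext V0 V1 (ESnd V2) V3))
          EAtom),
    (3, EIf V1 (c_ext V0 (EFst V1) V2 (c_assigns V0 (ESnd V1) V2)) ETrue),
    (2, EIf V1 (EIf (c_eq (EFst V1) V0) ETrue (c_mem V0 (ESnd V1))) EAtom),
    (2, EIf V0 (EIf (c_mem (EPair (ESnd (EFst V0)) (ESnd (EFst V0))) V1)
            (c_idem (ESnd V0) V1) EAtom) ETrue),
    (2, EIf V0 (EIf V1 (c_norm (ESnd V0) (ESnd V1)) (EPair V0 V1)) (EPair V0 V1)),
    (2, EIf V0 (EIf V1
            (EPair (c_norm (c_app (EFst (EFst V0)) (EFst (EFst V1)))
                (c_app (ESnd (EFst V0)) (ESnd (EFst V1))))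
              (c_addvec (ESnd V0) (ESnd V1)))
            V0) V1),
    (3, EIf V2 (EIf (c_eq (ESnd (EFst V2)) V1)
            (EIf (c_eq (EFst (EFst V2)) V1) (c_leafvec V0 V1 (ESnd V2))
              (EPair V0 (c_leafvec V0 V1 (ESnd V2))))
            (c_leafvec V0 V1 (ESnd V2))) EAtom),
    (3, EIf V1 (c_addvec (c_leafvec V0 (EFst (EFst V1)) V2) (c_vecs V0 (ESnd V1) V2)) EAtom),
    (3, EIf V1 (EIf (EIf (c_eq (EFst (EFst V1)) (ESnd (EFst V1)))
              (c_leafvec V0 (EFst (EFst V1)) V2) ETrue)
            (c_app (EFst V0) (c_wcount V0 (ESnd V1) V2)) (c_wcount V0 (ESnd V1) V2)) EAtom),
    (2, EIf V1 (EIf (c_idem (EFst V1) (EFst V1))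
            (EPair (EPair (c_wcount V0 (EFst V1) (EFst V1)) (c_vecs V0 (EFst V1) (EFst V1)))
              (c_opts V0 (ESnd V1)))
            (c_opts V0 (ESnd V1))) EAtom),
    (2, EIf V1 (EIf (c_eq (EFst V1) V0) (EPair V0 V1) (EPair (EFst V1) (c_ginsert V0 (ESnd V1))))
          (EPair V0 EAtom)),
    (4, EIf V2 (c_ginsert (c_opts V1 (c_assigns V0 (EFst V2) (EFst V2)))
            (c_optlists V0 V1 (ESnd V2) V3)) V3),
    (2, EIf V0 (c_size (EFst V0) (c_size (ESnd V0) (EPair EAtom V1))) V1),
    (1, EIf V0 (EIf (c_eq (EFst V0) (EFst (ESnd V0))) (c_bound (ESnd V0))
            (c_size (EFst V0) (c_bound (ESnd V0)))) EAtom),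
    (1, EIf V0 (EPair (EFst V0) (c_odds (ESnd (ESnd V0)))) EAtom),
    (2, EIf V1 (EIf (c_le (EFst (EFst V1)) V0)
            (EIf (c_le (ESnd (EFst V1)) V0) (c_in_box V0 (ESnd V1)) EAtom) EAtom) ETrue),
    (3, EIf (c_in_box V0 (ESnd V1)) (EIf (c_mem V1 V2) V2 (EPair V1 V2)) V2),
    (4, EIf V2 (c_comb1 V0 V1 (ESnd V2) (c_insert V0
            (EPair (c_app (EFst V1) (EFst (EFst V2))) (c_addvec (ESnd V1) (ESnd (EFst V2)))) V3))
          V3),
    (4, EIf V1 (c_comb V0 (ESnd V1) V2 (c_comb1 V0 (EFst V1) V2 V3)) V3),
    (2, EIf (ESnd V1) (c_comb V0 (c_solve V0 (c_odds V1)) (c_solve V0 (c_odds (ESnd V1))) EAtom)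
          (EFst V1)),
    (1, EIf V0 (EIf (EFst (EFst V0)) EAtom (EIf (ESnd (EFst V0)) EAtom (c_zero (ESnd V0)))) ETrue),
    (2, EIf V0 (c_best (ESnd V0) (EIf (c_zero (ESnd (EFst V0)))
            (EIf (c_le V1 (EFst (EFst V0))) (EFst (EFst V0)) V1) V1)) V1),
    (1, c_best (c_solve (c_bound V0) V0) EAtom),
    (2, c_optimum (c_optlists V0 (EPair ETrue EAtom) (c_build V0 V0 EAtom EAtom)
          (c_optlists V1 (EPair EAtom ETrue) (c_build V1 V1 EAtom EAtom) EAtom)))]"

definition prog :: "expr \<Rightarrow> program" where
  "prog main = main # map snd library"

definition sem :: "(data \<Rightarrow> data) \<Rightarrow> nat \<Rightarrow> data list \<Rightarrow> data" where
  "sem f i vs = (((\<lambda>v. f (v!0)) # sem_table) ! i) vs"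

definition time :: "(data \<Rightarrow> nat) \<Rightarrow> nat \<Rightarrow> data list \<Rightarrow> nat" where
  "time t i vs = (((\<lambda>v. t (v!0)) # time_table) ! i) vs"

text \<open>Quantified over the semantics \<open>f\<close> and the cost \<open>t\<close> of the main
  function, which no library function calls; one verification thus serves both programs.\<close>

definition implements :: "nat \<Rightarrow> nat \<times> expr \<Rightarrow> bool" where
  "implements i b \<longleftrightarrow> (\<forall>f t vs. length vs = fst b \<longrightarrow> sem f i vs = den (sem f) vs (snd b)
     \<and> cost (sem f) (time t) vs (snd b) \<le> time t i vs)"

text \<open>One rule per arity: with named arguments every \<open>vs ! i\<close> simplifies, and
  case analysis on the arguments can start.\<close>

lemma implements1I:
  assumes "b = (1, e)"
    and "\<And>f t x. sem f i [x] = den (sem f) [x] e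
      \<and> cost (sem f) (time t) [x] e \<le> time t i [x]"
  shows "implements i b"
  using assms by (auto simp: implements_def numeral_eq_Suc length_Suc_conv)

lemma implements2I:
  assumes "b = (2, e)"
    and "\<And>f t x y. sem f i [x, y] = den (sem f) [x, y] e
      \<and> cost (sem f) (time t) [x, y] e \<le> time t i [x, y]"
  shows "implements i b"
  using assms by (auto simp: implements_def numeral_eq_Suc length_Suc_conv)

lemma implements3I:
  assumes "b = (3, e)"
    and "\<And>f t x y z. sem f i [x, y, z] = den (sem f) [x, y, z] e
      \<and> cost (sem f) (time t) [x, y, z] e \<le> time t i [x, y, z]"
  shows "implements i b"
  using assms by (auto simp: implements_def numeral_eq_Suc length_Suc_conv)

lemma implements4I:
  assumes "b = (4, e)"
    and "\<And>f t x y z u. sem f i [x, y, z, u] = den (sem f) [x, y, z, u] e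
      \<and> cost (sem f) (time t) [x, y, z, u] e \<le> time t i [x, y, z, u]"
  shows "implements i b"
  using assms by (auto simp: implements_def numeral_eq_Suc length_Suc_conv)

lemma implements5I:
  assumes "b = (5, e)"
    and "\<And>f t x y z u w. sem f i [x, y, z, u, w] = den (sem f) [x, y, z, u, w] e
      \<and> cost (sem f) (time t) [x, y, z, u, w] e \<le> time t i [x, y, z, u, w]"
  shows "implements i b"
  using assms by (auto simp: implements_def numeral_eq_Suc length_Suc_conv)

lemmas calls = sem_def time_def sem_table_def time_table_def

lemma pairs_data_fst_snd: "pairs (data_fst d) \<le> pairs d" "pairs (data_snd d) \<le> pairs d"
  by (cases d; simp)+

lemma pairs_d_app [simp]: "pairs (d_app x y) = pairs x + pairs y"
  by (induction x) (auto simp: d_app_def)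

lemma odds_Cons: "odds (x # xs) = x # odds (tl xs)"
  by (cases xs) auto

lemma dlist_data_snd: "dlist (data_snd d) = tl (dlist d)"
  by (cases d) auto

lemma pairs_fst_snd: "pairs (data_fst d) + pairs (data_snd d) \<le> pairs d"
  by (cases d) auto

lemma pairs_d_norm: "pairs (d_norm p q) \<le> Suc (pairs p + pairs q)"
  by (induction p q rule: d_norm.induct) auto

lemma pairs_d_addvec: "pairs (d_addvec x y) \<le> pairs x + pairs y"
proof (induction x y rule: d_addvec.induct)
  case (3 a x b y)
  then show ?case
    using pairs_d_norm[of "d_app (data_fst a) (data_fst b)" "d_app (data_snd a) (data_snd b)"]
      pairs_fst_snd[of a] pairs_fst_snd[of b] by simp
qed auto

lemma d_Pair_simps [simp]:
  "d_app Atom y = y" "d_app (Pair a x) y = Pair a (d_app x y)"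
  "touches M v Atom = False" "touches M v (Pair a b) = (d_adj M v a \<or> touches M v b)"
  "d_consall e Atom acc = acc"
  "d_consall e (Pair a x) acc = Pair (Pair e a) (d_consall e x acc)"
  "idem Atom y" "idem (Pair a x) y = (Pair (data_snd a) (data_snd a) \<in> set (dlist y) \<and> idem x y)"
  "in_box B Atom" "in_box B (Pair a v) =
     (dlen (data_fst a) \<le> dlen B \<and> dlen (data_snd a) \<le> dlen B \<and> in_box B v)"
  "zero_vec Atom" "zero_vec (Pair a v) = (data_fst a = Atom \<and> data_snd a = Atom \<and> zero_vec v)"
  "d_leafvec one v Atom = Atom" "d_leafvec one v (Pair a x) =
     (if data_snd a = v \<and> data_fst a \<noteq> v then Pair one (d_leafvec one v x) else d_leafvec one v x)"
  "d_size Atom acc = acc"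
  "d_size (Pair a x) acc = d_size a (d_size x (Pair Atom acc))"
  "d_ginsert x Atom = Pair x Atom"
  "d_ginsert x (Pair y L) = (if y = x then Pair x (Pair y L) else Pair y (d_ginsert x L))"
  "d_opts one Atom = Atom"
  "d_opts one (Pair a as) = (if idem a a then Pair (d_option one a) (d_opts one as) else d_opts one as)"
  "d_odds Atom = Atom" "d_odds (Pair a L) = Pair a (d_odds (data_snd L))"
  by (auto simp: d_app_def touches_def d_consall_def idem_def in_box_def zero_vec_def
      d_leafvec_def leaves_def d_size_def d_ginsert_def d_opts_def d_odds_def replicate_add
      replicate_app_Cons_same odds_Cons dlist_data_snd)

lemma d_ext_simps [simp]:
  "d_ext M u Atom as = Atom"
  "d_ext M u (Pair c cs) as = (if u = c \<or> d_adj M u c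
     then d_consall (Pair u c) as (d_ext M u cs as) else d_ext M u cs as)"
  by (auto simp: d_ext_def d_consall_def)

text \<open>The code detects the existence of a leaf by computing a leaf vector and comparing it
  with \<open>Atom\<close>.\<close>

lemma leaves_pos_iff: "0 < leaves v a \<longleftrightarrow> d_leafvec one v a \<noteq> Atom"
  by (simp add: d_leafvec_def)

section \<open>Verification of the library functions\<close>

lemma impl_app: "implements (Suc 0) (library ! 0)"
  apply (rule implements2I, simp add: library_def)
  subgoal for f t x y
    by (cases x) (simp_all add: calls algebra_simps)
  done

lemma impl_eq: "implements 2 (library ! 1)"
  apply (rule implements2I, simp add: library_def)
  subgoal for f t x y
    by (cases x; cases y) (simp_all add: calls algebra_simps)
  done

lemma impl_le: "implements 3 (library ! 2)"
  apply (rule implements2I, simp add: library_def)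
  subgoal for f t x y
    by (cases x; cases y) (simp_all add: calls algebra_simps min_def)
  done

lemma impl_nth: "implements 4 (library ! 3)"
  apply (rule implements2I, simp add: library_def)
  subgoal for f t x y
    by (cases x; cases y) (simp_all add: calls algebra_simps)
  done

lemma impl_touches: "implements 5 (library ! 4)"
  apply (rule implements3I, simp add: library_def)
  subgoal for f t x y z
    by (cases z) (simp_all add: calls algebra_simps d_adj_def)
  done

lemma impl_merge: "implements 6 (library ! 5)"
  apply (rule implements5I, simp add: library_def)
  subgoal for f t x y z u w
    by (cases z) (simp_all add: calls algebra_simps)
  done

lemma impl_build: "implements 7 (library ! 6)"
  apply (rule implements4I, simp add: library_def)
  subgoal for f t x y z u
    by (cases y) (simp_all add: calls algebra_simps)
  done

lemma impl_consall: "implements 8 (library ! 7)"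
  apply (rule implements3I, simp add: library_def)
  subgoal for f t x y z
    by (cases y) (simp_all add: calls algebra_simps)
  done

lemma impl_ext: "implements 9 (library ! 8)"
  apply (rule implements4I, simp add: library_def)
  subgoal for f t x y z u
    by (cases z) (simp_all add: calls algebra_simps d_adj_def)
  done

lemma impl_assigns: "implements 10 (library ! 9)"
  apply (rule implements3I, simp add: library_def)
  subgoal for f t x y z
    by (cases y) (simp_all add: calls algebra_simps)
  done

lemma impl_mem: "implements 11 (library ! 10)"
  apply (rule implements2I, simp add: library_def)
  subgoal for f t x y
    by (cases y) (simp_all add: calls algebra_simps)
  done

lemma impl_idem: "implements 12 (library ! 11)"
  apply (rule implements2I, simp add: library_def)
  subgoal for f t x y
    using pairs_data_fst_snd[of "data_fst x"]
    by (cases x) (simp_all add: calls algebra_simps)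
  done

lemma impl_norm: "implements 13 (library ! 12)"
  apply (rule implements2I, simp add: library_def)
  subgoal for f t x y
    by (cases x; cases y) (simp_all add: calls algebra_simps)
  done

lemma impl_addvec: "implements 14 (library ! 13)"
  apply (rule implements2I, simp add: library_def)
  subgoal for f t x y
    using pairs_data_fst_snd[of "data_fst x"] pairs_data_fst_snd[of "data_fst y"]
    by (cases x; cases y) (simp_all add: calls algebra_simps)
  done

lemma impl_leafvec: "implements 15 (library ! 14)"
  apply (rule implements3I, simp add: library_def)
  subgoal for f t x y z
    using pairs_data_fst_snd[of "data_fst z"]
    by (cases z) (auto simp: calls algebra_simps)
  done

lemma impl_vecs: "implements 16 (library ! 15)"
  apply (rule implements3I, simp add: library_def)
  subgoal for f t x y z
    using pairs_data_fst_snd[of "data_fst y"]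
    by (cases y) (simp_all add: calls algebra_simps)
  done

lemma impl_wcount: "implements 17 (library ! 16)"
  apply (rule implements3I, simp add: library_def)
  subgoal for f t x y z
    using pairs_data_fst_snd[of "data_fst y"] pairs_data_fst_snd[of "x"]
    by (cases y) (simp_all add: calls algebra_simps leaves_pos_iff[where one=x])
  done

lemma impl_opts: "implements 18 (library ! 17)"
  apply (rule implements2I, simp add: library_def)
  subgoal for f t x y
    by (cases y) (simp_all add: calls algebra_simps d_option_def)
  done

lemma impl_ginsert: "implements 19 (library ! 18)"
  apply (rule implements2I, simp add: library_def)
  subgoal for f t x y
    by (cases y) (simp_all add: calls algebra_simps)
  done

lemma impl_optlists: "implements 20 (library ! 19)"
  apply (rule implements4I, simp add: library_def)
  subgoal for f t x y z u
    by (cases z) (simp_all add: calls algebra_simps block_opts_def)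
  done

lemma impl_size: "implements 21 (library ! 20)"
  apply (rule implements2I, simp add: library_def)
  subgoal for f t x y
    by (cases x) (simp_all add: calls algebra_simps)
  done

lemma impl_bound: "implements 22 (library ! 21)"
  apply (rule implements1I, simp add: library_def)
  subgoal for f t x
    by (cases x; cases "data_snd x") (simp_all add: calls algebra_simps)
  done

lemma impl_odds: "implements 23 (library ! 22)"
  apply (rule implements1I, simp add: library_def)
  subgoal for f t x
    by (cases x; cases "data_snd x") (simp_all add: calls algebra_simps)
  done

lemma impl_in_box: "implements 24 (library ! 23)"
  apply (rule implements2I, simp add: library_def)
  subgoal for f t x y
    using pairs_data_fst_snd[of "data_fst y"]
    by (cases y) (simp_all add: calls algebra_simps min_def)
  done

lemma impl_insert: "implements 25 (library ! 24)"
  apply (rule implements3I, simp add: library_def)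
  subgoal for f t x y z
    using pairs_data_fst_snd[of "y"]
    by (cases "in_box x (data_snd y)"; cases "y \<in> set (dlist z)") (simp_all add: calls algebra_simps d_insert_def)
  done

lemma impl_comb1: "implements 26 (library ! 25)"
  apply (rule implements4I, simp add: library_def)
  subgoal for f t x y z u
    using pairs_data_fst_snd[of "y"] pairs_data_fst_snd[of "data_fst z"]
      pairs_d_addvec[of "data_snd y" "data_snd (data_fst z)"]
      pairs_fst_snd[of y] pairs_fst_snd[of "data_fst z"]
    by (cases z) (simp_all add: calls algebra_simps d_add_def)
  done

lemma impl_comb: "implements 27 (library ! 26)"
  apply (rule implements4I, simp add: library_def)
  subgoal for f t x y z u
    by (cases y) (simp_all add: calls algebra_simps)
  done

lemma impl_solve: "implements 28 (library ! 27)"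
  apply (rule implements2I, simp add: library_def)
  subgoal for f t x y
    using pairs_data_fst_snd[of "y"]
    by (cases "data_snd y = Atom") (simp_all add: calls algebra_simps d_solve.simps[of x y] t_solve.simps[of x y])
  done

lemma impl_zero: "implements 29 (library ! 28)"
  apply (rule implements1I, simp add: library_def)
  subgoal for f t x
    using pairs_data_fst_snd[of "data_fst x"]
    by (cases x; cases "data_fst (data_fst x)") (simp_all add: calls algebra_simps)
  done

lemma impl_best: "implements 30 (library ! 29)"
  apply (rule implements2I, simp add: library_def)
  subgoal for f t x y
    using pairs_data_fst_snd[of "data_fst x"]
    by (cases x; cases "zero_vec (data_snd (data_fst x))") (simp_all add: calls algebra_simps min_def)
  done

lemma impl_optimum: "implements 31 (library ! 30)"
  apply (rule implements1I, simp add: library_def)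
  subgoal for f t x
    by (simp add: calls algebra_simps d_optimum_def t_optimum_def)
  done

lemma impl_mcsf: "implements 32 (library ! 31)"
  apply (rule implements2I, simp add: library_def)
  subgoal for f t x y
    by (simp add: calls algebra_simps d_types_def t_types_def pos_one_def neg_one_def)
  done

lemmas implementations = impl_app impl_le impl_nth impl_touches impl_merge impl_build impl_consall impl_ext impl_assigns
  impl_mem impl_idem impl_norm impl_addvec impl_leafvec impl_vecs impl_wcount impl_opts
  impl_ginsert impl_optlists impl_size impl_bound impl_odds impl_in_box impl_insert impl_comb1
  impl_comb impl_solve impl_zero impl_best impl_optimum impl_mcsf impl_eq

lemma implements_library: "i < 32 \<Longrightarrow> implements (Suc i) (library ! i)"
proof -
  have "\<forall>i\<in>set [0..<32]. implements (Suc i) (library ! i)"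
    using implementations by (simp add: upt_rec numeral_eq_Suc del: set_upt)
  then show "i < 32 \<Longrightarrow> implements (Suc i) (library ! i)" by simp
qed

lemma length_library: "length library = 32"
  by (simp add: library_def)

lemma scoped_library:
  "\<forall>b\<in>set library. well_scoped (1 # map fst library) (fst b) (snd b)"
  by (simp add: library_def)

text \<open>The two extra steps pay for the argument and the call by which
  \<open>computes_in\<close> enters the program.\<close>

theorem prog_eval:
  assumes scoped: "well_scoped (1 # map fst library) 1 main"
    and den: "\<And>x. den (sem f) [x] main = f x"
    and cost: "\<And>x. cost (sem f) (time t) [x] main \<le> t x"
  shows "\<exists>s\<le>t x + 2. computes_in (prog main) x (f x) s"
proof -
  let ?ar = "1 # map fst library"
  have lib: "Suc i < length (prog main) \<Longrightarrow> i < 32" for i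
    by (simp add: prog_def length_library)
  have "\<exists>s\<le>time t 0 [x]. eval (prog main) [x] (prog main ! 0) (sem f 0 [x]) s"
  proof (rule eval_of_den[where ar = ?ar])
    fix i assume "i < length (prog main)"
    then show "well_scoped ?ar (?ar ! i) (prog main ! i)"
      using scoped scoped_library length_library by (cases i) (auto simp: prog_def)
  next
    fix i and vs :: "data list" assume i: "i < length (prog main)" "length vs = ?ar ! i"
    show "sem f i vs = den (sem f) vs (prog main ! i)"
    proof (cases i)
      case 0
      then show ?thesis using i den by (auto simp: prog_def sem_def length_Suc_conv)
    next
      case (Suc j)
      then show ?thesis using i implements_library[OF lib, of j]
        by (auto simp: prog_def implements_def length_library)
    qed
    show "cost (sem f) (time t) vs (prog main ! i) \<le> time t i vs"
    proof (cases i)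
      case 0
      then show ?thesis using i cost by (auto simp: prog_def time_def length_Suc_conv)
    next
      case (Suc j)
      then show ?thesis using i implements_library[OF lib, of j]
        by (auto simp: prog_def implements_def length_library)
    qed
  qed (auto simp: prog_def)
  then obtain s where s: "s \<le> t x" "eval (prog main) [x] (prog main ! 0) (f x) s"
    by (auto simp: sem_def time_def)
  have "evals (prog main) [x] [Var 0] [x] (1 + 0)"
    using eval_Var[of 0 "[x]" "prog main"] by (intro evals_Cons evals_Nil) auto
  then have "computes_in (prog main) x (f x) (Suc (1 + 0 + s))"
    unfolding computes_in_def using s by (intro eval_Call) (auto simp: prog_def)
  then show ?thesis using s by (intro exI[of _ "Suc (1 + 0 + s)"]) auto
qed

abbreviation "opt_main \<equiv> c_mcsf (EFst V0) (ESnd V0)"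
abbreviation "dec_main \<equiv> c_le (ESnd V0) (c_mcsf (EFst (EFst V0)) (ESnd (EFst V0)))"

definition d_mcsf :: "data \<Rightarrow> data \<Rightarrow> data" where
  "d_mcsf M1 M2 = d_optimum (d_types M1 M2)"

definition t_mcsf :: "data \<Rightarrow> data \<Rightarrow> nat" where
  "t_mcsf M1 M2 = t_types M1 M2 + t_optimum (d_types M1 M2)"

lemma opt_main:
  "\<exists>s\<le>t_mcsf M1 M2 + 20. computes_in (prog opt_main) (Pair M1 M2) (d_mcsf M1 M2) s"
proof -
  let ?f = "\<lambda>x. d_mcsf (data_fst x) (data_snd x)"
  let ?t = "\<lambda>x. t_mcsf (data_fst x) (data_snd x) + 5"
  have "\<exists>s\<le>?t (Pair M1 M2) + 2. computes_in (prog opt_main) (Pair M1 M2) (?f (Pair M1 M2)) s"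
    by (rule prog_eval) (simp_all add: library_def calls d_mcsf_def t_mcsf_def)
  then obtain s where "s \<le> ?t (Pair M1 M2) + 2" "computes_in (prog opt_main) (Pair M1 M2) (d_mcsf M1 M2) s"
    by auto
  then show ?thesis by (intro exI[of _ s]) simp
qed

text \<open>\<open>c_le\<close> stops at the end of the shorter list, so the comparison can be
  charged to the optimum and the bound is independent of the size of \<open>h\<close>.\<close>

lemma dec_main:
  "\<exists>s\<le>t_mcsf M1 M2 + 20 * pairs (d_mcsf M1 M2) + 50. computes_in (prog dec_main)
     (Pair (Pair M1 M2) h) (enc_bool (dlen h \<le> dlen (d_mcsf M1 M2))) s"
proof -
  let ?o = "\<lambda>x. d_mcsf (data_fst (data_fst x)) (data_snd (data_fst x))"
  let ?f = "\<lambda>x. enc_bool (dlen (data_snd x) \<le> dlen (?o x))"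
  let ?t = "\<lambda>x. t_mcsf (data_fst (data_fst x)) (data_snd (data_fst x)) + 20 * pairs (?o x) + 40"
  have "\<exists>s\<le>?t (Pair (Pair M1 M2) h) + 2.
      computes_in (prog dec_main) (Pair (Pair M1 M2) h) (?f (Pair (Pair M1 M2) h)) s"
    by (rule prog_eval) (simp_all add: library_def calls d_mcsf_def t_mcsf_def)
  then obtain s where "s \<le> ?t (Pair (Pair M1 M2) h) + 2" "computes_in (prog dec_main)
     (Pair (Pair M1 M2) h) (enc_bool (dlen h \<le> dlen (d_mcsf M1 M2))) s"
    by auto
  then show ?thesis by (intro exI[of _ s]) simp
qed

section \<open>Stars\<close>

definition star_graph :: "'a \<Rightarrow> 'a set \<Rightarrow> 'a graph" where
  "star_graph c L = (insert c L, (\<lambda>l. {c, l}) ` L)"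

lemma adj_symD: "(u, v) \<in> adj G \<Longrightarrow> (v, u) \<in> adj G"
  by (simp add: adj_def insert_commute)

lemma simple_adj:
  assumes "simple_graph G" "(u, v) \<in> adj G"
  shows "u \<in> verts G" "v \<in> verts G" "u \<noteq> v"
  using assms by (auto simp: simple_graph_def adj_def)

text \<open>The only form in which the diameter is used: finiteness makes \<open>Max\<close> an
  upper bound, and connectivity makes the \<open>LEAST\<close> in \<open>distance\<close> an
  attained length.\<close>

lemma distance_le_2D:
  assumes "nontrivial_star S" "u \<in> verts S" "v \<in> verts S" "u \<noteq> v" "(u, v) \<notin> adj S"
  shows "\<exists>w. (u, w) \<in> adj S \<and> (w, v) \<in> adj S"
proof -
  have fin: "finite (verts S)" and conn: "connected_graph S"
    using assms by (auto simp: nontrivial_star_def tree_def simple_graph_def)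
  let ?D = "{distance S u v | u v. u \<in> verts S \<and> v \<in> verts S}"
  have "?D = (\<lambda>(u, v). distance S u v) ` (verts S \<times> verts S)" by auto
  then have "finite ?D" using fin by simp
  then have "distance S u v \<le> Max ?D" using assms by (intro Max_ge) auto
  then have le: "distance S u v \<le> 2" using assms by (simp add: nontrivial_star_def diameter_def)
  have "(u, v) \<in> (adj S)\<^sup>*" using conn assms by (auto simp: connected_graph_def)
  then have "\<exists>l. (u, v) \<in> adj S ^^ l" by (simp add: rtrancl_power)
  then have d: "(u, v) \<in> adj S ^^ distance S u v" unfolding distance_def by (rule LeastI_ex)
  have "distance S u v \<noteq> 0" using d assms by (intro notI) simp
  moreover have "distance S u v \<noteq> 1" using d assms by (intro notI) simp
  ultimately have "distance S u v = 2" using le by linarith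
  then show ?thesis using d by (auto simp: numeral_2_eq_2)
qed

lemma is_cycle_3:
  assumes "distinct [a, b, c]" "(a, b) \<in> adj G" "(b, c) \<in> adj G" "(c, a) \<in> adj G"
  shows "is_cycle G [a, b, c]"
  using assms unfolding is_cycle_def by (simp add: All_less_Suc)

lemma is_cycle_4:
  assumes "distinct [a, b, c, d]" "(a, b) \<in> adj G" "(b, c) \<in> adj G" "(c, d) \<in> adj G" "(d, a) \<in> adj G"
  shows "is_cycle G [a, b, c, d]"
  using assms unfolding is_cycle_def by (simp add: All_less_Suc)

lemma is_cycle_5:
  assumes "distinct [a, b, c, d, e]" "(a, b) \<in> adj G" "(b, c) \<in> adj G" "(c, d) \<in> adj G"
    "(d, e) \<in> adj G" "(e, a) \<in> adj G"
  shows "is_cycle G [a, b, c, d, e]"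
  using assms unfolding is_cycle_def by (simp add: All_less_Suc)

text \<open>If \<open>x\<close> were adjacent to neither end of the edge, its common neighbours
  \<open>z\<close> with \<open>a\<close> and \<open>w\<close> with \<open>b\<close> would close a
  triangle (if \<open>w = z\<close>) or a 5-cycle.\<close>

lemma adj_other_end:
  assumes S: "nontrivial_star S" and ab: "(a, b) \<in> adj S"
    and x: "x \<in> verts S" "x \<noteq> a" "(a, x) \<notin> adj S"
  shows "(b, x) \<in> adj S"
proof (rule ccontr)
  assume nbx: "(b, x) \<notin> adj S"
  have simple: "simple_graph S" and acyc: "\<And>vs. \<not> is_cycle S vs"
    using S by (auto simp: nontrivial_star_def tree_def)
  note sadj = simple_adj[OF simple]
  note inv = sadj[OF ab]
  have "x \<noteq> b" using x ab by blast
  obtain z where z: "(a, z) \<in> adj S" "(z, x) \<in> adj S"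
    using distance_le_2D[OF S inv(1) x(1)] x by blast
  obtain w where w: "(b, w) \<in> adj S" "(w, x) \<in> adj S"
    using distance_le_2D[OF S inv(2) x(1)] nbx \<open>x \<noteq> b\<close> by blast
  have zb: "z \<noteq> b" "w \<noteq> a" using z w nbx x by auto
  have sym: "(z, a) \<in> adj S" "(x, z) \<in> adj S" using z adj_symD by metis+
  show False
  proof (cases "w = z")
    case True
    then have "is_cycle S [a, b, z]"
      using ab w zb sym sadj[OF z(1)] inv by (intro is_cycle_3) auto
    then show False using acyc by blast
  next
    case False
    then have "is_cycle S [a, b, w, x, z]"
      using ab w zb sym sadj[OF z(1)] sadj[OF z(2)] sadj[OF w(1)] sadj[OF w(2)] inv x \<open>x \<noteq> b\<close>
      by (intro is_cycle_5) auto
    then show False using acyc by blast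
  qed
qed

text \<open>One end of any edge \<open>a b\<close> is a centre. Otherwise \<open>a\<close> misses
  some \<open>x\<close> and \<open>b\<close> misses some \<open>y\<close>; by
  \<open>adj_other_end\<close> there is a path \<open>x b a y\<close>, which is closed to a 4-cycle
  by the edge \<open>x y\<close> or to a 5-cycle by a common neighbour of \<open>x\<close> and
  \<open>y\<close>.\<close>

lemma nontrivial_star_centre:
  assumes S: "nontrivial_star S"
  shows "\<exists>c\<in>verts S. \<forall>v\<in>verts S. v = c \<or> (c, v) \<in> adj S"
proof -
  have simple: "simple_graph S" and acyc: "\<And>vs. \<not> is_cycle S vs"
    using S by (auto simp: nontrivial_star_def tree_def)
  note sadj = simple_adj[OF simple]
  have card: "card (verts S) \<ge> 2" using S by (simp add: nontrivial_star_def)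
  obtain a b where ab: "(a, b) \<in> adj S"
  proof -
    obtain u where u: "u \<in> verts S" using card by fastforce
    obtain v where v: "v \<in> verts S" "v \<noteq> u"
    proof (rule ccontr)
      assume "\<not> thesis"
      then have "verts S = {u}" using that u by blast
      then show False using card by simp
    qed
    show ?thesis using distance_le_2D[OF S u v(1)] v that by blast
  qed
  note inv = sadj[OF ab]
  show ?thesis
  proof (rule ccontr)
    assume no: "\<not> ?thesis"
    obtain x where x: "x \<in> verts S" "x \<noteq> a" "(a, x) \<notin> adj S" using no inv by blast
    obtain y where y: "y \<in> verts S" "y \<noteq> b" "(b, y) \<notin> adj S" using no inv by blast
    have "x \<noteq> b" "y \<noteq> a" using x y ab adj_symD by metis+
    have ba: "(b, a) \<in> adj S" using ab adj_symD by metis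
    have bx: "(b, x) \<in> adj S" by (rule adj_other_end[OF S ab x])
    have ay: "(a, y) \<in> adj S" by (rule adj_other_end[OF S ba y])
    have ya: "(y, a) \<in> adj S" using ay adj_symD by metis
    have "x \<noteq> y" using ay x by auto
    show False
    proof (cases "(x, y) \<in> adj S")
      case True
      then have "is_cycle S [a, b, x, y]"
        using ab bx ya inv x y \<open>x \<noteq> b\<close> \<open>y \<noteq> a\<close> \<open>x \<noteq> y\<close> by (intro is_cycle_4) auto
      then show False using acyc by blast
    next
      case False
      obtain w where w: "(x, w) \<in> adj S" "(w, y) \<in> adj S"
        using distance_le_2D[OF S x(1) y(1)] False \<open>x \<noteq> y\<close> by blast
      have "w \<noteq> a" "w \<noteq> b" using w x y adj_symD by metis+
      then have "is_cycle S [a, b, x, w, y]"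
        using ab bx ya inv x y w \<open>x \<noteq> b\<close> \<open>y \<noteq> a\<close> \<open>x \<noteq> y\<close> sadj[OF w(1)] sadj[OF w(2)]
        by (intro is_cycle_5) auto
      then show False using acyc by blast
    qed
  qed
qed

text \<open>An edge that avoids the centre would form a triangle with it.\<close>

lemma nontrivial_star_eq_star_graph:
  assumes S: "nontrivial_star S"
  shows "\<exists>c L. S = star_graph c L \<and> c \<notin> L \<and> finite L \<and> L \<noteq> {}"
proof -
  have simple: "simple_graph S" and acyc: "\<And>vs. \<not> is_cycle S vs"
    using S by (auto simp: nontrivial_star_def tree_def)
  obtain c where c: "c \<in> verts S" "\<And>v. v \<in> verts S \<Longrightarrow> v = c \<or> (c, v) \<in> adj S"
    using nontrivial_star_centre[OF S] by blast
  define L where "L = verts S - {c}"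
  have "edges S = (\<lambda>l. {c, l}) ` L"
  proof
    show "(\<lambda>l. {c, l}) ` L \<subseteq> edges S" using c by (auto simp: L_def adj_def)
    show "edges S \<subseteq> (\<lambda>l. {c, l}) ` L"
    proof
      fix e assume e: "e \<in> edges S"
      then obtain u v where uv: "e = {u, v}" "u \<noteq> v" "u \<in> verts S" "v \<in> verts S"
        using simple by (auto simp: simple_graph_def card_2_iff)
      have "u = c \<or> v = c"
      proof (rule ccontr)
        assume *: "\<not> (u = c \<or> v = c)"
        then have "is_cycle S [c, u, v]"
          using uv e c(2)[OF uv(3)] c(2)[OF uv(4)] adj_symD[of c v S]
          by (intro is_cycle_3) (auto simp: adj_def insert_commute)
        then show False using acyc by blast
      qed
      then show "e \<in> (\<lambda>l. {c, l}) ` L" using uv by (auto simp: L_def insert_commute)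
    qed
  qed
  moreover have "verts S = insert c L" using c by (auto simp: L_def)
  moreover have "L \<noteq> {}"
  proof
    assume "L = {}"
    then have "verts S = {c}" using \<open>verts S = insert c L\<close> by simp
    then show False using S by (simp add: nontrivial_star_def)
  qed
  moreover have "finite L" using simple by (simp add: L_def simple_graph_def)
  moreover have "c \<notin> L" by (simp add: L_def)
  ultimately show ?thesis unfolding star_graph_def by (metis prod.collapse)
qed

lemma adj_star_graph: "(u, v) \<in> adj (star_graph c L) \<longleftrightarrow> u = c \<and> v \<in> L \<or> v = c \<and> u \<in> L"
  by (auto simp: adj_def star_graph_def doubleton_eq_iff)

lemma nontrivial_star_star_graph:
  assumes "c \<notin> L" "finite L" "L \<noteq> {}"
  shows "nontrivial_star (star_graph c L)"
proof -
  let ?S = "star_graph c L"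
  have path: "\<exists>l\<le>2. (u, v) \<in> adj ?S ^^ l" if uv: "u \<in> insert c L" "v \<in> insert c L" for u v
  proof -
    consider "u = v" | "u = c" "v \<in> L" | "v = c" "u \<in> L" | "u \<in> L" "v \<in> L" using uv by blast
    then show ?thesis
    proof cases
      case 1 then show ?thesis by (intro exI[of _ 0]) auto
    next
      case 2 then show ?thesis by (intro exI[of _ 1]) (auto simp: adj_star_graph)
    next
      case 3 then show ?thesis by (intro exI[of _ 1]) (auto simp: adj_star_graph)
    next
      case 4 then show ?thesis
        by (intro exI[of _ 2]) (auto simp: adj_star_graph numeral_2_eq_2 intro!: relcompI[of _ c])
    qed
  qed
  have simple: "simple_graph ?S"
    using assms by (auto simp: simple_graph_def star_graph_def card_2_iff)
  have "connected_graph ?S"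
    unfolding connected_graph_def using path
    by (fastforce simp: star_graph_def rtrancl_power)
  \<comment> \<open>The first two edges have distinct outer ends, so they can meet only in
    \<open>c\<close>; the third edge leads from the leaf \<open>vs ! 2\<close> back to
    \<open>c\<close>. Its end has index \<open>3 mod length vs\<close>, which covers triangles and
    differs from 1, so \<open>c\<close> would be repeated.\<close>
  moreover have "\<not> is_cycle ?S vs" for vs
  proof
    assume "is_cycle ?S vs"
    then have len: "length vs \<ge> 3" and dist: "distinct vs"
      and e: "\<And>i. i < length vs \<Longrightarrow> (vs ! i, vs ! (Suc i mod length vs)) \<in> adj ?S"
      by (auto simp: is_cycle_def)
    have "vs \<noteq> []" using len by auto
    have e0: "(vs ! 0, vs ! 1) \<in> adj ?S" and e1: "(vs ! 1, vs ! 2) \<in> adj ?S"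
      using e[of 0] e[of 1] len \<open>vs \<noteq> []\<close> by (auto simp: numeral_2_eq_2)
    have "vs ! 0 \<noteq> vs ! 2" using nth_eq_iff_index_eq[OF dist, of 0 2] len \<open>vs \<noteq> []\<close> by auto
    then have c1: "vs ! 1 = c" using e0 e1 by (auto simp: adj_star_graph)
    then have "vs ! 2 \<in> L" using e1 assms by (auto simp: adj_star_graph)
    then have "vs ! (3 mod length vs) = c"
      using e[of 2] len assms by (auto simp: adj_star_graph numeral_3_eq_3 numeral_2_eq_2)
    moreover have "3 mod length vs \<noteq> 1" "3 mod length vs < length vs"
      using len by (cases "length vs = 3"; auto)+
    ultimately show False using c1 dist len by (metis One_nat_def Suc_le_lessD nth_eq_iff_index_eq numeral_3_eq_3 Suc_lessD)
  qed
  moreover have "card (verts ?S) \<ge> 2"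
    using assms by (auto simp: star_graph_def Suc_le_eq card_gt_0_iff)
  moreover have "diameter ?S \<le> 2"
  proof -
    let ?D = "{distance ?S u v | u v. u \<in> verts ?S \<and> v \<in> verts ?S}"
    have "?D = (\<lambda>(u, v). distance ?S u v) ` (verts ?S \<times> verts ?S)" by auto
    then have "finite ?D" using assms by (simp add: star_graph_def)
    moreover have "?D \<noteq> {}" by (auto simp: star_graph_def)
    moreover have "d \<le> 2" if "d \<in> ?D" for d
      using that path unfolding distance_def
      by (auto simp: star_graph_def) (metis (no_types, lifting) Least_le order_trans)+
    ultimately show ?thesis unfolding diameter_def by (subst Max_le_iff) auto
  qed
  ultimately show ?thesis using simple by (auto simp: nontrivial_star_def tree_def)
qed

section \<open>Star forests as centre maps\<close>

text \<open>A star forest inside a graph is encoded by the idempotent map that sends every leaf to its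
  centre and fixes all other vertices.\<close>

definition centre_map :: "'a set set \<Rightarrow> 'a set \<Rightarrow> ('a \<Rightarrow> 'a) \<Rightarrow> bool" where
  "centre_map E V p \<longleftrightarrow> (\<forall>u\<in>V. p u \<in> V \<and> p (p u) = p u \<and> (p u \<noteq> u \<longrightarrow> {u, p u} \<in> E))"

definition leaf_set :: "('a \<Rightarrow> 'a) \<Rightarrow> 'a set \<Rightarrow> 'a \<Rightarrow> 'a set" where
  "leaf_set p V v = {u \<in> V. u \<noteq> v \<and> p u = v}"

definition leaf_count :: "('a \<Rightarrow> 'a) \<Rightarrow> 'a set \<Rightarrow> 'a \<Rightarrow> nat" where
  "leaf_count p V v = card (leaf_set p V v)"

text \<open>The conjugate of the partition formed by the star sizes; differences of consecutive
  values give the number of stars of each size.\<close>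

definition profile :: "('a \<Rightarrow> 'a) \<Rightarrow> 'a set \<Rightarrow> nat \<Rightarrow> nat" where
  "profile p V j = card {v \<in> V. j < leaf_count p V v}"

definition used :: "('a \<Rightarrow> 'a) \<Rightarrow> 'a set \<Rightarrow> 'a set" where
  "used p V = {u \<in> V. p u \<noteq> u \<or> 0 < leaf_count p V u}"

lemma leaf_count_pos_iff: "finite V \<Longrightarrow> 0 < leaf_count p V v \<longleftrightarrow> leaf_set p V v \<noteq> {}"
  by (auto simp: leaf_count_def leaf_set_def card_gt_0_iff)

text \<open>Each star supplies a centre; for a single edge one end is chosen once and for all.
  Disjointness makes the star through \<open>u\<close> unique, so the \<open>SOME\<close> in
  \<open>q\<close> is determined.\<close>

lemma star_forest_centre_map:
  assumes "star_forest H"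
  obtains q where "finite (verts H)" "centre_map (edges H) (verts H) q" "used q (verts H) = verts H"
proof -
  obtain \<S> where fin: "finite \<S>" and stars: "\<forall>S\<in>\<S>. nontrivial_star S"
    and disj: "disjoint_family_on verts \<S>" and H: "H = (\<Union>S\<in>\<S>. verts S, \<Union>S\<in>\<S>. edges S)"
    using assms unfolding star_forest_def by blast
  have "\<forall>S\<in>\<S>. \<exists>c L. S = star_graph c L \<and> c \<notin> L \<and> finite L \<and> L \<noteq> {}"
    using stars nontrivial_star_eq_star_graph by blast
  then obtain c L where cL: "\<And>S. S \<in> \<S> \<Longrightarrow> S = star_graph (c S) (L S)"
    "\<And>S. S \<in> \<S> \<Longrightarrow> c S \<notin> L S" "\<And>S. S \<in> \<S> \<Longrightarrow> finite (L S)" "\<And>S. S \<in> \<S> \<Longrightarrow> L S \<noteq> {}"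
    by metis
  have vS: "verts S = insert (c S) (L S)" and eS: "edges S = (\<lambda>l. {c S, l}) ` L S" if "S \<in> \<S>" for S
    using cL(1)[OF that] by (metis fst_conv snd_conv star_graph_def)+
  define q where "q u = c (SOME S. S \<in> \<S> \<and> u \<in> verts S)" for u
  have q: "q u = c S" if "S \<in> \<S>" "u \<in> verts S" for u S
  proof -
    have "(SOME S. S \<in> \<S> \<and> u \<in> verts S) = S"
      using that disj by (intro some_equality) (auto simp: disjoint_family_on_def)
    then show ?thesis by (simp add: q_def)
  qed
  have finV: "finite (verts H)" using fin vS cL(3) by (auto simp: H)
  have vH: "S \<in> \<S> \<Longrightarrow> verts S \<subseteq> verts H" for S by (auto simp: H)
  have 1: "centre_map (edges H) (verts H) q"
    unfolding centre_map_def
  proof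
    fix u assume "u \<in> verts H"
    then obtain S where S: "S \<in> \<S>" "u \<in> verts S" by (auto simp: H)
    have qu: "q u = c S" using q[OF S] .
    have cS: "c S \<in> verts S" using vS[OF S(1)] by simp
    have "{u, q u} \<in> edges H" if "q u \<noteq> u"
    proof -
      have "{c S, u} \<in> edges S" using that S vS[OF S(1)] eS[OF S(1)] qu by auto
      then show ?thesis using S qu by (auto simp: H insert_commute)
    qed
    then show "q u \<in> verts H \<and> q (q u) = q u \<and> (q u \<noteq> u \<longrightarrow> {u, q u} \<in> edges H)"
      using q[OF S(1) cS] qu cS vH[OF S(1)] by auto
  qed
  have "u \<in> used q (verts H)" if u: "u \<in> verts H" for u
  proof -
    obtain S where S: "S \<in> \<S>" "u \<in> verts S" using u by (auto simp: H)
    show ?thesis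
    proof (cases "q u = u")
      case True
      then have "u = c S" using q[OF S] by simp
      obtain l where l: "l \<in> L S" using cL(4)[OF S(1)] by blast
      then have "l \<in> verts S" using vS[OF S(1)] by simp
      then have "l \<in> leaf_set q (verts H) u"
        using q[OF S(1)] l cL(2)[OF S(1)] vH[OF S(1)] \<open>u = c S\<close> by (auto simp: leaf_set_def)
      then show ?thesis using u finV by (auto simp: used_def leaf_count_pos_iff)
    qed (use u in \<open>auto simp: used_def\<close>)
  qed
  then have "used q (verts H) = verts H" by (auto simp: used_def)
  then show ?thesis using that finV 1 by blast
qed

text \<open>\<open>q\<close> is transported along \<open>\<phi>\<close> and extended by the
  identity. Vertices outside the image are then neither leaves nor centres and contribute nothing to
  the counts.\<close>

lemma centre_map_embed:
  assumes q: "centre_map E W q" and inj: "inj_on \<phi> W" and img: "\<phi> ` W \<subseteq> V"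
    and edges: "\<And>u v. {u, v} \<in> E \<Longrightarrow> {\<phi> u, \<phi> v} \<in> E'" and fin: "finite V"
  shows "\<exists>p. centre_map E' V p \<and> (\<forall>j. profile p V j = profile q W j)
    \<and> card (used p V) = card (used q W)"
proof -
  define p where "p u = (if u \<in> \<phi> ` W then \<phi> (q (inv_into W \<phi> u)) else u)" for u
  have p1: "p (\<phi> w) = \<phi> (q w)" if "w \<in> W" for w
    using that inj by (simp add: p_def)
  have p2: "p u = u" if "u \<notin> \<phi> ` W" for u using that by (simp add: p_def)
  have qW: "q w \<in> W" "q (q w) = q w" "q w \<noteq> w \<Longrightarrow> {w, q w} \<in> E" if "w \<in> W" for w
    using q that by (auto simp: centre_map_def)
  have "centre_map E' V p"
    unfolding centre_map_def
  proof
    fix u assume u: "u \<in> V"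
    show "p u \<in> V \<and> p (p u) = p u \<and> (p u \<noteq> u \<longrightarrow> {u, p u} \<in> E')"
    proof (cases "u \<in> \<phi> ` W")
      case True
      then obtain w where "w \<in> W" "u = \<phi> w" by blast
      moreover have "{\<phi> w, \<phi> (q w)} \<in> E'" if "\<phi> (q w) \<noteq> \<phi> w"
        using that edges qW(3) \<open>w \<in> W\<close> by metis
      ultimately show ?thesis using p1 qW(1,2) img by auto
    qed (use p2 u in auto)
  qed
  moreover have ls: "leaf_set p V (\<phi> w) = \<phi> ` leaf_set q W w" if "w \<in> W" for w
  proof
    show "\<phi> ` leaf_set q W w \<subseteq> leaf_set p V (\<phi> w)"
      using that p1 img inj by (auto simp: leaf_set_def inj_on_eq_iff)
    show "leaf_set p V (\<phi> w) \<subseteq> \<phi> ` leaf_set q W w"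
    proof
      fix u assume u: "u \<in> leaf_set p V (\<phi> w)"
      then have "u \<in> \<phi> ` W" using p2 by (force simp: leaf_set_def)
      then obtain x where "x \<in> W" "u = \<phi> x" by blast
      then show "u \<in> \<phi> ` leaf_set q W w"
        using u that p1 inj qW by (auto simp: leaf_set_def inj_on_eq_iff)
    qed
  qed
  have lc: "leaf_count p V (\<phi> w) = leaf_count q W w" if "w \<in> W" for w
    unfolding leaf_count_def ls[OF that]
    by (intro card_image inj_on_subset[OF inj]) (auto simp: leaf_set_def)
  have lc0: "leaf_count p V v = 0" if "v \<notin> \<phi> ` W" for v
  proof -
    have "p u \<noteq> v" if "u \<noteq> v" for u
    proof (cases "u \<in> \<phi> ` W")
      case True
      then obtain w where "w \<in> W" "u = \<phi> w" by blast
      then have "p u \<in> \<phi> ` W" using p1 qW(1) by simp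
      then show ?thesis using \<open>v \<notin> \<phi> ` W\<close> by blast
    qed (use p2 that in auto)
    then have "leaf_set p V v = {}" by (auto simp: leaf_set_def)
    then show ?thesis by (simp add: leaf_count_def)
  qed
  have "profile p V j = profile q W j" for j
  proof -
    have "{v \<in> V. j < leaf_count p V v} = \<phi> ` {w \<in> W. j < leaf_count q W w}"
      using lc lc0 img by (auto simp: image_iff) (metis less_nat_zero_code image_eqI)
    then show ?thesis unfolding profile_def
      by (simp add: card_image inj_on_subset[OF inj])
  qed
  moreover have "used p V = \<phi> ` used q W"
  proof
    show "\<phi> ` used q W \<subseteq> used p V"
      using lc p1 img inj qW by (auto simp: used_def inj_on_eq_iff)
    show "used p V \<subseteq> \<phi> ` used q W"
    proof
      fix u assume u: "u \<in> used p V"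
      then have "u \<in> \<phi> ` W" using p2 lc0 by (force simp: used_def)
      then obtain x where "x \<in> W" "u = \<phi> x" by blast
      then show "u \<in> \<phi> ` used q W" using u p1 lc by (auto simp: used_def)
    qed
  qed
  then have "card (used p V) = card (used q W)"
    by (auto intro!: card_image inj_on_subset[OF inj] simp: used_def)
  ultimately show ?thesis by blast
qed

text \<open>Subtracting consecutive levels yields equally many elements of each positive value on
  both sides; these are matched value by value.\<close>

lemma match_counts:
  fixes f :: "'a \<Rightarrow> nat" and g :: "'b \<Rightarrow> nat"
  assumes fin: "finite A" "finite B"
    and eq: "\<And>j. card {a \<in> A. j < f a} = card {b \<in> B. j < g b}"
  obtains \<sigma> where "inj_on \<sigma> {a \<in> A. 0 < f a}"
    "\<And>a. a \<in> A \<Longrightarrow> 0 < f a \<Longrightarrow> \<sigma> a \<in> B \<and> g (\<sigma> a) = f a"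
proof -
  have level: "card {a \<in> X. h a = Suc l} = card {a \<in> X. l < h a} - card {a \<in> X. Suc l < h a}"
    if "finite X" for X :: "'c set" and h :: "'c \<Rightarrow> nat" and l
  proof -
    have "{a \<in> X. h a = Suc l} = {a \<in> X. l < h a} - {a \<in> X. Suc l < h a}" by auto
    then show ?thesis using that by (simp add: card_Diff_subset Collect_mono_iff)
  qed
  have "\<exists>h. bij_betw h {a \<in> A. f a = Suc l} {b \<in> B. g b = Suc l}" for l
    using level[OF fin(1), of f l] level[OF fin(2), of g l] eq[of l] eq[of "Suc l"] fin
    by (intro finite_same_card_bij) auto
  then obtain h where h: "\<And>l. bij_betw (h l) {a \<in> A. f a = Suc l} {b \<in> B. g b = Suc l}"
    by metis
  \<comment> \<open>\<open>h l\<close> matches the elements of value \<open>Suc l\<close>, hence the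
    predecessor.\<close>
  define \<sigma> where "\<sigma> a = h (f a - 1) a" for a
  have \<sigma>: "\<sigma> a \<in> B \<and> g (\<sigma> a) = f a" if "a \<in> A" "0 < f a" for a
    using bij_betwE[OF h[of "f a - 1"]] that by (auto simp: \<sigma>_def)
  moreover have "inj_on \<sigma> {a \<in> A. 0 < f a}"
  proof (rule inj_onI)
    fix a b assume a: "a \<in> {a \<in> A. 0 < f a}" and b: "b \<in> {a \<in> A. 0 < f a}" and "\<sigma> a = \<sigma> b"
    then have "f a = f b" using \<sigma> by (metis (mono_tags, lifting) mem_Collect_eq)
    then show "a = b"
      using a b \<open>\<sigma> a = \<sigma> b\<close> bij_betw_imp_inj_on[OF h[of "f a - 1"]]
      by (auto simp: \<sigma>_def inj_on_def)
  qed
  ultimately show ?thesis using that by blast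
qed

text \<open>\<open>H\<close> is cut out of \<open>G1\<close> itself, so the work lies in the
  embedding into \<open>G2\<close>: centres are matched by leaf count through
  \<open>\<sigma>\<close>, then the leaves of each star by a bijection
  \<open>\<tau>\<close>.\<close>

lemma centre_map_imp_common_star_forest:
  fixes G1 :: "nat graph" and G2 :: "'b graph"
  assumes fin: "finite (verts G1)" "finite (verts G2)"
    and p1: "centre_map (edges G1) (verts G1) p1" and p2: "centre_map (edges G2) (verts G2) p2"
    and eq: "\<And>j. profile p1 (verts G1) j = profile p2 (verts G2) j"
  obtains H where "common_star_forest G1 G2 H" "verts H = used p1 (verts G1)"
proof -
  let ?V = "verts G1" and ?V' = "verts G2"
  let ?l = "leaf_set p1 ?V" and ?l' = "leaf_set p2 ?V'"
  define W where "W = used p1 ?V"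
  define C where "C = {c \<in> ?V. 0 < leaf_count p1 ?V c}"
  define H where "H = (W, (\<lambda>u. {u, p1 u}) ` {u \<in> ?V. p1 u \<noteq> u})"
  have pV: "p1 u \<in> ?V" "p1 (p1 u) = p1 u" "p1 u \<noteq> u \<Longrightarrow> {u, p1 u} \<in> edges G1" if "u \<in> ?V" for u
    using p1 that by (auto simp: centre_map_def)
  have pV': "p2 u \<in> ?V'" "p2 (p2 u) = p2 u" "p2 u \<noteq> u \<Longrightarrow> {u, p2 u} \<in> edges G2" if "u \<in> ?V'" for u
    using p2 that by (auto simp: centre_map_def)
  have C: "c \<in> C \<longleftrightarrow> c \<in> ?V \<and> (\<exists>u\<in>?V. u \<noteq> c \<and> p1 u = c)" for c
    using fin by (auto simp: C_def leaf_count_pos_iff leaf_set_def)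
  have W: "u \<in> W \<longleftrightarrow> u \<in> ?V \<and> (p1 u \<noteq> u \<or> u \<in> C)" for u
    by (auto simp: W_def used_def C_def)
  have pC: "p1 u \<in> C" if "u \<in> W" for u
    using that pV(1,2)[of u] by (cases "p1 u = u") (auto simp: W C intro!: bexI[of _ u])
  have CW: "p1 c = c" if "c \<in> C" for c using that pV by (auto simp: C)
  have fix2: "p2 c = c" if "0 < leaf_count p2 ?V' c" for c
    using that pV' fin by (auto simp: leaf_count_pos_iff leaf_set_def)
  have "star_forest H"
    unfolding star_forest_def
  proof (intro exI conjI)
    let ?S = "(\<lambda>c. star_graph c (?l c)) ` C"
    show "finite ?S" using fin by (auto simp: C_def)
    show "\<forall>S\<in>?S. nontrivial_star S"
    proof
      fix S assume "S \<in> ?S"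
      then obtain c where "c \<in> C" "S = star_graph c (?l c)" by blast
      then show "nontrivial_star S"
        using fin by (auto intro!: nontrivial_star_star_graph simp: C_def leaf_count_pos_iff)
          (auto simp: leaf_set_def)
    qed
    show "disjoint_family_on verts ?S"
      using CW by (fastforce simp: disjoint_family_on_def star_graph_def leaf_set_def)
    have "W = (\<Union>c\<in>C. insert c (?l c))"
    proof
      show "W \<subseteq> (\<Union>c\<in>C. insert c (?l c))"
      proof
        fix u assume u: "u \<in> W"
        show "u \<in> (\<Union>c\<in>C. insert c (?l c))"
          using u pC[OF u] by (cases "p1 u = u") (auto simp: W leaf_set_def)
      qed
      show "(\<Union>c\<in>C. insert c (?l c)) \<subseteq> W"
        using CW by (auto simp: W leaf_set_def C)
    qed
    moreover have "(\<lambda>u. {u, p1 u}) ` {u \<in> ?V. p1 u \<noteq> u} = (\<Union>c\<in>C. (\<lambda>l. {c, l}) ` ?l c)"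
    proof
      show "(\<lambda>u. {u, p1 u}) ` {u \<in> ?V. p1 u \<noteq> u} \<subseteq> (\<Union>c\<in>C. (\<lambda>l. {c, l}) ` ?l c)"
      proof
        fix e assume "e \<in> (\<lambda>u. {u, p1 u}) ` {u \<in> ?V. p1 u \<noteq> u}"
        then obtain u where u: "u \<in> ?V" "p1 u \<noteq> u" "e = {p1 u, u}" by (auto simp: insert_commute)
        then have "p1 u \<in> C" "u \<in> ?l (p1 u)" using pC by (auto simp: W leaf_set_def)
        then show "e \<in> (\<Union>c\<in>C. (\<lambda>l. {c, l}) ` ?l c)" using u by blast
      qed
      show "(\<Union>c\<in>C. (\<lambda>l. {c, l}) ` ?l c) \<subseteq> (\<lambda>u. {u, p1 u}) ` {u \<in> ?V. p1 u \<noteq> u}"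
        by (fastforce simp: leaf_set_def insert_commute)
    qed
    ultimately show "H = (\<Union>S\<in>?S. verts S, \<Union>S\<in>?S. edges S)"
      by (simp add: H_def star_graph_def)
  qed
  moreover have "subgraph_of H G1"
    unfolding subgraph_of_def
  proof (intro exI[of _ "\<lambda>u. u"] conjI allI impI)
    fix u v assume "{u, v} \<in> edges H"
    then show "{u, v} \<in> edges G1" using pV(3) by (auto simp: H_def)
  qed (auto simp: H_def W)
  moreover have "subgraph_of H G2"
  proof -
    obtain \<sigma> where \<sigma>: "inj_on \<sigma> C"
      "\<And>c. c \<in> C \<Longrightarrow> \<sigma> c \<in> ?V' \<and> leaf_count p2 ?V' (\<sigma> c) = leaf_count p1 ?V c"
      using match_counts[OF fin, of "leaf_count p1 ?V" "leaf_count p2 ?V'"] eq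
      unfolding profile_def C_def by (metis (mono_tags, lifting) mem_Collect_eq)
    have \<sigma>fix: "p2 (\<sigma> c) = \<sigma> c" if "c \<in> C" for c
      using \<sigma>(2)[OF that] that by (intro fix2) (auto simp: C_def)
    have "\<exists>\<tau>. bij_betw \<tau> (?l c) (?l' (\<sigma> c))" if "c \<in> C" for c
      using \<sigma>(2)[OF that] fin
      by (intro finite_same_card_bij) (auto simp: leaf_count_def leaf_set_def)
    then obtain \<tau> where \<tau>: "\<And>c. c \<in> C \<Longrightarrow> bij_betw (\<tau> c) (?l c) (?l' (\<sigma> c))" by metis
    \<comment> \<open>Inside \<open>W\<close> the fixed points of \<open>p1\<close> are exactly the
      centres.\<close>
    define \<psi> where "\<psi> u = (if p1 u = u then \<sigma> u else \<tau> (p1 u) u)" for u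
    have \<psi>l: "\<psi> u \<in> ?l' (\<sigma> (p1 u))" if "u \<in> W" "p1 u \<noteq> u" for u
    proof -
      have "u \<in> ?l (p1 u)" using that by (auto simp: leaf_set_def W)
      then show ?thesis using bij_betwE[OF \<tau>[OF pC[OF that(1)]]] that by (auto simp: \<psi>_def)
    qed
    have \<psi>p: "\<psi> u \<in> ?V'" "p2 (\<psi> u) = \<sigma> (p1 u)" "\<psi> u = \<sigma> (p1 u) \<longleftrightarrow> p1 u = u" if u: "u \<in> W" for u
    proof -
      have "\<psi> u \<in> ?V' \<and> p2 (\<psi> u) = \<sigma> (p1 u) \<and> (\<psi> u = \<sigma> (p1 u) \<longleftrightarrow> p1 u = u)"
      proof (cases "p1 u = u")
        case True
        then show ?thesis using pC[OF u] \<sigma>(2) \<sigma>fix by (auto simp: \<psi>_def)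
      next
        case False
        then show ?thesis using \<psi>l[OF u] by (auto simp: leaf_set_def)
      qed
      then show "\<psi> u \<in> ?V'" "p2 (\<psi> u) = \<sigma> (p1 u)" "\<psi> u = \<sigma> (p1 u) \<longleftrightarrow> p1 u = u" by auto
    qed
    have "inj_on \<psi> W"
    proof (rule inj_onI)
      fix u v assume u: "u \<in> W" and v: "v \<in> W" and e: "\<psi> u = \<psi> v"
      \<comment> \<open>Applying \<open>p2\<close> to an image recovers its centre, which reduces
        injectivity to a single star.\<close>
      have "\<sigma> (p1 u) = \<sigma> (p1 v)" using \<psi>p(2)[OF u] \<psi>p(2)[OF v] e by simp
      then have c: "p1 u = p1 v" using \<sigma>(1) pC[OF u] pC[OF v] by (auto simp: inj_on_def)
      show "u = v"
      proof (cases "p1 u = u")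
        case True
        then have "p1 v = v" using \<psi>p(3)[OF u] \<psi>p(3)[OF v] e c by simp
        then show ?thesis using c True by simp
      next
        case False
        then have nv: "p1 v \<noteq> v" using \<psi>p(3)[OF u] \<psi>p(3)[OF v] e c by simp
        have "u \<in> ?l (p1 u)" "v \<in> ?l (p1 u)" using u v False nv c by (auto simp: leaf_set_def W)
        then show ?thesis using bij_betw_imp_inj_on[OF \<tau>[OF pC[OF u]]] e False nv c
          by (auto simp: \<psi>_def inj_on_def)
      qed
    qed
    moreover have "{\<psi> u, \<psi> v} \<in> edges G2" if uv: "{u, v} \<in> edges H" for u v
    proof -
      obtain x where x: "{u, v} = {x, p1 x}" "x \<in> ?V" "p1 x \<noteq> x"
        using uv unfolding H_def snd_conv by (elim imageE) blast
      then have xW: "x \<in> W" by (simp add: W)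
      have "\<psi> (p1 x) = p2 (\<psi> x)" using \<psi>p(2)[OF xW] x pV by (simp add: \<psi>_def)
      moreover have "p2 (\<psi> x) \<noteq> \<psi> x" using \<psi>p[OF xW] x by auto
      ultimately have "{\<psi> x, \<psi> (p1 x)} \<in> edges G2" using pV'(3) \<psi>p(1)[OF xW] by simp
      moreover have "{\<psi> u, \<psi> v} = \<psi> ` {u, v}" by simp
      ultimately show ?thesis using x(1) by (metis image_empty image_insert)
    qed
    ultimately show ?thesis unfolding subgraph_of_def using \<psi>p(1)
      by (intro exI[of _ \<psi>]) (auto simp: H_def)
  qed
  ultimately have "common_star_forest G1 G2 H" by (simp add: common_star_forest_def)
  then show ?thesis using that by (auto simp: H_def W_def)
qed

text \<open>The vertices of \<open>G1\<close> are natural numbers, as those of \<open>H\<close> have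
  to be, so \<open>H\<close> can be a subgraph of \<open>G1\<close> without renaming and its size
  can be read off from \<open>p1\<close>.\<close>

theorem common_star_forest_iff:
  fixes G1 :: "nat graph" and G2 :: "'b graph"
  assumes "simple_graph G1" "simple_graph G2"
  shows "(\<exists>H. common_star_forest G1 G2 H \<and> card (verts H) = w) \<longleftrightarrow>
    (\<exists>p1 p2. centre_map (edges G1) (verts G1) p1 \<and> centre_map (edges G2) (verts G2) p2 \<and>
      (\<forall>j. profile p1 (verts G1) j = profile p2 (verts G2) j) \<and> card (used p1 (verts G1)) = w)"
    (is "?L \<longleftrightarrow> ?R")
proof -
  have fin: "finite (verts G1)" "finite (verts G2)" using assms by (auto simp: simple_graph_def)
  show ?thesis
  proof
  assume ?L
  then obtain H :: "nat graph" where H: "star_forest H" "subgraph_of H G1" "subgraph_of H G2" "card (verts H) = w"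
    unfolding common_star_forest_def by blast
  obtain q where q: "centre_map (edges H) (verts H) q" "used q (verts H) = verts H"
    using star_forest_centre_map[OF H(1)] by metis
  obtain \<phi>1 where f1: "inj_on \<phi>1 (verts H)" "\<phi>1 ` verts H \<subseteq> verts G1"
    "\<And>u v. {u, v} \<in> edges H \<Longrightarrow> {\<phi>1 u, \<phi>1 v} \<in> edges G1"
    using H(2) unfolding subgraph_of_def by blast
  obtain \<phi>2 where f2: "inj_on \<phi>2 (verts H)" "\<phi>2 ` verts H \<subseteq> verts G2"
    "\<And>u v. {u, v} \<in> edges H \<Longrightarrow> {\<phi>2 u, \<phi>2 v} \<in> edges G2"
    using H(3) unfolding subgraph_of_def by blast
  obtain p1 where p1: "centre_map (edges G1) (verts G1) p1"
    "\<And>j. profile p1 (verts G1) j = profile q (verts H) j"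
    "card (used p1 (verts G1)) = card (used q (verts H))"
    using centre_map_embed[OF q(1) f1 fin(1)] by blast
  obtain p2 where p2: "centre_map (edges G2) (verts G2) p2"
    "\<And>j. profile p2 (verts G2) j = profile q (verts H) j"
    using centre_map_embed[OF q(1) f2 fin(2)] by blast
  show ?R using p1 p2 q H by (intro exI[of _ p1] exI[of _ p2]) auto
next
  assume ?R
  then obtain p1 p2 where p: "centre_map (edges G1) (verts G1) p1"
    "centre_map (edges G2) (verts G2) p2"
    "\<And>j. profile p1 (verts G1) j = profile p2 (verts G2) j"
    "card (used p1 (verts G1)) = w"
    by blast
  obtain H where "common_star_forest G1 G2 H" "verts H = used p1 (verts G1)"
    by (rule centre_map_imp_common_star_forest[OF fin p(1-3)])
  then show ?L using p(4) by (intro exI[of _ H]) simp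
  qed
qed

section \<open>Difference vectors\<close>

text \<open>Zero beyond the end of the list, so that missing entries and trailing zeros have the
  same meaning.\<close>

fun vval :: "data \<Rightarrow> nat \<Rightarrow> int" where
  "vval Atom j = 0"
| "vval (Pair a v) 0 = int (dlen (data_fst a)) - int (dlen (data_snd a))"
| "vval (Pair a v) (Suc j) = vval v j"

text \<open>\<open>in_box\<close> and \<open>zero_vec\<close> look at the two parts of an entry
  separately. On reduced differences, where one part is zero, they agree with the conditions on the
  integer value.\<close>

definition canonical :: "data \<Rightarrow> bool" where
  "canonical v \<longleftrightarrow> (\<forall>e\<in>set (dlist v). data_fst e = Atom \<or> data_snd e = Atom)"

abbreviation st_w :: "data \<Rightarrow> nat" where "st_w s \<equiv> dlen (data_fst s)"
abbreviation st_v :: "data \<Rightarrow> nat \<Rightarrow> int" where "st_v s \<equiv> vval (data_snd s)"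

lemma canonical_simps [simp]:
  "canonical Atom"
  "canonical (Pair a v) \<longleftrightarrow> (data_fst a = Atom \<or> data_snd a = Atom) \<and> canonical v"
  by (auto simp: canonical_def)

lemma dlen_d_app [simp]: "dlen (d_app x y) = dlen x + dlen y"
  by (simp add: d_app_def)

lemma d_norm_canonical: "data_fst (d_norm p q) = Atom \<or> data_snd (d_norm p q) = Atom"
  by (induction p q rule: d_norm.induct) auto

lemma d_norm_diff:
  "int (dlen (data_fst (d_norm p q))) - int (dlen (data_snd (d_norm p q))) = int (dlen p) - int (dlen q)"
  by (induction p q rule: d_norm.induct) auto

lemma vval_d_addvec [simp]: "vval (d_addvec x y) j = vval x j + vval y j"
proof (induction x y arbitrary: j rule: d_addvec.induct)
  case (3 a x b y)
  then show ?case by (cases j) (auto simp: d_norm_diff)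
qed auto

lemma canonical_d_addvec: "canonical x \<Longrightarrow> canonical y \<Longrightarrow> canonical (d_addvec x y)"
  by (induction x y rule: d_addvec.induct) (auto simp: d_norm_canonical)

text \<open>Splits off coordinate 0, to follow the recursion of \<open>vval\<close> along the
  list.\<close>

lemma all_nat_split: "(\<forall>j. P j) \<longleftrightarrow> P 0 \<and> (\<forall>j. P (Suc j))"
  by (metis not0_implies_Suc)

lemma in_box_iff: "canonical v \<Longrightarrow> in_box B v \<longleftrightarrow> (\<forall>j. \<bar>vval v j\<bar> \<le> int (dlen B))"
proof (induction v)
  case (Pair a v)
  then show ?case by (subst all_nat_split) auto
qed simp

lemma zero_vec_iff: "canonical v \<Longrightarrow> zero_vec v \<longleftrightarrow> (\<forall>j. vval v j = 0)"
proof (induction v)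
  case (Pair a v)
  then show ?case by (subst all_nat_split) auto
qed simp

lemma dlen_le_pairs: "dlen d \<le> pairs d"
  by (induction d) auto

text \<open>Lets the radius of the box be computed as a size of data, without looking at single
  coordinates.\<close>

lemma abs_vval_le: "\<bar>vval v j\<bar> \<le> int (pairs v)"
proof (induction v j rule: vval.induct)
  case (2 a v)
  have "dlen (data_fst a) \<le> pairs a" "dlen (data_snd a) \<le> pairs a"
    using dlen_le_pairs pairs_data_fst_snd le_trans by blast+
  then show ?case by auto
qed auto

lemma d_add_simps [simp]:
  "st_w (d_add s t) = st_w s + st_w t" "st_v (d_add s t) j = st_v s j + st_v t j"
  by (simp_all add: d_add_def)

section \<open>Combining state sets\<close>

lemma set_d_comb1:
  "set (dlist (d_comb1 B s T acc)) = set (dlist acc)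
     \<union> {d_add s t | t. t \<in> set (dlist T) \<and> in_box B (data_snd (d_add s t))}"
  by (induction B s T acc rule: d_comb1.induct) (auto simp: d_insert_def)

text \<open>Without duplicates the length of a list of states is bounded by the number of states in
  the box.\<close>

lemma distinct_d_comb1: "distinct (dlist acc) \<Longrightarrow> distinct (dlist (d_comb1 B s T acc))"
  by (induction B s T acc rule: d_comb1.induct) (auto simp: d_insert_def)

lemma set_d_comb:
  "set (dlist (d_comb B S T acc)) = set (dlist acc)
     \<union> {d_add s t | s t. s \<in> set (dlist S) \<and> t \<in> set (dlist T) \<and> in_box B (data_snd (d_add s t))}"
  by (induction B S T acc rule: d_comb.induct) (auto simp: set_d_comb1)

lemma distinct_d_comb: "distinct (dlist acc) \<Longrightarrow> distinct (dlist (d_comb B S T acc))"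
  by (induction B S T acc rule: d_comb.induct) (auto simp: distinct_d_comb1)

section \<open>Alternating splits of grouped lists\<close>

text \<open>Each maximal run of equal elements pays once. In an alternating sum a run cancels in
  pairs and leaves at most one element over.\<close>

fun runs_sum :: "('a \<Rightarrow> int) \<Rightarrow> 'a list \<Rightarrow> int" where
  "runs_sum g [] = 0"
| "runs_sum g [x] = \<bar>g x\<bar>"
| "runs_sum g (x # y # ys) = (if x = y then 0 else \<bar>g x\<bar>) + runs_sum g (y # ys)"

lemma runs_sum_nonneg: "0 \<le> runs_sum g xs"
  by (induction g xs rule: runs_sum.induct) auto

lemma runs_sum_Cons: "runs_sum g xs \<le> runs_sum g (x # xs)"
  by (cases xs) auto

lemma runs_sum_Cons_le: "runs_sum g (x # xs) \<le> \<bar>g x\<bar> + runs_sum g xs"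
  by (cases xs) auto

text \<open>Deleting an element can shorten or remove a run or merge two runs, but never splits
  one.\<close>

lemma runs_sum_skip: "runs_sum g (x # zs) \<le> runs_sum g (x # y # zs)"
  by (cases zs) (auto simp: runs_sum_nonneg)

lemma runs_sum_append: "runs_sum g (xs @ ys) \<le> runs_sum g xs + runs_sum g ys"
proof (induction g xs rule: runs_sum.induct)
  case (2 g x)
  then show ?case using runs_sum_Cons_le by simp
qed auto

lemma runs_sum_Cons_odds: "runs_sum g (x # odds xs) \<le> runs_sum g (x # xs)"
proof (induction xs arbitrary: x rule: odds.induct)
  case (3 a b ys)
  have "runs_sum g (a # odds ys) \<le> runs_sum g (a # b # ys)"
    using 3[of a] runs_sum_skip[of g a ys b] by linarith
  then show ?case by simp
qed auto

lemma runs_sum_odds: "runs_sum g (odds xs) \<le> runs_sum g xs"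
proof (cases xs)
  case (Cons x ys)
  have "runs_sum g (x # odds (tl ys)) \<le> runs_sum g (x # tl ys)" by (rule runs_sum_Cons_odds)
  also have "\<dots> \<le> runs_sum g (x # ys)" by (cases ys) (auto simp: runs_sum_skip simp del: runs_sum.simps)
  finally show ?thesis by (simp add: Cons odds_Cons)
qed simp

lemma runs_sum_odds_tl: "runs_sum g (odds (tl xs)) \<le> runs_sum g xs"
  using runs_sum_odds[of g "tl xs"] runs_sum_Cons[of g "tl xs" "hd xs"] by (cases xs) auto

text \<open>Two equal leading elements go to different halves and cancel. Otherwise the first
  element ends its run and pays for itself, and the halves of the rest swap roles, which the
  absolute value hides.\<close>

lemma odds_diff_le_runs_sum:
  "\<bar>sum_list (map g (odds xs)) - sum_list (map g (odds (tl xs)))\<bar> \<le> runs_sum g xs"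
proof (induction "length xs" arbitrary: xs rule: less_induct)
  case less
  show ?case
  proof (cases xs rule: odds.cases)
    case (3 x y ys)
    show ?thesis
    proof (cases "x = y")
      case True
      have "\<bar>sum_list (map g (odds ys)) - sum_list (map g (odds (tl ys)))\<bar> \<le> runs_sum g ys"
        using less 3 by simp
      then show ?thesis using True 3 runs_sum_Cons[of g ys y] by (simp add: odds_Cons)
    next
      case False
      have "\<bar>sum_list (map g (odds (y # ys))) - sum_list (map g (odds ys))\<bar> \<le> runs_sum g (y # ys)"
        using less.hyps[of "y # ys"] 3 by simp
      then show ?thesis using False 3 by simp
    qed
  qed auto
qed

lemma sum_odds: "sum_list (map g (odds xs)) + sum_list (map g (odds (tl xs))) = (sum_list (map g xs) :: int)"
  by (induction xs) (auto simp: odds_Cons)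

lemma set_ginsert [simp]: "set (ginsert x xs) = insert x (set xs)"
  by (induction xs) auto

lemma mset_ginsert [simp]: "mset (ginsert x xs) = add_mset x (mset xs)"
  by (induction xs) auto

lemma ginsert_Cons_hd: "\<exists>ys. ginsert x (z # zs) = z # ys"
  by auto

text \<open>Beside its twin a new element joins an existing run and costs nothing; otherwise it
  forms one new run at the end.\<close>

lemma runs_sum_ginsert:
  "runs_sum g (ginsert x ys) \<le> (if x \<in> set ys then 0 else \<bar>g x\<bar>) + runs_sum g ys"
proof (induction ys)
  case (Cons y ys)
  show ?case
  proof (cases "y = x")
    case False
    show ?thesis
    proof (cases ys)
      case (Cons z zs)
      obtain r where r: "ginsert x ys = z # r" using ginsert_Cons_hd Cons by metis
      then show ?thesis using Cons.IH False Cons by auto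
    qed (use False in auto)
  qed auto
qed simp

text \<open>The permutation is chosen independently of \<open>g\<close>: one order has to serve all
  coordinates at once.\<close>

lemma grouping_exists:
  "\<exists>ys. mset ys = mset xs \<and> (\<forall>g. runs_sum g ys \<le> (\<Sum>x\<in>set xs. \<bar>g x\<bar>))"
proof (induction xs)
  case (Cons x xs)
  then obtain ys where ys: "mset ys = mset xs" "\<And>g. runs_sum g ys \<le> (\<Sum>x\<in>set xs. \<bar>g x\<bar>)" by auto
  have s: "set ys = set xs" using ys(1) by (metis set_mset_mset)
  have "runs_sum g (ginsert x ys) \<le> (\<Sum>x\<in>set (x # xs). \<bar>g x\<bar>)" for g
    using runs_sum_ginsert[of g x ys] ys(2)[of g] s by (auto simp: sum.insert_if split: if_splits)
  then show ?case using ys(1) by (intro exI[of _ "ginsert x ys"]) auto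
qed auto

fun grouped :: "'a list \<Rightarrow> bool" where
  "grouped [] = True"
| "grouped (x # xs) = (grouped xs \<and> (x \<in> set xs \<longrightarrow> hd xs = x))"

lemma grouped_ginsert: "grouped xs \<Longrightarrow> grouped (ginsert x xs)"
proof (induction xs)
  case (Cons y ys)
  then show ?case by (cases ys) auto
qed simp

lemma grouped_split:
  "grouped xs \<Longrightarrow> xs \<noteq> [] \<Longrightarrow> \<exists>n \<tau> ys. xs = replicate (Suc n) \<tau> @ ys \<and> \<tau> \<notin> set ys \<and> grouped ys"
proof (induction xs)
  case (Cons x xs)
  show ?case
  proof (cases "x \<in> set xs")
    case False
    then show ?thesis using Cons.prems by (intro exI[of _ 0] exI[of _ x] exI[of _ xs]) auto
  next
    case True
    then obtain n \<tau> ys where ys: "xs = replicate (Suc n) \<tau> @ ys" "\<tau> \<notin> set ys" "grouped ys"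
      using Cons by force
    then have "\<tau> = x" using Cons.prems True by auto
    then show ?thesis using ys by (intro exI[of _ "Suc n"] exI[of _ \<tau>] exI[of _ ys]) auto
  qed
qed simp

text \<open>Choices for equal offers can be exchanged, so they are regrouped within each group of
  offers. Each state of an offer then pays at most once per group, and the bound is independent of
  the length of the list.\<close>

lemma list_all2_regroup:
  assumes "grouped xs" "list_all2 (\<lambda>s \<tau>. s \<in> A \<tau>) ch xs" "\<And>\<tau>. finite (A \<tau>)"
  shows "\<exists>ch'. list_all2 (\<lambda>s \<tau>. s \<in> A \<tau>) ch' xs \<and> mset ch' = mset ch
    \<and> (\<forall>g. runs_sum g ch' \<le> (\<Sum>\<tau>\<in>set xs. \<Sum>s\<in>A \<tau>. \<bar>g s\<bar>))"
  using assms(1,2)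
proof (induction "length xs" arbitrary: xs ch rule: less_induct)
  case less
  show ?case
  proof (cases "xs = []")
    case False
    obtain n \<tau> ys where ys: "xs = replicate (Suc n) \<tau> @ ys" "\<tau> \<notin> set ys" "grouped ys"
      using grouped_split[OF less.prems(1) False] by blast
    obtain c1 c2 where c: "ch = c1 @ c2" "list_all2 (\<lambda>s \<tau>. s \<in> A \<tau>) c1 (replicate (Suc n) \<tau>)"
      "list_all2 (\<lambda>s \<tau>. s \<in> A \<tau>) c2 ys"
      using less.prems(2) ys(1) by (auto simp: list_all2_append2 simp del: replicate_Suc)
    have c1: "length c1 = Suc n" "set c1 \<subseteq> A \<tau>"
      using c(2) by (auto simp: list_all2_conv_all_nth in_set_conv_nth simp del: replicate_Suc)
    obtain d1 where d1: "mset d1 = mset c1" "\<And>g. runs_sum g d1 \<le> (\<Sum>x\<in>set c1. \<bar>g x\<bar>)"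
      using grouping_exists[of c1] by blast
    obtain d2 where d2: "list_all2 (\<lambda>s \<tau>. s \<in> A \<tau>) d2 ys" "mset d2 = mset c2"
      "\<And>g. runs_sum g d2 \<le> (\<Sum>\<tau>\<in>set ys. \<Sum>s\<in>A \<tau>. \<bar>g s\<bar>)"
      using less.hyps[of ys c2] ys c(3) by auto
    have "length d1 = Suc n" "set d1 \<subseteq> A \<tau>"
      using d1(1) c1 by (metis size_mset, metis set_mset_mset)
    then have "list_all2 (\<lambda>s \<tau>. s \<in> A \<tau>) d1 (replicate (Suc n) \<tau>)"
      by (auto simp: list_all2_conv_all_nth simp del: replicate_Suc)
    then have "list_all2 (\<lambda>s \<tau>. s \<in> A \<tau>) (d1 @ d2) xs" 
      unfolding ys(1) using d2(1) by (rule list_all2_appendI)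
    moreover have "runs_sum g (d1 @ d2) \<le> (\<Sum>\<tau>\<in>set xs. \<Sum>s\<in>A \<tau>. \<bar>g s\<bar>)" for g
    proof -
      have "runs_sum g (d1 @ d2) \<le> runs_sum g d1 + runs_sum g d2" by (rule runs_sum_append)
      also have "runs_sum g d1 \<le> (\<Sum>s\<in>A \<tau>. \<bar>g s\<bar>)"
        using d1(2)[of g] sum_mono2[OF assms(3)[of \<tau>] c1(2), of "\<lambda>s. \<bar>g s\<bar>"] by simp
      \<comment> \<open>Since \<open>\<tau> \<notin> set ys\<close>, the offer \<open>\<tau>\<close>
        is not charged a second time.\<close>
      also have "(\<Sum>s\<in>A \<tau>. \<bar>g s\<bar>) + runs_sum g d2 \<le> (\<Sum>\<tau>\<in>insert \<tau> (set ys). \<Sum>s\<in>A \<tau>. \<bar>g s\<bar>)"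
        using d2(3)[of g] ys(2) by simp
      also have "insert \<tau> (set ys) = set xs" using ys(1) by auto
      finally show ?thesis by simp
    qed
    ultimately show ?thesis using d1(1) d2(2) c(1) by (intro exI[of _ "d1 @ d2"]) auto
  qed (use less.prems in auto)
qed

section \<open>Correctness of the divide-and-conquer search\<close>

definition choice :: "data list \<Rightarrow> data list \<Rightarrow> bool" where
  "choice ch Ls \<longleftrightarrow> list_all2 (\<lambda>s \<tau>. s \<in> set (dlist \<tau>)) ch Ls"

definition tot_w :: "data list \<Rightarrow> nat" where "tot_w ch = sum_list (map st_w ch)"
definition tot_v :: "data list \<Rightarrow> nat \<Rightarrow> int" where "tot_v ch j = sum_list (map (\<lambda>s. st_v s j) ch)"

text \<open>Inverse of the alternating split: the two lists swap roles after each element, just as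
  \<open>odds (x # xs)\<close> continues with \<open>odds (tl xs)\<close>.\<close>

function interleave :: "'a list \<Rightarrow> 'a list \<Rightarrow> 'a list" where
  "interleave [] ys = ys"
| "interleave (x # xs) ys = x # interleave ys xs"
  by pat_completeness auto
termination by (relation "measure (\<lambda>(xs, ys). length xs + length ys)") auto

lemma mset_interleave: "mset (interleave xs ys) = mset xs + mset ys"
  by (induction xs ys rule: interleave.induct) auto

lemma list_all2_interleave:
  "list_all2 R c1 (odds xs) \<Longrightarrow> list_all2 R c2 (odds (tl xs)) \<Longrightarrow> list_all2 R (interleave c1 c2) xs"
proof (induction xs arbitrary: c1 c2)
  case (Cons x xs)
  then show ?case by (auto simp: odds_Cons list_all2_Cons2)
qed simp

lemma list_all2_odds:
  "list_all2 R ch xs \<Longrightarrow> list_all2 R (odds ch) (odds xs) \<and> list_all2 R (odds (tl ch)) (odds (tl xs))"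
  by (induction rule: list_all2_induct) (auto simp: odds_Cons)

lemma sum_list_mset_cong: "mset xs = mset ys \<Longrightarrow> sum_list (map f xs) = sum_list (map f ys)"
  for f :: "'a \<Rightarrow> 'b :: comm_monoid_add"
  by (metis mset_map sum_mset_sum_list)

lemma tot_append [simp]: "tot_w (xs @ ys) = tot_w xs + tot_w ys" "tot_v (xs @ ys) j = tot_v xs j + tot_v ys j"
  by (simp_all add: tot_w_def tot_v_def)

lemma tot_cong: "mset xs = mset ys \<Longrightarrow> tot_w xs = tot_w ys" "mset xs = mset ys \<Longrightarrow> tot_v xs j = tot_v ys j"
  unfolding tot_w_def tot_v_def by (rule sum_list_mset_cong; assumption)+

lemma dlist_d_odds: "dlist (d_odds L) = odds (dlist L)" "dlist (d_odds (data_snd L)) = odds (tl (dlist L))"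
  by (simp_all add: d_odds_def dlist_data_snd)

lemma set_odds: "set (odds xs) \<subseteq> set xs"
  by (induction xs rule: odds.induct) auto

lemma set_tl_subset: "set (tl xs) \<subseteq> set xs"
  by (cases xs) auto

text \<open>Pruning only removes states; a surviving sum is realised by interleaving the choices
  that realise its two summands.\<close>

lemma d_solve_sound:
  "s \<in> set (dlist (d_solve B L)) \<Longrightarrow>
    \<exists>ch. choice ch (dlist L) \<and> st_w s = tot_w ch \<and> (\<forall>j. st_v s j = tot_v ch j)"
proof (induction B L arbitrary: s rule: d_solve.induct)
  case (1 B L)
  show ?case
  proof (cases "data_snd L = Atom")
    case True
    have "s \<in> set (dlist (data_fst L))" using 1(3) True by (simp add: d_solve.simps[of B L])
    then show ?thesis using True
      by (cases L) (auto simp: choice_def tot_w_def tot_v_def intro!: exI[of _ "[s]"])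
  next
    case False
    then obtain s1 s2 where s: "s = d_add s1 s2" "s1 \<in> set (dlist (d_solve B (d_odds L)))"
      "s2 \<in> set (dlist (d_solve B (d_odds (data_snd L))))"
      using 1(3) by (auto simp: d_solve.simps[of B L] set_d_comb)
    obtain c1 where c1: "choice c1 (odds (dlist L))" "st_w s1 = tot_w c1" "\<And>j. st_v s1 j = tot_v c1 j"
      using 1(1)[OF False s(2)] by (auto simp: dlist_d_odds dlist_data_snd)
    obtain c2 where c2: "choice c2 (odds (tl (dlist L)))" "st_w s2 = tot_w c2" "\<And>j. st_v s2 j = tot_v c2 j"
      using 1(2)[OF False s(3)] by (auto simp: dlist_d_odds dlist_data_snd)
    have "choice (interleave c1 c2) (dlist L)"
      using c1 c2 list_all2_interleave by (auto simp: choice_def)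
    moreover have "mset (interleave c1 c2) = mset (c1 @ c2)" by (simp add: mset_interleave)
    ultimately show ?thesis using c1 c2 s tot_cong[of "interleave c1 c2" "c1 @ c2"]
      by (intro exI[of _ "interleave c1 c2"]) auto
  qed
qed

text \<open>Common induction for properties of states that hold in all offers and survive addition:
  canonical form, unary weights, number of coordinates.\<close>

lemma d_solve_invariant:
  assumes "\<And>s t. P s \<Longrightarrow> P t \<Longrightarrow> in_box B (data_snd (d_add s t)) \<Longrightarrow> P (d_add s t)"
    and "\<forall>\<tau>\<in>set (dlist L). \<forall>s\<in>set (dlist \<tau>). P s"
  shows "s \<in> set (dlist (d_solve B L)) \<Longrightarrow> P s"
  using assms
proof (induction B L arbitrary: s rule: d_solve.induct)
  case (1 B L)
  show ?case
  proof (cases "data_snd L = Atom")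
    case True
    have "s \<in> set (dlist (data_fst L))" using 1(3) True by (simp add: d_solve.simps[of B L])
    then show ?thesis using 1(5) by (cases L) auto
  next
    case False
    then obtain s1 s2 where s: "s = d_add s1 s2" "s1 \<in> set (dlist (d_solve B (d_odds L)))"
      "s2 \<in> set (dlist (d_solve B (d_odds (data_snd L))))" "in_box B (data_snd s)"
      using 1(3) by (auto simp: d_solve.simps[of B L] set_d_comb)
    have "\<forall>\<tau>\<in>set (dlist (d_odds L)). \<forall>s\<in>set (dlist \<tau>). P s"
      "\<forall>\<tau>\<in>set (dlist (d_odds (data_snd L))). \<forall>s\<in>set (dlist \<tau>). P s"
      using 1(5) set_odds set_tl_subset by (fastforce simp: dlist_d_odds dlist_data_snd)+
    then have "P s1" "P s2" using 1(1)[OF False s(2) 1(4)] 1(2)[OF False s(3) 1(4)] by blast+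
    then show ?thesis using 1(4) s(1,4) by blast
  qed
qed

lemma d_solve_canonical:
  assumes "\<forall>\<tau>\<in>set (dlist L). \<forall>s\<in>set (dlist \<tau>). canonical (data_snd s)"
  shows "s \<in> set (dlist (d_solve B L)) \<Longrightarrow> canonical (data_snd s)"
  by (rule d_solve_invariant[of "\<lambda>s. canonical (data_snd s)", OF _ assms])
    (simp_all add: d_add_def canonical_d_addvec)

text \<open>The total and the run sums of the choice are bounded by the radius, and both halves
  inherit both bounds with the same radius: the totals through their sum and difference, the run
  sums because \<open>odds\<close> only deletes elements.\<close>

lemma d_solve_complete:
  assumes "choice ch (dlist L)" "L \<noteq> Atom"
    "\<forall>\<tau>\<in>set (dlist L). \<forall>s\<in>set (dlist \<tau>). canonical (data_snd s)"
    "\<And>j. runs_sum (\<lambda>s. st_v s j) ch \<le> int (dlen B)" "\<And>j. \<bar>tot_v ch j\<bar> \<le> int (dlen B)"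
  shows "\<exists>s\<in>set (dlist (d_solve B L)). st_w s = tot_w ch \<and> (\<forall>j. st_v s j = tot_v ch j)"
  using assms
proof (induction B L arbitrary: ch rule: d_solve.induct)
  case (1 B L)
  show ?case
  proof (cases "data_snd L = Atom")
    case True
    then obtain \<tau> where L: "L = Pair \<tau> Atom" using 1(4) by (cases L) auto
    then obtain s where "ch = [s]" "s \<in> set (dlist \<tau>)"
      using 1(3) by (auto simp: choice_def list_all2_Cons2)
    then show ?thesis using L by (intro bexI[of _ s]) (auto simp: tot_w_def tot_v_def d_solve.simps[of B "Pair \<tau> Atom"])
  next
    case False
    let ?c1 = "odds ch" and ?c2 = "odds (tl ch)"
    have ch: "choice ?c1 (dlist (d_odds L))" "choice ?c2 (dlist (d_odds (data_snd L)))"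
      using 1(3) list_all2_odds by (auto simp: choice_def dlist_d_odds dlist_data_snd)
    have ne: "d_odds L \<noteq> Atom" "d_odds (data_snd L) \<noteq> Atom"
      using False by (cases L; cases "data_snd L"; auto)+
    have can1: "\<forall>\<tau>\<in>set (dlist (d_odds L)). \<forall>s\<in>set (dlist \<tau>). canonical (data_snd s)"
      using 1(5) set_odds by (fastforce simp: dlist_d_odds dlist_data_snd)
    have can2: "\<forall>\<tau>\<in>set (dlist (d_odds (data_snd L))). \<forall>s\<in>set (dlist \<tau>). canonical (data_snd s)"
      using 1(5) set_odds set_tl_subset by (fastforce simp: dlist_d_odds dlist_data_snd)
    have r: "runs_sum (\<lambda>s. st_v s j) ?c1 \<le> int (dlen B)" "runs_sum (\<lambda>s. st_v s j) ?c2 \<le> int (dlen B)" for j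
      using 1(6)[of j] runs_sum_odds[of "\<lambda>s. st_v s j" ch] runs_sum_odds_tl[of "\<lambda>s. st_v s j" ch] by auto
    have t: "tot_v ?c1 j + tot_v ?c2 j = tot_v ch j" for j
      unfolding tot_v_def by (rule sum_odds)
    have t': "\<bar>tot_v ?c1 j - tot_v ?c2 j\<bar> \<le> int (dlen B)" for j
      using odds_diff_le_runs_sum[of "\<lambda>s. st_v s j" ch] 1(6)[of j] unfolding tot_v_def by linarith
    \<comment> \<open>Sum and difference of the two totals are at most the radius in absolute value,
      hence so is each total.\<close>
    have b: "\<bar>tot_v ?c1 j\<bar> \<le> int (dlen B)" "\<bar>tot_v ?c2 j\<bar> \<le> int (dlen B)" for j
      using t[of j] t'[of j] 1(7)[of j] by linarith+
    obtain s1 where s1: "s1 \<in> set (dlist (d_solve B (d_odds L)))" "st_w s1 = tot_w ?c1" "\<And>j. st_v s1 j = tot_v ?c1 j"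
      using 1(1)[OF False ch(1) ne(1) can1 r(1) b(1)] by blast
    obtain s2 where s2: "s2 \<in> set (dlist (d_solve B (d_odds (data_snd L))))" "st_w s2 = tot_w ?c2" "\<And>j. st_v s2 j = tot_v ?c2 j"
      using 1(2)[OF False ch(2) ne(2) can2 r(2) b(2)] by blast
    let ?s = "d_add s1 s2"
    have v: "st_v ?s j = tot_v ch j" for j using s1 s2 t by simp
    have "canonical (data_snd ?s)"
      using d_solve_canonical[OF can1 s1(1)] d_solve_canonical[OF can2 s2(1)]
      by (simp add: d_add_def canonical_d_addvec)
    then have "in_box B (data_snd ?s)" using v 1(7) by (simp add: in_box_iff)
    then have "?s \<in> set (dlist (d_solve B L))"
      using s1 s2 False by (auto simp: d_solve.simps[of B L] set_d_comb)
    moreover have "tot_w ?c1 + tot_w ?c2 = tot_w ch"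
    proof -
      have "int (tot_w ?c1 + tot_w ?c2) = int (tot_w ch)"
        using sum_odds[of "\<lambda>s. int (st_w s)" ch] by (simp add: tot_w_def sum_list_of_nat[symmetric] o_def)
      then show ?thesis by linarith
    qed
    ultimately show ?thesis using v s1 s2 by (intro bexI[of _ ?s]) auto
  qed
qed

section \<open>Radius of the box\<close>

lemma dlen_d_size: "dlen (d_size d acc) = pairs d + dlen acc"
  by (simp add: d_size_def)

lemma dlen_d_bound: "grouped (dlist L) \<Longrightarrow> dlen (d_bound L) = (\<Sum>\<tau>\<in>set (dlist L). pairs \<tau>)"
proof (induction L rule: d_bound.induct)
  case (2 x L)
  show ?case
  proof (cases "x = data_fst L")
    case True
    then show ?thesis using 2 by (cases L) (auto simp: insert_absorb)
  next
    case False
    then have "x \<notin> set (dlist L)" using 2(3) by (cases L) auto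
    then show ?thesis using False 2 by (simp add: dlen_d_size)
  qed
qed simp

lemma sum_abs_le_pairs: "(\<Sum>s\<in>set (dlist \<tau>). \<bar>st_v s j\<bar>) \<le> int (pairs \<tau>)"
proof (induction \<tau>)
  case (Pair s \<tau>)
  have "\<bar>st_v s j\<bar> \<le> int (pairs s)"
    using abs_vval_le[of "data_snd s" j] pairs_data_fst_snd(2)[of s] by linarith
  then show ?case using Pair.IH(2) by (auto simp: sum.insert_if)
qed simp

text \<open>For completeness the given choice is regrouped along equal offers; its run sums are then
  at most the total size of the distinct offers, which is the length of \<open>d_bound L\<close>.
  Its vanishing total lies in any box.\<close>

theorem d_solve_correct:
  assumes "L \<noteq> Atom" "grouped (dlist L)"
    and can: "\<forall>\<tau>\<in>set (dlist L). \<forall>s\<in>set (dlist \<tau>). canonical (data_snd s)"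
  shows "(\<exists>s\<in>set (dlist (d_solve (d_bound L) L)). zero_vec (data_snd s) \<and> st_w s = w)
    \<longleftrightarrow> (\<exists>ch. choice ch (dlist L) \<and> tot_w ch = w \<and> (\<forall>j. tot_v ch j = 0))"
proof
  assume "\<exists>s\<in>set (dlist (d_solve (d_bound L) L)). zero_vec (data_snd s) \<and> st_w s = w"
  then show "\<exists>ch. choice ch (dlist L) \<and> tot_w ch = w \<and> (\<forall>j. tot_v ch j = 0)"
    using d_solve_sound d_solve_canonical[OF can] zero_vec_iff by metis
next
  assume "\<exists>ch. choice ch (dlist L) \<and> tot_w ch = w \<and> (\<forall>j. tot_v ch j = 0)"
  then obtain ch where ch: "choice ch (dlist L)" "tot_w ch = w" "\<And>j. tot_v ch j = 0" by blast
  obtain ch' where ch': "choice ch' (dlist L)" "mset ch' = mset ch"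
    "\<And>g. runs_sum g ch' \<le> (\<Sum>\<tau>\<in>set (dlist L). \<Sum>s\<in>set (dlist \<tau>). \<bar>g s\<bar>)"
    using list_all2_regroup[OF assms(2), of "\<lambda>\<tau>. set (dlist \<tau>)" ch] ch(1)
    unfolding choice_def by auto
  have r: "runs_sum (\<lambda>s. st_v s j) ch' \<le> int (dlen (d_bound L))" for j
    using ch'(3)[of "\<lambda>s. st_v s j"] sum_abs_le_pairs
    by (simp add: dlen_d_bound[OF assms(2)]) (metis (no_types, lifting) order_trans sum_mono)
  have "tot_w ch' = w" "\<And>j. tot_v ch' j = 0" using ch tot_cong[OF ch'(2)] by auto
  then show "\<exists>s\<in>set (dlist (d_solve (d_bound L) L)). zero_vec (data_snd s) \<and> st_w s = w"
    using d_solve_complete[OF ch'(1) assms(1) can r] d_solve_canonical[OF can] zero_vec_iff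
    by (metis abs_zero of_nat_0_le_iff)
qed

section \<open>Options of a block\<close>

lemma enc_nat_eq_dl: "enc_nat n = dl (replicate n Atom)"
  by (induction n) auto

lemma enc_nat_inject [simp]: "enc_nat m = enc_nat n \<longleftrightarrow> m = n"
  by (simp add: enc_nat_eq_dl)

definition enc_block :: "nat list \<Rightarrow> data" where
  "enc_block us = dl (map enc_nat us)"

definition enc_map :: "(nat \<Rightarrow> nat) \<Rightarrow> nat list \<Rightarrow> data" where
  "enc_map p us = dl (map (\<lambda>u. Pair (enc_nat u) (enc_nat (p u))) us)"

lemma dlist_enc_block [simp]: "dlist (enc_block us) = map enc_nat us"
  by (simp add: enc_block_def)

lemma dlist_enc_map [simp]: "dlist (enc_map p us) = map (\<lambda>u. Pair (enc_nat u) (enc_nat (p u))) us"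
  by (simp add: enc_map_def)

lemma dlist_d_ext: "dlist (d_ext M u cs as) = concat (map (\<lambda>c. map (Pair (Pair u c)) (dlist as))
    (filter (\<lambda>c. u = c \<or> d_adj M u c) (dlist cs)))"
  by (simp add: d_ext_def)

lemma mem_d_assigns:
  "a \<in> set (dlist (d_assigns M us b)) \<longleftrightarrow>
    list_all2 (\<lambda>x u. \<exists>c\<in>set (dlist b). x = Pair u c \<and> (u = c \<or> d_adj M u c)) (dlist a) (dlist us)"
proof (induction us arbitrary: a)
  case (Pair u us)
  have "a \<in> set (dlist (d_ext M u b A)) \<longleftrightarrow>
    (\<exists>c\<in>set (dlist b). (u = c \<or> d_adj M u c) \<and> (\<exists>a'\<in>set (dlist A). a = Pair (Pair u c) a'))" for A
    by (auto simp: dlist_d_ext)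
  then show ?case by (cases a) (auto simp: Pair.IH(2) list_all2_Cons2 dlist_inject)
qed auto

text \<open>Turns a list of argument-value pairs into a function; distinctness ensures that
  \<open>p(u := c)\<close> leaves the values on \<open>us\<close> intact.\<close>

lemma list_all2_enc_map:
  assumes "list_all2 (\<lambda>x u. \<exists>c\<in>enc_nat ` U. x = Pair u c \<and> P u c) xs (map enc_nat us)" "distinct us"
  shows "\<exists>p. xs = map (\<lambda>u. Pair (enc_nat u) (enc_nat (p u))) us \<and>
    (\<forall>u\<in>set us. p u \<in> U \<and> P (enc_nat u) (enc_nat (p u)))"
  using assms
proof (induction us arbitrary: xs)
  case (Cons u us)
  then obtain c ys where c: "c \<in> U" "P (enc_nat u) (enc_nat c)" "xs = Pair (enc_nat u) (enc_nat c) # ys"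
    "list_all2 (\<lambda>x u. \<exists>c\<in>enc_nat ` U. x = Pair u c \<and> P u c) ys (map enc_nat us)"
    by (auto simp: list_all2_Cons2)
  obtain p where p: "ys = map (\<lambda>u. Pair (enc_nat u) (enc_nat (p u))) us"
    "\<And>u. u \<in> set us \<Longrightarrow> p u \<in> U \<and> P (enc_nat u) (enc_nat (p u))"
    using Cons.IH[OF c(4)] Cons.prems(2) by auto
  have "u \<notin> set us" using Cons.prems(2) by simp
  then show ?case using c p by (intro exI[of _ "p(u := c)"]) auto
qed simp

text \<open>The enumeration restricts images to the vertex itself and its neighbours, the filter
  adds idempotence; together these conditions define centre maps.\<close>

lemma mem_block_assigns_iff:
  assumes dist: "distinct us"
    and adj: "\<And>u v. u \<in> set us \<Longrightarrow> v \<in> set us \<Longrightarrow> d_adj M (enc_nat u) (enc_nat v) \<longleftrightarrow> {u, v} \<in> E"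
  shows "a \<in> set (dlist (d_assigns M (enc_block us) (enc_block us))) \<and> idem a a \<longleftrightarrow>
    (\<exists>p. centre_map E (set us) p \<and> a = enc_map p us)" (is "?L \<longleftrightarrow> ?R")
proof
  assume L: ?L
  then have "list_all2 (\<lambda>x u. \<exists>c\<in>enc_nat ` set us. x = Pair u c \<and> (u = c \<or> d_adj M u c))
      (dlist a) (map enc_nat us)"
    by (simp add: mem_d_assigns)
  from list_all2_enc_map[OF this dist] obtain p
    where p: "dlist a = map (\<lambda>u. Pair (enc_nat u) (enc_nat (p u))) us"
      "\<And>u. u \<in> set us \<Longrightarrow> p u \<in> set us \<and> (enc_nat u = enc_nat (p u) \<or> d_adj M (enc_nat u) (enc_nat (p u)))"
    by blast
  have a: "a = enc_map p us" using p(1) by (simp add: dlist_inject[symmetric])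
  have "p (p u) = p u" if "u \<in> set us" for u
    using L that p(2) by (fastforce simp: idem_def a)
  then have "centre_map E (set us) p"
    unfolding centre_map_def using p(2) adj enc_nat_inject by metis
  then show ?R using a by blast
next
  assume ?R
  then obtain p where p: "centre_map E (set us) p" "a = enc_map p us" by blast
  have "list_all2 (\<lambda>x u. \<exists>c\<in>enc_nat ` set us. x = Pair u c \<and> (u = c \<or> d_adj M u c))
      (dlist a) (map enc_nat us)"
  proof -
    have "p u \<in> set us \<and> (u = p u \<or> d_adj M (enc_nat u) (enc_nat (p u)))"
      if "u \<in> set us" for u
      using p(1) adj[OF that, of "p u"] that by (cases "p u = u") (auto simp: centre_map_def)
    then show ?thesis by (auto simp: p(2) list.rel_map list_all2_same)
  qed
  moreover have "idem a a" using p by (force simp: idem_def centre_map_def)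
  ultimately show ?L by (simp add: mem_d_assigns)
qed

lemma leaves_enc_map: "distinct us \<Longrightarrow> leaves (enc_nat v) (enc_map p us) = leaf_count p (set us) v"
  by (auto simp: leaves_def leaf_count_def leaf_set_def filter_map o_def distinct_length_filter
      intro!: arg_cong[of _ _ card])

definition unit_val :: "data \<Rightarrow> int" where
  "unit_val one = int (dlen (data_fst one)) - int (dlen (data_snd one))"

lemma vval_replicate: "vval (dl (replicate l one)) j = (if j < l then unit_val one else 0)"
proof (induction l arbitrary: j)
  case (Suc l)
  then show ?case by (cases j) (auto simp: unit_val_def)
qed simp

lemma vval_d_vecs:
  "vval (d_vecs one a a0) j =
    unit_val one * int (length (filter (\<lambda>x. j < leaves (data_fst x) a0) (dlist a)))"
  by (induction a) (auto simp: d_leafvec_def vval_replicate algebra_simps)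

lemma dlen_d_wcount:
  "dlen (d_wcount one a a0) = dlen (data_fst one) *
    length (filter (\<lambda>x. data_fst x \<noteq> data_snd x \<or> 0 < leaves (data_fst x) a0) (dlist a))"
  by (induction a) auto

text \<open>Sign and counting both come from \<open>one\<close>: \<open>unit_val\<close> is 1 or -1,
  and its first part has length 1 or 0.\<close>

lemma option_enc_map:
  assumes "distinct us"
  shows "st_v (d_option one (enc_map p us)) j = unit_val one * int (profile p (set us) j)"
    "st_w (d_option one (enc_map p us)) = dlen (data_fst one) * card (used p (set us))"
proof -
  show "st_v (d_option one (enc_map p us)) j = unit_val one * int (profile p (set us) j)"
    using assms by (auto simp: d_option_def vval_d_vecs filter_map o_def leaves_enc_map
        distinct_length_filter profile_def intro!: arg_cong[of _ _ card])
  show "st_w (d_option one (enc_map p us)) = dlen (data_fst one) * card (used p (set us))"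
    using assms by (auto simp: d_option_def dlen_d_wcount filter_map o_def leaves_enc_map
        distinct_length_filter used_def intro!: arg_cong[of _ _ card])
qed

lemma canonical_d_vecs:
  assumes "data_fst one = Atom \<or> data_snd one = Atom"
  shows "canonical (d_vecs one a a0)"
proof (induction a)
  case (Pair x a)
  have "canonical (d_leafvec one v a0)" for v using assms by (auto simp: canonical_def d_leafvec_def)
  then show ?case using Pair by (simp add: canonical_d_addvec)
qed simp

lemma block_opts_canonical:
  assumes "data_fst one = Atom \<or> data_snd one = Atom" "s \<in> set (dlist (block_opts M one b))"
  shows "canonical (data_snd s)"
  using assms canonical_d_vecs by (auto simp: block_opts_def d_opts_def d_option_def)

lemma set_block_opts:
  assumes "distinct us"
    and "\<And>u v. u \<in> set us \<Longrightarrow> v \<in> set us \<Longrightarrow> d_adj M (enc_nat u) (enc_nat v) \<longleftrightarrow> {u, v} \<in> E"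
  shows "set (dlist (block_opts M one (enc_block us))) =
    (\<lambda>p. d_option one (enc_map p us)) ` {p. centre_map E (set us) p}"
  using mem_block_assigns_iff[OF assms] unfolding block_opts_def d_opts_def by auto

section \<open>Gluing blocks\<close>

lemma leaf_set_cong: "(\<And>u. u \<in> V \<Longrightarrow> p u = q u) \<Longrightarrow> leaf_set p V v = leaf_set q V v"
  by (auto simp: leaf_set_def)

lemma profile_cong: "(\<And>u. u \<in> V \<Longrightarrow> p u = q u) \<Longrightarrow> profile p V j = profile q V j"
  unfolding profile_def leaf_count_def by (metis (mono_tags, lifting) leaf_set_cong)

lemma used_cong: "(\<And>u. u \<in> V \<Longrightarrow> p u = q u) \<Longrightarrow> used p V = used q V"
  unfolding used_def leaf_count_def using leaf_set_cong[of V p q] by auto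

lemma centre_map_cong: "(\<And>u. u \<in> V \<Longrightarrow> p u = q u) \<Longrightarrow> centre_map E V p = centre_map E V q"
  by (auto simp: centre_map_def)

text \<open>A map that sends vertices to themselves or to neighbours cannot leave a part that no
  edge leaves.\<close>

lemma centre_map_Un:
  assumes "\<And>u v. u \<in> U \<Longrightarrow> v \<in> V \<Longrightarrow> {u, v} \<notin> E"
  shows "centre_map E (U \<union> V) p \<longleftrightarrow> centre_map E U p \<and> centre_map E V p"
proof
  assume p: "centre_map E (U \<union> V) p"
  have "p u \<in> U" if "u \<in> U" for u
    using p that assms[of u "p u"] by (cases "p u = u") (auto simp: centre_map_def)
  moreover have "p u \<in> V" if "u \<in> V" for u
    using p that assms[of "p u" u] by (cases "p u = u") (auto simp: centre_map_def insert_commute)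
  ultimately show "centre_map E U p \<and> centre_map E V p" using p by (auto simp: centre_map_def)
qed (auto simp: centre_map_def)

lemma glue_counts:
  assumes "finite U" "finite V" "U \<inter> V = {}" "centre_map E U p" "centre_map E V p"
  shows "profile p (U \<union> V) j = profile p U j + profile p V j"
    "card (used p (U \<union> V)) = card (used p U) + card (used p V)"
proof -
  have lU: "leaf_count p (U \<union> V) v = leaf_count p U v" if "v \<in> U" for v
    using assms that unfolding leaf_count_def
    by (intro arg_cong[of _ _ card]) (auto simp: leaf_set_def centre_map_def)
  have lV: "leaf_count p (U \<union> V) v = leaf_count p V v" if "v \<in> V" for v
    using assms that unfolding leaf_count_def
    by (intro arg_cong[of _ _ card]) (auto simp: leaf_set_def centre_map_def)
  have "{v \<in> U \<union> V. j < leaf_count p (U \<union> V) v}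
      = {v \<in> U. j < leaf_count p U v} \<union> {v \<in> V. j < leaf_count p V v}"
    using lU lV by auto
  then show "profile p (U \<union> V) j = profile p U j + profile p V j"
    unfolding profile_def by (simp only:) (rule card_Un_disjoint; use assms in auto)
  have "used p (U \<union> V) = used p U \<union> used p V"
    using lU lV by (auto simp: used_def)
  then show "card (used p (U \<union> V)) = card (used p U) + card (used p V)"
    by (simp only:) (rule card_Un_disjoint; use assms in \<open>auto simp: used_def\<close>)
qed

lemma choice_Cons: "choice ch (\<tau> # Ls) \<longleftrightarrow> (\<exists>s ch'. ch = s # ch' \<and> s \<in> set (dlist \<tau>) \<and> choice ch' Ls)"
  by (auto simp: choice_def list_all2_Cons2)

lemma tot_Cons [simp]: "tot_w (s # ch) = st_w s + tot_w ch" "tot_v (s # ch) j = st_v s j + tot_v ch j"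
  "tot_w [] = 0" "tot_v [] j = 0"
  by (simp_all add: tot_w_def tot_v_def)

text \<open>Closed only relative to the vertices listed so far, so that it can be an invariant of
  the incremental construction.\<close>

definition closed_blocks :: "nat set set \<Rightarrow> nat list list \<Rightarrow> bool" where
  "closed_blocks E uss \<longleftrightarrow> distinct (concat uss) \<and>
    (\<forall>us\<in>set uss. \<forall>u\<in>set us. \<forall>x\<in>set (concat uss). {u, x} \<in> E \<longrightarrow> x \<in> set us)"

text \<open>Independent maps on the blocks glue to one map on their union, and any map on the union
  restricts to the blocks; counts add up. The targets \<open>w\<close> and \<open>v\<close> are
  general because the state of the first block changes what is left for the rest.\<close>

lemma choice_blocks_iff:
  assumes "closed_blocks E uss" "\<And>u v. u \<in> set (concat uss) \<Longrightarrow> v \<in> set (concat uss) \<Longrightarrow>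
      d_adj M (enc_nat u) (enc_nat v) \<longleftrightarrow> {u, v} \<in> E"
  shows "(\<exists>ch. choice ch (map (\<lambda>us. block_opts M one (enc_block us)) uss)
        \<and> tot_w ch = w \<and> (\<forall>j. tot_v ch j = v j)) \<longleftrightarrow>
    (\<exists>p. centre_map E (set (concat uss)) p \<and> dlen (data_fst one) * card (used p (set (concat uss))) = w
      \<and> (\<forall>j. unit_val one * int (profile p (set (concat uss)) j) = v j))"
  using assms
proof (induction uss arbitrary: w v)
  case Nil
  show ?case by (auto simp: choice_def centre_map_def used_def profile_def)
next
  case (Cons us uss)
  let ?U = "set us" and ?V = "set (concat uss)"
  have dist: "distinct us" and disj: "?U \<inter> ?V = {}"
    using Cons.prems(1) by (auto simp: closed_blocks_def)
  have clos: "closed_blocks E uss"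
  proof -
    have "x \<in> set ys" if "ys \<in> set uss" "u \<in> set ys" "x \<in> ?V" "{u, x} \<in> E" for ys u x
      using Cons.prems(1) that unfolding closed_blocks_def
      by (metis UnCI concat.simps(2) list.set_intros(2) set_append)
    moreover have "distinct (concat uss)" using Cons.prems(1) by (simp add: closed_blocks_def)
    ultimately show ?thesis unfolding closed_blocks_def by blast
  qed
  have U: "\<forall>u\<in>?U. \<forall>x\<in>set (concat (us # uss)). {u, x} \<in> E \<longrightarrow> x \<in> ?U"
    using Cons.prems(1) unfolding closed_blocks_def by (meson list.set_intros(1))
  have noE: "{u, x} \<notin> E" if "u \<in> ?U" "x \<in> ?V" for u x
  proof
    assume "{u, x} \<in> E"
    moreover have "x \<in> set (concat (us # uss))" using that by simp
    ultimately have "x \<in> ?U" using U that by blast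
    then show False using disj that by blast
  qed
  have IH: "(\<exists>ch. choice ch (map (\<lambda>us. block_opts M one (enc_block us)) uss)
        \<and> tot_w ch = w \<and> (\<forall>j. tot_v ch j = v j)) \<longleftrightarrow>
    (\<exists>p. centre_map E ?V p \<and> dlen (data_fst one) * card (used p ?V) = w
      \<and> (\<forall>j. unit_val one * int (profile p ?V j) = v j))" for w v
    by (rule Cons.IH[OF clos]) (use Cons.prems(2) in auto)
  have opts: "set (dlist (block_opts M one (enc_block us))) =
      (\<lambda>p. d_option one (enc_map p us)) ` {p. centre_map E ?U p}"
    by (rule set_block_opts[OF dist]) (use Cons.prems(2) in auto)
  show ?case (is "?L \<longleftrightarrow> ?R")
  proof
    assume ?L
    then obtain s ch where s: "s \<in> set (dlist (block_opts M one (enc_block us)))"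
      "choice ch (map (\<lambda>us. block_opts M one (enc_block us)) uss)"
      "st_w s + tot_w ch = w" "\<And>j. st_v s j + tot_v ch j = v j"
      by (auto simp: choice_Cons)
    obtain p where p: "centre_map E ?U p" "s = d_option one (enc_map p us)" using s(1) opts by auto
    have "\<exists>ch'. choice ch' (map (\<lambda>us. block_opts M one (enc_block us)) uss)
        \<and> tot_w ch' = tot_w ch \<and> (\<forall>j. tot_v ch' j = tot_v ch j)" using s(2) by blast
    then obtain q where q: "centre_map E ?V q" "dlen (data_fst one) * card (used q ?V) = tot_w ch"
      "\<And>j. unit_val one * int (profile q ?V j) = tot_v ch j"
      unfolding IH by blast
    define r where "r u = (if u \<in> ?U then p u else q u)" for u
    have rU: "\<And>u. u \<in> ?U \<Longrightarrow> r u = p u" and rV: "\<And>u. u \<in> ?V \<Longrightarrow> r u = q u"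
      using disj by (auto simp: r_def)
    have cong: "centre_map E ?U r = centre_map E ?U p" "centre_map E ?V r = centre_map E ?V q"
      "used r ?U = used p ?U" "used r ?V = used q ?V"
      "profile r ?U j = profile p ?U j" "profile r ?V j = profile q ?V j" for j
      by (rule centre_map_cong used_cong profile_cong; erule rU rV)+
    then have r: "centre_map E ?U r" "centre_map E ?V r" using p(1) q(1) by blast+
    note g = glue_counts[OF _ _ disj r]
    have "centre_map E (?U \<union> ?V) r" using r centre_map_Un[OF noE] by blast
    moreover have "dlen (data_fst one) * card (used r (?U \<union> ?V)) = w"
      using g(2) cong(3,4) s(3) q(2) option_enc_map(2)[OF dist, of one p] p(2)
      by (simp add: distrib_left)
    moreover have "unit_val one * int (profile r (?U \<union> ?V) j) = v j" for j
      using g(1)[of j] cong(5,6)[of j] s(4)[of j] q(3)[of j]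
        option_enc_map(1)[OF dist, of one p j] p(2)
      by (simp add: distrib_left)
    ultimately show ?R by (intro exI[of _ r]) simp
  next
    assume ?R
    then obtain r where r: "centre_map E (?U \<union> ?V) r" "dlen (data_fst one) * card (used r (?U \<union> ?V)) = w"
      "\<And>j. unit_val one * int (profile r (?U \<union> ?V) j) = v j" by auto
    have rr: "centre_map E ?U r" "centre_map E ?V r" using r(1) centre_map_Un[OF noE] by blast+
    note g = glue_counts[OF _ _ disj rr]
    have "\<exists>ch. choice ch (map (\<lambda>us. block_opts M one (enc_block us)) uss)
        \<and> tot_w ch = dlen (data_fst one) * card (used r ?V)
        \<and> (\<forall>j. tot_v ch j = unit_val one * int (profile r ?V j))"
      unfolding IH using rr by blast
    then obtain ch where ch: "choice ch (map (\<lambda>us. block_opts M one (enc_block us)) uss)"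
      "tot_w ch = dlen (data_fst one) * card (used r ?V)"
      "\<And>j. tot_v ch j = unit_val one * int (profile r ?V j)" by blast
    let ?s = "d_option one (enc_map r us)"
    have "?s \<in> set (dlist (block_opts M one (enc_block us)))" using rr(1) opts by auto
    moreover have "st_w ?s + tot_w ch = w"
      using g(2) r(2) ch(2) option_enc_map(2)[OF dist, of one r] by (simp add: distrib_left)
    moreover have "st_v ?s j + tot_v ch j = v j" for j
      using g(1)[of j] r(3)[of j] ch(3)[of j] option_enc_map(1)[OF dist, of one r j]
      by (simp add: distrib_left)
    ultimately show ?L using ch(1) by (intro exI[of _ "?s # ch"]) (auto simp: choice_Cons)
  qed
qed

section \<open>Splitting a graph into blocks\<close>

lemma enc_list_eq_dl: "enc_list f xs = dl (map f xs)"
  by (induction xs) auto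

lemma d_nth_enc_nat: "d_nth L (enc_nat i) = (if i < dlen L then dlist L ! i else Atom)"
proof (induction i arbitrary: L)
  case 0
  then show ?case by (cases L) auto
next
  case (Suc i)
  then show ?case by (cases L) auto
qed

lemma dlist_enc_graph: "dlist (enc_graph G) = map (\<lambda>i. dl (map (\<lambda>j. enc_bool ({i, j} \<in> edges G))
    [0..<card (verts G)])) [0..<card (verts G)]"
  by (simp add: enc_graph_def adj_matrix_def enc_list_eq_dl o_def Let_def)

lemma d_adj_enc_graph:
  assumes "u < card (verts G)" "v < card (verts G)"
  shows "d_adj (enc_graph G) (enc_nat u) (enc_nat v) \<longleftrightarrow> {u, v} \<in> edges G"
  using assms by (simp add: d_adj_def d_nth_enc_nat dlist_enc_graph)

lemma d_merge_eq:
  "d_merge M v bs acc rest = Pair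
    (dl (concat (rev (map dlist (filter (touches M v) (dlist bs)))) @ dlist acc))
    (dl (rev (filter (\<lambda>b. \<not> touches M v b) (dlist bs)) @ dlist rest))"
  by (induction M v bs acc rest rule: d_merge.induct) (auto simp: d_app_def)

definition has_nbr :: "nat set set \<Rightarrow> nat \<Rightarrow> nat list \<Rightarrow> bool" where
  "has_nbr E v us \<longleftrightarrow> (\<exists>u\<in>set us. {v, u} \<in> E)"

definition merge_blocks :: "nat set set \<Rightarrow> nat \<Rightarrow> nat list list \<Rightarrow> nat list list" where
  "merge_blocks E v uss =
    (concat (rev (filter (has_nbr E v) uss)) @ [v]) # rev (filter (\<lambda>us. \<not> has_nbr E v us) uss)"

text \<open>Closedness makes the blocks independent, reachability puts each inside one component and
  so bounds its size, and non-emptiness bounds their number.\<close>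

definition blocks_upto :: "nat graph \<Rightarrow> nat \<Rightarrow> nat list list \<Rightarrow> bool" where
  "blocks_upto G i uss \<longleftrightarrow> closed_blocks (edges G) uss \<and> set (concat uss) = {..<i} \<and> [] \<notin> set uss
    \<and> (\<forall>us\<in>set uss. \<forall>u\<in>set us. \<forall>x\<in>set us. (u, x) \<in> (adj G)\<^sup>*)"

lemma d_merge_enc:
  assumes "v < card (verts G)" "set (concat uss) \<subseteq> {..<card (verts G)}"
  shows "d_merge (enc_graph G) (enc_nat v) (dl (map enc_block uss)) (Pair (enc_nat v) Atom) Atom
    = dl (map enc_block (merge_blocks (edges G) v uss))"
proof -
  have t: "touches (enc_graph G) (enc_nat v) (enc_block us) \<longleftrightarrow> has_nbr (edges G) v us"
    if "us \<in> set uss" for us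
  proof -
    have "d_adj (enc_graph G) (enc_nat v) (enc_nat u) \<longleftrightarrow> {v, u} \<in> edges G" if "u \<in> set us" for u
      using assms(2) that \<open>us \<in> set uss\<close> by (intro d_adj_enc_graph assms(1)) auto
    then show ?thesis by (auto simp: touches_def has_nbr_def)
  qed
  have f: "filter (touches (enc_graph G) (enc_nat v)) (map enc_block uss)
      = map enc_block (filter (has_nbr (edges G) v) uss)"
    "filter (\<lambda>b. \<not> touches (enc_graph G) (enc_nat v) b) (map enc_block uss)
      = map enc_block (filter (\<lambda>us. \<not> has_nbr (edges G) v us) uss)"
    using t by (auto simp: filter_map o_def intro!: arg_cong[of _ _ "map enc_block"] filter_cong)
  show ?thesis
    by (simp add: d_merge_eq f merge_blocks_def rev_map map_concat o_def)
      (simp add: enc_block_def map_concat rev_map o_def)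
qed

lemma mset_concat_filter:
  "mset (concat (filter P xs)) + mset (concat (filter (\<lambda>x. \<not> P x) xs)) = mset (concat xs)"
  by (induction xs) (auto simp: ac_simps)

lemma mset_concat_rev: "mset (concat (rev xs)) = mset (concat xs)"
  by (induction xs) auto

lemma mset_merge_blocks: "mset (concat (merge_blocks E v uss)) = mset (v # concat uss)"
  using mset_concat_filter[of "has_nbr E v" uss] by (simp add: merge_blocks_def mset_concat_rev)

lemma blocks_upto_merge:
  assumes b: "blocks_upto G i uss"
  shows "blocks_upto G (Suc i) (merge_blocks (edges G) i uss)"
proof -
  let ?E = "edges G"
  let ?m = "merge_blocks ?E i uss"
  let ?b = "concat (rev (filter (has_nbr ?E i) uss)) @ [i]"
  have set: "set (concat uss) = {..<i}" and dist: "distinct (concat uss)"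
    and closed: "\<And>us u x. us \<in> set uss \<Longrightarrow> u \<in> set us \<Longrightarrow> x \<in> set (concat uss) \<Longrightarrow> {u, x} \<in> ?E \<Longrightarrow> x \<in> set us"
    and reach: "\<And>us u x. us \<in> set uss \<Longrightarrow> u \<in> set us \<Longrightarrow> x \<in> set us \<Longrightarrow> (u, x) \<in> (adj G)\<^sup>*"
    and ne: "[] \<notin> set uss"
    using b unfolding blocks_upto_def closed_blocks_def by blast+
  have m: "us \<in> set ?m \<longleftrightarrow> us = ?b \<or> us \<in> set uss \<and> \<not> has_nbr ?E i us" for us
    by (auto simp: merge_blocks_def)
  have ib: "u \<in> set ?b \<longleftrightarrow> u = i \<or> (\<exists>us\<in>set uss. has_nbr ?E i us \<and> u \<in> set us)" for u
    by auto
  have "set (concat ?m) = set (i # concat uss)"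
    using mset_merge_blocks by (metis set_mset_mset)
  then have set': "set (concat ?m) = insert i (set (concat uss))" by simp
  have "distinct (concat ?m) \<longleftrightarrow> distinct (i # concat uss)"
    using mset_merge_blocks by (rule mset_eq_imp_distinct_iff)
  then have dist': "distinct (concat ?m)" using dist set by (simp del: set_concat)
  have "x \<in> set us" if us: "us \<in> set ?m" and u: "u \<in> set us" and x: "x \<in> set (concat ?m)"
    and e: "{u, x} \<in> ?E" for us u x
  proof -
    have x': "x = i \<or> x \<in> set (concat uss)" using x set' by blast
    consider "us = ?b" | "us \<in> set uss" "\<not> has_nbr ?E i us" using us m by blast
    then show ?thesis
    proof cases
      case 1
      have "x \<in> set ?b"
      proof (cases "x = i")
        case False
        then have xs: "x \<in> set (concat uss)" using x' by blast
        then obtain vs where vs: "vs \<in> set uss" "x \<in> set vs" by auto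
        consider "u = i" | ws where "ws \<in> set uss" "has_nbr ?E i ws" "u \<in> set ws"
          using u 1 ib by blast
        then show ?thesis
        proof cases
          case 1
          \<comment> \<open>The edge from \<open>i\<close> to \<open>x\<close> is what makes the
            block of \<open>x\<close> join.\<close>
          then have "has_nbr ?E i vs" using e vs by (auto simp: has_nbr_def)
          then show ?thesis using vs ib by blast
        next
          case 2
          then show ?thesis using closed[OF 2(1,3) xs e] ib by blast
        qed
      qed simp
      then show ?thesis using 1 by blast
    next
      case 2
      \<comment> \<open>An edge to \<open>i\<close> would have put this block among the merged
        ones.\<close>
      have "x \<noteq> i" using 2 u e by (auto simp: has_nbr_def insert_commute)
      then show ?thesis using closed[OF 2(1) u _ e] x' by blast
    qed
  qed
  then have "closed_blocks ?E ?m" using dist' unfolding closed_blocks_def by blast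
  moreover have "set (concat ?m) = {..<Suc i}" using set' set by auto
  moreover have "[] \<notin> set ?m" using ne m by blast
  moreover have "(u, x) \<in> (adj G)\<^sup>*" if us: "us \<in> set ?m" and u: "u \<in> set us" and x: "x \<in> set us" for us u x
  proof -
    \<comment> \<open>Vertices from different merged blocks reach each other through
      \<open>i\<close>.\<close>
    have to_i: "(u, i) \<in> (adj G)\<^sup>* \<and> (i, u) \<in> (adj G)\<^sup>*" if u: "u \<in> set ?b" for u
    proof (cases "u = i")
      case False
      then obtain us w where us: "us \<in> set uss" "u \<in> set us" "w \<in> set us" "{i, w} \<in> ?E"
        using u ib unfolding has_nbr_def by blast
      have "(i, w) \<in> adj G" "(w, i) \<in> adj G" using us(4) by (auto simp: adj_def insert_commute)
      then show ?thesis using reach[OF us(1,2,3)] reach[OF us(1,3,2)]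
        by (meson converse_rtrancl_into_rtrancl rtrancl.rtrancl_into_rtrancl)
    qed simp
    consider "us = ?b" | "us \<in> set uss" using us m by blast
    then show ?thesis
    proof cases
      case 1
      then show ?thesis using to_i[of u] to_i[of x] u x by (meson rtrancl_trans)
    next
      case 2
      then show ?thesis using reach u x by blast
    qed
  qed
  ultimately show ?thesis unfolding blocks_upto_def by blast
qed

lemma d_build_blocks:
  assumes "blocks_upto G i uss" "i + dlen rows = card (verts G)"
  shows "\<exists>uss'. d_build (enc_graph G) rows (enc_nat i) (dl (map enc_block uss)) = dl (map enc_block uss')
    \<and> blocks_upto G (card (verts G)) uss'"
  using assms
proof (induction rows arbitrary: i uss)
  case Atom
  then show ?case by auto
next
  case (Pair r rows)
  have "set (concat uss) \<subseteq> {..<card (verts G)}" "i < card (verts G)"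
    using Pair.prems by (auto simp: blocks_upto_def)
  then have "d_merge (enc_graph G) (enc_nat i) (dl (map enc_block uss)) (Pair (enc_nat i) Atom) Atom
      = dl (map enc_block (merge_blocks (edges G) i uss))"
    by (intro d_merge_enc)
  moreover have "Pair Atom (enc_nat i) = enc_nat (Suc i)" by simp
  ultimately show ?case
    using Pair.IH(2)[OF blocks_upto_merge[OF Pair.prems(1)]] Pair.prems(2) by simp
qed

lemma d_build_enc_graph:
  obtains uss where "d_build (enc_graph G) (enc_graph G) Atom Atom = dl (map enc_block uss)"
    "blocks_upto G (card (verts G)) uss"
proof -
  have "blocks_upto G 0 []" by (simp add: blocks_upto_def closed_blocks_def)
  from d_build_blocks[OF this, of "enc_graph G"] show ?thesis
    using that by (auto simp: dlist_enc_graph)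
qed

section \<open>Lists of offers\<close>

lemma mset_d_optlists:
  "mset (dlist (d_optlists M one (dl bs) L)) = mset (map (block_opts M one) bs) + mset (dlist L)"
  by (induction bs) (auto simp: d_ginsert_def)

lemma grouped_d_optlists: "grouped (dlist L) \<Longrightarrow> grouped (dlist (d_optlists M one bs L))"
  by (induction bs) (auto simp: d_ginsert_def grouped_ginsert)

text \<open>A choice is permuted along with the offers, so grouping them keeps all totals.\<close>

lemma choice_mset_cong:
  assumes "mset xs = mset ys" "choice ch xs"
  shows "\<exists>ch'. choice ch' ys \<and> mset ch' = mset ch"
proof -
  let ?R = "\<lambda>s \<tau>. s \<in> set (dlist \<tau>)"
  have "list_all2 ?R\<inverse>\<inverse> xs ch" using assms(2) by (simp add: choice_def list.rel_flip)
  from list_all2_reorder_left_invariance[OF this assms(1)[symmetric]]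
  show ?thesis by (simp add: choice_def list.rel_flip)
qed

lemma choice_append: "choice ch (xs @ ys) \<longleftrightarrow> (\<exists>c1 c2. ch = c1 @ c2 \<and> choice c1 xs \<and> choice c2 ys)"
  unfolding choice_def list_all2_append2 by (blast dest: list_all2_lengthD)

section \<open>Correctness of the program\<close>

lemma unit_vals [simp]: "unit_val pos_one = 1" "unit_val neg_one = -1"
  "dlen (data_fst pos_one) = 1" "dlen (data_fst neg_one) = 0"
  by (simp_all add: unit_val_def pos_one_def neg_one_def)

lemma d_types_structure:
  obtains uss1 uss2 where "blocks_upto G1 (card (verts G1)) uss1" "blocks_upto G2 (card (verts G2)) uss2"
    "d_build (enc_graph G1) (enc_graph G1) Atom Atom = dl (map enc_block uss1)"
    "d_build (enc_graph G2) (enc_graph G2) Atom Atom = dl (map enc_block uss2)"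
    "mset (dlist (d_types (enc_graph G1) (enc_graph G2))) =
      mset (map (\<lambda>us. block_opts (enc_graph G1) pos_one (enc_block us)) uss1
          @ map (\<lambda>us. block_opts (enc_graph G2) neg_one (enc_block us)) uss2)"
    "grouped (dlist (d_types (enc_graph G1) (enc_graph G2)))"
proof -
  obtain uss1 where 1: "d_build (enc_graph G1) (enc_graph G1) Atom Atom = dl (map enc_block uss1)"
    "blocks_upto G1 (card (verts G1)) uss1" by (rule d_build_enc_graph)
  obtain uss2 where 2: "d_build (enc_graph G2) (enc_graph G2) Atom Atom = dl (map enc_block uss2)"
    "blocks_upto G2 (card (verts G2)) uss2" by (rule d_build_enc_graph)
  show ?thesis
    by (rule that[OF 1(2) 2(2) 1(1) 2(1)])
      (simp_all add: d_types_def 1 2 mset_d_optlists grouped_d_optlists o_def)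
qed

text \<open>The vectors of the second graph are negated and have weight zero: a vanishing sum means
  equal profiles, and the total weight is the number of vertices covered in the first graph.\<close>

lemma choice_types_iff:
  assumes "input_graph G1" "input_graph G2"
  shows "(\<exists>ch. choice ch (dlist (d_types (enc_graph G1) (enc_graph G2))) \<and> tot_w ch = w \<and> (\<forall>j. tot_v ch j = 0))
    \<longleftrightarrow> (\<exists>H. common_star_forest G1 G2 H \<and> card (verts H) = w)"
proof -
  let ?M1 = "enc_graph G1" and ?M2 = "enc_graph G2"
  obtain uss1 uss2 where uss: "blocks_upto G1 (card (verts G1)) uss1" "blocks_upto G2 (card (verts G2)) uss2"
    "mset (dlist (d_types ?M1 ?M2)) = mset (map (\<lambda>us. block_opts ?M1 pos_one (enc_block us)) uss1
        @ map (\<lambda>us. block_opts ?M2 neg_one (enc_block us)) uss2)" (is "_ = mset (?A @ ?B)")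
    using d_types_structure[of G1 G2] by metis
  have simple: "simple_graph G1" "simple_graph G2" using assms by (auto simp: input_graph_def)
  have V: "set (concat uss1) = verts G1" "set (concat uss2) = verts G2"
    using uss assms by (auto simp: blocks_upto_def input_graph_def simp del: set_concat)
  have C1: "(\<exists>ch. choice ch ?A \<and> tot_w ch = w \<and> (\<forall>j. tot_v ch j = v j)) \<longleftrightarrow>
    (\<exists>p. centre_map (edges G1) (verts G1) p \<and> dlen (data_fst pos_one) * card (used p (verts G1)) = w
      \<and> (\<forall>j. unit_val pos_one * int (profile p (verts G1) j) = v j))" for w v
    unfolding V(1)[symmetric]
    by (rule choice_blocks_iff)
      (use uss(1) in \<open>auto simp: blocks_upto_def d_adj_enc_graph simp del: set_concat\<close>)
  have C2: "(\<exists>ch. choice ch ?B \<and> tot_w ch = w \<and> (\<forall>j. tot_v ch j = v j)) \<longleftrightarrow>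
    (\<exists>p. centre_map (edges G2) (verts G2) p \<and> dlen (data_fst neg_one) * card (used p (verts G2)) = w
      \<and> (\<forall>j. unit_val neg_one * int (profile p (verts G2) j) = v j))" for w v
    unfolding V(2)[symmetric]
    by (rule choice_blocks_iff)
      (use uss(2) in \<open>auto simp: blocks_upto_def d_adj_enc_graph simp del: set_concat\<close>)
  have "(\<exists>ch. choice ch (dlist (d_types ?M1 ?M2)) \<and> tot_w ch = w \<and> (\<forall>j. tot_v ch j = 0))
    \<longleftrightarrow> (\<exists>ch. choice ch (?A @ ?B) \<and> tot_w ch = w \<and> (\<forall>j. tot_v ch j = 0))"
    using choice_mset_cong[OF uss(3)] choice_mset_cong[OF uss(3)[symmetric]] tot_cong by metis
  also have "\<dots> \<longleftrightarrow> (\<exists>p1 p2. centre_map (edges G1) (verts G1) p1 \<and> centre_map (edges G2) (verts G2) p2 \<and>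
      (\<forall>j. profile p1 (verts G1) j = profile p2 (verts G2) j) \<and> card (used p1 (verts G1)) = w)"
    (is "?L \<longleftrightarrow> ?R")
  proof
    assume ?L
    then obtain c1 c2 where c: "choice c1 ?A" "choice c2 ?B" "tot_w c1 + tot_w c2 = w"
      "\<And>j. tot_v c1 j + tot_v c2 j = 0"
      by (auto simp: choice_append)
    obtain p1 where p1: "centre_map (edges G1) (verts G1) p1" "card (used p1 (verts G1)) = tot_w c1"
      "\<And>j. int (profile p1 (verts G1) j) = tot_v c1 j"
      using C1[of "tot_w c1" "tot_v c1"] c(1) by auto
    obtain p2 where p2: "centre_map (edges G2) (verts G2) p2" "tot_w c2 = 0"
      "\<And>j. - int (profile p2 (verts G2) j) = tot_v c2 j"
      using C2[of "tot_w c2" "tot_v c2"] c(2) by auto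
    have "profile p1 (verts G1) j = profile p2 (verts G2) j" for j
      using c(4)[of j] p1(3)[of j] p2(3)[of j] by linarith
    then show ?R using p1 p2 c(3) by auto
  next
    assume ?R
    then obtain p1 p2 where p: "centre_map (edges G1) (verts G1) p1"
      "centre_map (edges G2) (verts G2) p2" "\<And>j. profile p1 (verts G1) j = profile p2 (verts G2) j"
      "card (used p1 (verts G1)) = w" by blast
    obtain c1 where c1: "choice c1 ?A" "tot_w c1 = w" "\<And>j. tot_v c1 j = int (profile p1 (verts G1) j)"
      using C1[of w "\<lambda>j. int (profile p1 (verts G1) j)"] p(1,4) by auto
    obtain c2 where c2: "choice c2 ?B" "tot_w c2 = 0" "\<And>j. tot_v c2 j = - int (profile p2 (verts G2) j)"
      using C2[of 0 "\<lambda>j. - int (profile p2 (verts G2) j)"] p(2) by auto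
    show ?L using c1 c2 p(3) by (intro exI[of _ "c1 @ c2"]) (auto simp: choice_append)
  qed
  finally show ?thesis unfolding common_star_forest_iff[OF simple] .
qed

text \<open>The required output is a specific datum, while \<open>dlen\<close> sees only the number
  of its cells; unary weights are determined by their length.\<close>

definition unary :: "data \<Rightarrow> bool" where
  "unary d \<longleftrightarrow> set (dlist d) \<subseteq> {Atom}"

lemma unary_eq_enc_nat: "unary d \<Longrightarrow> d = enc_nat (dlen d)"
  by (induction d) (auto simp: unary_def)

lemma unary_d_app: "unary x \<Longrightarrow> unary y \<Longrightarrow> unary (d_app x y)"
  by (auto simp: unary_def d_app_def)

lemma unary_d_wcount: "unary (data_fst one) \<Longrightarrow> unary (d_wcount one a a0)"
  by (induction a) (auto simp: unary_d_app, simp_all add: unary_def)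

lemma block_opts_unary:
  assumes "unary (data_fst one)" "s \<in> set (dlist (block_opts M one b))"
  shows "unary (data_fst s)"
  using assms unary_d_wcount by (auto simp: block_opts_def d_opts_def d_option_def)

lemma d_best_spec:
  "(d_best S acc = acc \<or> (\<exists>s\<in>set (dlist S). zero_vec (data_snd s) \<and> d_best S acc = data_fst s))
    \<and> dlen acc \<le> dlen (d_best S acc)
    \<and> (\<forall>s\<in>set (dlist S). zero_vec (data_snd s) \<longrightarrow> st_w s \<le> dlen (d_best S acc))"
proof (induction S acc rule: d_best.induct)
  case (2 s S acc)
  then show ?case by (auto split: if_splits)
qed auto

theorem d_mcsf_correct:
  assumes "input_graph G1" "input_graph G2"
  shows "d_mcsf (enc_graph G1) (enc_graph G2) = enc_nat (mcsf_optimum G1 G2)"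
proof -
  let ?M1 = "enc_graph G1" and ?M2 = "enc_graph G2"
  let ?L = "d_types ?M1 ?M2"
  let ?S = "d_solve (d_bound ?L) ?L"
  let ?W = "{card (verts H) | H. common_star_forest G1 G2 H}"
  let ?d = "d_best ?S Atom"
  obtain uss1 uss2 where uss: "mset (dlist ?L) = mset (map (\<lambda>us. block_opts ?M1 pos_one (enc_block us)) uss1
        @ map (\<lambda>us. block_opts ?M2 neg_one (enc_block us)) uss2)" and grp: "grouped (dlist ?L)"
    using d_types_structure[of G1 G2] by metis
  have setL: "set (dlist ?L) = (\<lambda>us. block_opts ?M1 pos_one (enc_block us)) ` set uss1
        \<union> (\<lambda>us. block_opts ?M2 neg_one (enc_block us)) ` set uss2"
    using arg_cong[OF uss, of set_mset] by simp
  have can: "\<forall>\<tau>\<in>set (dlist ?L). \<forall>s\<in>set (dlist \<tau>). canonical (data_snd s)"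
    unfolding setL using block_opts_canonical[of pos_one] block_opts_canonical[of neg_one]
    by (auto simp: pos_one_def neg_one_def)
  have un: "\<forall>\<tau>\<in>set (dlist ?L). \<forall>s\<in>set (dlist \<tau>). unary (data_fst s)"
  proof -
    have "unary (data_fst pos_one)" "unary (data_fst neg_one)"
      by (simp_all add: pos_one_def neg_one_def unary_def)
    then show ?thesis unfolding setL using block_opts_unary by blast
  qed
  have unS: "unary (data_fst s)" if "s \<in> set (dlist ?S)" for s
    by (rule d_solve_invariant[of "\<lambda>s. unary (data_fst s)", OF _ un that])
      (simp add: d_add_def unary_d_app)
  have W: "finite ?W" "0 \<in> ?W"
    by (rule finite_common_star_forest_sizes zero_common_star_forest_size;
        use assms in \<open>simp add: input_graph_def\<close>)+
  have mem: "w \<in> ?W \<longleftrightarrow> (\<exists>s\<in>set (dlist ?S). zero_vec (data_snd s) \<and> st_w s = w)" if "?L \<noteq> Atom" for w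
    unfolding d_solve_correct[OF that grp can] choice_types_iff[OF assms] by blast
  \<comment> \<open>With no components at all \<open>d_solve\<close> yields no state, and the result
    is the initial value \<open>Atom\<close> of \<open>d_best\<close>, which encodes the correct
    optimum 0.\<close>
  have mem0: "w = 0" if "w \<in> ?W" "?L = Atom" for w
  proof -
    have "\<exists>ch. choice ch (dlist ?L) \<and> tot_w ch = w \<and> (\<forall>j. tot_v ch j = 0)"
      unfolding choice_types_iff[OF assms] using that(1) by blast
    then show ?thesis using that(2) by (auto simp: choice_def)
  qed
  have "dlen ?d = Max ?W"
  proof (rule Max_eqI[symmetric, OF W(1)])
    fix w assume w: "w \<in> ?W"
    show "w \<le> dlen ?d"
    proof (cases "?L = Atom")
      case True
      have "w = 0" by (rule mem0[OF w True])
      then show ?thesis by simp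
    next
      case False
      obtain s where "s \<in> set (dlist ?S)" "zero_vec (data_snd s)" "st_w s = w"
        using w unfolding mem[OF False] by (elim bexE conjE)
      then show ?thesis using d_best_spec[of ?S Atom] by blast
    qed
  next
    show "dlen ?d \<in> ?W"
    proof (cases "?d = Atom")
      case False
      then obtain s where s: "s \<in> set (dlist ?S)" "zero_vec (data_snd s)" "?d = data_fst s"
        using d_best_spec[of ?S Atom] by auto
      have "?L \<noteq> Atom" using s(1) by (auto simp: d_solve.simps)
      then show ?thesis unfolding s(3) by (subst mem) (use s(1,2) in blast)+
    next
      case True
      then have "dlen ?d = 0" by simp
      then show ?thesis using W(2) by (simp only:)
    qed
  qed
  moreover have "unary ?d"
  proof (cases "?d = Atom")
    case True
    then show ?thesis by (simp only: unary_def dlist.simps) simp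
  next
    case False
    then obtain s where "s \<in> set (dlist ?S)" "?d = data_fst s"
      using d_best_spec[of ?S Atom] by blast
    then show ?thesis using unS by (simp only:)
  qed
  ultimately show ?thesis
    using unary_eq_enc_nat by (metis d_mcsf_def d_optimum_def mcsf_optimum_def)
qed

section \<open>Running time\<close>

lemma pairs_le: "(\<And>x. x \<in> set (dlist d) \<Longrightarrow> pairs x \<le> P) \<Longrightarrow> pairs d \<le> dlen d * Suc P"
proof (induction d)
  case (Pair a d)
  then have "pairs a \<le> P" "pairs d \<le> dlen d * Suc P" by auto
  then show ?case by simp
qed simp

lemma pairs_enc_nat [simp]: "pairs (enc_nat n) = n"
  by (induction n) auto

lemma pairs_d_merge: "pairs (d_merge M v bs acc rest) \<le> pairs bs + pairs acc + pairs rest + 1"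
proof (induction M v bs acc rest rule: d_merge.induct)
  case (2 M v b bs acc rest)
  then show ?case by (auto split: if_splits)
qed simp

text \<open>\<open>X\<close> bounds the vertex numbers and \<open>Y\<close> the list of blocks. A
  round adds at most \<open>pairs i + 2\<close> cells to that list, for which \<open>X + 3\<close>
  leaves room.\<close>

lemma t_build_le:
  assumes "pairs i + dlen rows \<le> X" "pairs bs + dlen rows * (X + 3) \<le> Y"
  shows "t_build M rows i bs \<le> dlen rows * (100 + 300 * (X + 1) * (Y + 1)) + 10"
  using assms
proof (induction M rows i bs rule: t_build.induct)
  case (2 M r rows i bs)
  let ?bs = "d_merge M i bs (Pair i Atom) Atom"
  have "pairs ?bs \<le> pairs bs + pairs i + 2" using pairs_d_merge[of M i bs "Pair i Atom" Atom] by simp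
  then have "t_build M rows (Pair Atom i) ?bs \<le> dlen rows * (100 + 300 * (X + 1) * (Y + 1)) + 10"
    using 2(2,3) by (intro 2(1)) auto
  moreover have "300 * (pairs i + 1) * (pairs bs + 1) \<le> 300 * (X + 1) * (Y + 1)"
    using 2(2,3) by (intro mult_mono) auto
  ultimately show ?case by simp
qed simp

lemma dlen_d_ext: "dlen (d_ext M u cs as) \<le> dlen cs * dlen as"
  by (induction cs) (auto simp: d_consall_def)

lemma dlen_d_assigns: "dlen (d_assigns M us b) \<le> dlen b ^ dlen us"
proof (induction us)
  case (Pair u us)
  have "dlen (d_assigns M (Pair u us) b) \<le> dlen b * dlen (d_assigns M us b)"
    using dlen_d_ext by simp
  also have "\<dots> \<le> dlen b * dlen b ^ dlen us" using Pair.IH(2) by simp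
  finally show ?case by simp
qed simp

text \<open>An entry is a cell with two vertex numbers of size at most \<open>n\<close>, held by one
  list cell: \<open>2 * n + 2\<close>.\<close>

lemma pairs_assignment:
  assumes "a \<in> set (dlist (d_assigns M us b))"
    and "\<And>u. u \<in> set (dlist us) \<Longrightarrow> pairs u \<le> n" "\<And>u. u \<in> set (dlist b) \<Longrightarrow> pairs u \<le> n"
  shows "pairs a \<le> dlen us * (2 * n + 2)" "dlen a = dlen us"
proof -
  have l: "list_all2 (\<lambda>x u. \<exists>c\<in>set (dlist b). x = Pair u c \<and> (u = c \<or> d_adj M u c)) (dlist a) (dlist us)"
    using assms(1) by (simp add: mem_d_assigns)
  show len: "dlen a = dlen us" using l by (rule list_all2_lengthD)
  have "pairs x \<le> 2 * n + 1" if x: "x \<in> set (dlist a)" for x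
  proof -
    obtain i where i: "i < dlen a" "x = dlist a ! i" using x unfolding in_set_conv_nth by blast
    have "dlist us ! i \<in> set (dlist us)" using i(1) len by simp
    then obtain u c where "u \<in> set (dlist us)" "c \<in> set (dlist b)" "x = Pair u c"
      using list_all2_nthD[OF l i(1)] i(2) by blast
    then show ?thesis using assms(2,3)[of u] assms(3)[of c] by simp
  qed
  then have "pairs a \<le> dlen a * Suc (2 * n + 1)" by (rule pairs_le)
  then show "pairs a \<le> dlen us * (2 * n + 2)" using len by simp
qed

text \<open>\<open>PA\<close> is the number of maps times the size of one, including its list cell.
  The base \<open>k + 1\<close> keeps the power increasing in the exponent also for
  \<open>k = 0\<close>.\<close>

lemma t_assigns_le:
  assumes "\<And>u. u \<in> set (dlist us) \<Longrightarrow> pairs u \<le> n" "\<And>u. u \<in> set (dlist b) \<Longrightarrow> pairs u \<le> n"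
    and "dlen b \<le> k" "dlen us \<le> k" and PA: "PA = (k + 1) ^ k * (k * (2 * n + 2) + 1)"
  shows "t_assigns M us b \<le> dlen us * (20 + 300 * (n + PA + 1) * (k * (n + 1) + 1)) + 10
    \<and> pairs (d_assigns M us b) \<le> PA"
  using assms(1,4)
proof (induction us)
  case Atom
  have "0 < PA" unfolding PA by simp
  then show ?case by simp
next
  case (Pair u us)
  have us: "\<And>u'. u' \<in> set (dlist (Pair u us)) \<Longrightarrow> pairs u' \<le> n" by (rule Pair.prems(1))
  have IH: "t_assigns M us b \<le> dlen us * (20 + 300 * (n + PA + 1) * (k * (n + 1) + 1)) + 10"
    "pairs (d_assigns M us b) \<le> PA"
    using Pair by auto
  have "pairs b \<le> dlen b * Suc n" by (rule pairs_le) (rule assms(2))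
  also have "\<dots> \<le> k * (n + 1)" using mult_right_mono[OF assms(3), of "Suc n"] by simp
  finally have pb: "pairs b \<le> k * (n + 1)" .
  have "pairs u \<le> n" using us by simp
  then have "300 * (pairs u + pairs (d_assigns M us b) + 1) * (pairs b + 1)
      \<le> 300 * (n + PA + 1) * (k * (n + 1) + 1)"
    using IH(2) pb by (intro mult_mono) auto
  then have 1: "t_assigns M (Pair u us) b
      \<le> dlen (Pair u us) * (20 + 300 * (n + PA + 1) * (k * (n + 1) + 1)) + 10"
    using IH(1) by simp
  have "pairs a \<le> k * (2 * n + 2)" if "a \<in> set (dlist (d_assigns M (Pair u us) b))" for a
  proof -
    have "pairs a \<le> dlen (Pair u us) * (2 * n + 2)"
      using pairs_assignment(1)[OF that us assms(2)] .
    also have "\<dots> \<le> k * (2 * n + 2)" using Pair.prems(2) by (intro mult_right_mono) auto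
    finally show ?thesis .
  qed
  from pairs_le[OF this] have 2: "pairs (d_assigns M (Pair u us) b)
      \<le> dlen (d_assigns M (Pair u us) b) * (k * (2 * n + 2) + 1)" by simp
  have "dlen (d_assigns M (Pair u us) b) \<le> dlen b ^ dlen (Pair u us)" by (rule dlen_d_assigns)
  also have "\<dots> \<le> (k + 1) ^ dlen (Pair u us)" using assms(3) by (intro power_mono) auto
  also have "\<dots> \<le> (k + 1) ^ k" using Pair.prems(2) by (intro power_increasing) auto
  finally have "dlen (d_assigns M (Pair u us) b) * (k * (2 * n + 2) + 1) \<le> PA"
    unfolding PA by (rule mult_right_mono) simp
  then show ?case using 1 2 by (meson order_trans)
qed

lemma leaves_le: "leaves v a \<le> dlen a"
  by (simp add: leaves_def)

lemma pairs_dl_replicate: "pairs (dl (replicate l d)) = l * Suc (pairs d)"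
  by (induction l) auto

text \<open>Both units have size 2, so an entry takes 3 cells.\<close>

lemma pairs_d_leafvec: "pairs one = 2 \<Longrightarrow> pairs (d_leafvec one v a) \<le> 3 * pairs a"
  using leaves_le[of v a] dlen_le_pairs[of a] by (simp add: d_leafvec_def pairs_dl_replicate)

lemma pairs_d_vecs: "pairs one = 2 \<Longrightarrow> pairs (d_vecs one a a0) \<le> dlen a * (3 * pairs a0)"
proof (induction a)
  case (Pair x a)
  then show ?case
    using pairs_d_addvec[of "d_leafvec one (data_fst x) a0" "d_vecs one a a0"]
      pairs_d_leafvec[OF Pair.prems, of "data_fst x" a0]
    by simp
qed simp

lemma t_vecs_le:
  assumes "pairs one = 2" "dlen a \<le> P" "pairs a0 \<le> P"
  shows "t_vecs one a a0 \<le> dlen a * (100 + 300 * (P + 1) + 300 * (3 * P + P * (3 * P) + 1)) + 10"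
  using assms(2)
proof (induction a)
  case (Pair x a)
  have "pairs (d_leafvec one (data_fst x) a0) \<le> 3 * P"
    using pairs_d_leafvec[OF assms(1), of "data_fst x" a0] assms(3) by linarith
  moreover have "pairs (d_vecs one a a0) \<le> P * (3 * P)"
    using pairs_d_vecs[OF assms(1), of a a0] Pair.prems assms(3)
      mult_mono[of "dlen a" P "3 * pairs a0" "3 * P"] by simp
  ultimately show ?case using Pair assms(3) by simp
qed simp

lemma t_opts_le:
  assumes "pairs one = 2" "\<And>a. a \<in> set (dlist as) \<Longrightarrow> pairs a \<le> P"
  shows "t_opts one as \<le> dlen as * (60 + 300 * (P + 1) * (P + 1) + 1000 * (P + 3) * (P + 1)
      + P * (100 + 300 * (P + 1) + 300 * (3 * P + P * (3 * P) + 1))) + 10"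
  using assms(2)
proof (induction as)
  case (Pair a as)
  let ?K = "60 + 300 * (P + 1) * (P + 1) + 1000 * (P + 3) * (P + 1)
      + P * (100 + 300 * (P + 1) + 300 * (3 * P + P * (3 * P) + 1))"
  have a: "pairs a \<le> P" "dlen a \<le> P" using Pair.prems[of a] dlen_le_pairs[of a] by auto
  have "t_vecs one a a \<le> dlen a * (100 + 300 * (P + 1) + 300 * (3 * P + P * (3 * P) + 1)) + 10"
    using t_vecs_le[OF assms(1) a(2,1)] .
  also have "\<dots> \<le> P * (100 + 300 * (P + 1) + 300 * (3 * P + P * (3 * P) + 1)) + 10"
    using a(2) by (intro add_mono mult_right_mono) auto
  finally have "t_vecs one a a \<le> \<dots>" .
  moreover have "300 * (pairs a + 1) * (pairs a + 1) \<le> 300 * (P + 1) * (P + 1)"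
    using a by (intro mult_mono) auto
  moreover have "1000 * (pairs one + pairs a + 1) * (pairs a + 1) \<le> 1000 * (P + 3) * (P + 1)"
    using a assms(1) by (intro mult_mono) auto
  ultimately have "50 + 300 * (pairs a + 1) * (pairs a + 1)
      + 1000 * (pairs one + pairs a + 1) * (pairs a + 1) + t_vecs one a a \<le> ?K" by linarith
  moreover have "t_opts one as \<le> dlen as * ?K + 10" using Pair.prems by (intro Pair.IH(2)) auto
  ultimately have "t_opts one (Pair a as) \<le> ?K + (dlen as * ?K + 10)"
    unfolding t_opts.simps by linarith
  moreover have "dlen (Pair a as) * K + 10 = K + (dlen as * K + 10)" for K by simp
  ultimately show ?case by (simp only:)
qed simp

lemma pairs_d_ginsert [simp]: "pairs (d_ginsert x L) = Suc (pairs x + pairs L)"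
  by (induction L) auto

lemma pairs_d_optlists:
  assumes "\<And>b. b \<in> set (dlist bs) \<Longrightarrow> pairs (block_opts M one b) \<le> P"
  shows "pairs (d_optlists M one bs L) \<le> dlen bs * Suc P + pairs L"
  using assms
proof (induction bs)
  case (Pair b bs)
  then have "pairs (block_opts M one b) \<le> P" "pairs (d_optlists M one bs L) \<le> dlen bs * Suc P + pairs L"
    by auto
  then show ?case by simp
qed simp

lemma t_optlists_le:
  assumes "\<And>b. b \<in> set (dlist bs) \<Longrightarrow> pairs (block_opts M one b) \<le> P"
    and "\<And>b. b \<in> set (dlist bs) \<Longrightarrow> t_assigns M b b + t_opts one (d_assigns M b b) \<le> Q"
    and "dlen bs * Suc P + pairs L \<le> R"
  shows "t_optlists M one bs L \<le> dlen bs * (50 + Q + 100 * (R + 1)) + 10"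
  using assms
proof (induction bs)
  case (Pair b bs)
  have "pairs (d_optlists M one bs L) \<le> dlen bs * Suc P + pairs L"
    using Pair.prems(1) by (intro pairs_d_optlists) auto
  then have "pairs (d_optlists M one bs L) \<le> R" using Pair.prems(3) by simp
  moreover have "t_optlists M one bs L \<le> dlen bs * (50 + Q + 100 * (R + 1)) + 10"
    using Pair.prems by (intro Pair.IH(2)) auto
  moreover have "t_assigns M b b + t_opts one (d_assigns M b b) \<le> Q" using Pair.prems(2) by simp
  ultimately show ?case by simp
qed simp

section \<open>Cost of the search\<close>

lemma pairs_d_insert: "pairs acc \<le> pairs (d_insert B u acc)"
  by (simp add: d_insert_def)

lemma pairs_d_comb1: "pairs acc \<le> pairs (d_comb1 B s T acc)"
  by (induction B s T acc rule: d_comb1.induct) (auto intro: order_trans[OF pairs_d_insert])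

lemma pairs_d_comb: "pairs acc \<le> pairs (d_comb B S T acc)"
  by (induction B S T acc rule: d_comb.induct) (auto intro: order_trans[OF pairs_d_comb1])

text \<open>The accumulator only grows, so a bound on the final list covers all intermediate
  ones.\<close>

lemma t_comb1_le:
  assumes "pairs s \<le> X" "pairs T \<le> X" "pairs (d_comb1 B s T acc) \<le> X"
  shows "t_comb1 B s T acc \<le> dlen T * (100 + 1000 * (3 * X + 1)) + 10"
  using assms
proof (induction B s T acc rule: t_comb1.induct)
  case (2 B s t T acc)
  have "pairs acc \<le> X"
    using pairs_d_comb1[of acc B s "Pair t T"] 2(4) by linarith
  then have "1000 * (pairs s + pairs t + pairs acc + 1) \<le> 1000 * (3 * X + 1)"
    using 2(2,3) by simp
  moreover have "t_comb1 B s T (d_insert B (d_add s t) acc) \<le> dlen T * (100 + 1000 * (3 * X + 1)) + 10"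
    using 2(2-4) by (intro 2(1)) auto
  ultimately show ?case by simp
qed simp

lemma t_comb_le:
  assumes "pairs S \<le> X" "pairs T \<le> X" "pairs (d_comb B S T acc) \<le> X"
  shows "t_comb B S T acc \<le> dlen S * (40 + X * (100 + 1000 * (3 * X + 1))) + 10"
  using assms
proof (induction B S T acc rule: t_comb.induct)
  case (2 B s S T acc)
  have acc: "pairs (d_comb1 B s T acc) \<le> X"
    using pairs_d_comb[of "d_comb1 B s T acc" B S T] 2(4) by simp
  have "t_comb1 B s T acc \<le> dlen T * (100 + 1000 * (3 * X + 1)) + 10"
    using 2(2,3) acc by (intro t_comb1_le) auto
  also have "\<dots> \<le> X * (100 + 1000 * (3 * X + 1)) + 10"
    using 2(3) dlen_le_pairs[of T] by (intro add_mono mult_right_mono) auto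
  finally have "t_comb1 B s T acc \<le> X * (100 + 1000 * (3 * X + 1)) + 10" .
  moreover have "t_comb B S T (d_comb1 B s T acc) \<le> dlen S * (40 + X * (100 + 1000 * (3 * X + 1))) + 10"
    using 2(2-4) by (intro 2(1)) auto
  ultimately show ?case by simp
qed simp

text \<open>Stated for variables, to keep the large products of the actual bounds away from the
  arithmetic.\<close>

lemma t_solve_step:
  fixes a p t y :: nat
  shows "p \<le> a \<Longrightarrow> t \<le> y + 10 \<Longrightarrow> 100 + 300 * (p + 1) + t \<le> 110 + 300 * (a + 1) + y"
  by simp

text \<open>A recursion tree with m leaves has m - 1 inner nodes, each of cost at most
  \<open>Z\<close>. The surplus \<open>Z\<close> on the left of the second conjunct makes the
  induction close: (2 a Z - Z) + (2 b Z - Z) + Z = 2 (a + b) Z - Z. The empty list, where it fails,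
  never arises from a split.\<close>

lemma t_solve_le:
  assumes X: "\<And>L'. set (dlist L') \<subseteq> set (dlist L) \<Longrightarrow> dlen L' \<le> dlen L \<Longrightarrow> pairs (d_solve B L') \<le> X"
    and P: "\<And>\<tau>. \<tau> \<in> set (dlist L) \<Longrightarrow> pairs \<tau> \<le> P"
    and Z: "Z = 110 + 300 * (dlen L * Suc P + 1) + X * (40 + X * (100 + 1000 * (3 * X + 1)))"
    and L': "set (dlist L') \<subseteq> set (dlist L)" "dlen L' \<le> dlen L"
  shows "t_solve B L' \<le> 2 * dlen L' * Z + 30 \<and> (L' \<noteq> Atom \<longrightarrow> t_solve B L' + Z \<le> 2 * dlen L' * Z)"
  using X L'
proof (induction B L' rule: t_solve.induct)
  case (1 B L')
  show ?case
  proof (cases "data_snd L' = Atom")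
    case True
    then have "t_solve B L' = 30" by (simp add: t_solve.simps[of B L'])
    moreover have "30 \<le> Z" unfolding Z by simp
    moreover have "L' \<noteq> Atom \<Longrightarrow> dlen L' = 1" using True by (cases L') auto
    ultimately show ?thesis by auto
  next
    case False
    let ?a = "d_odds L'" and ?b = "d_odds (data_snd L')"
    have ne: "?a \<noteq> Atom" "?b \<noteq> Atom"
      using False by (cases L'; cases "data_snd L'"; auto)+
    have sub: "set (dlist ?a) \<subseteq> set (dlist L')" "set (dlist ?b) \<subseteq> set (dlist L')"
      using set_odds[of "dlist L'"] set_odds[of "tl (dlist L')"] set_tl_subset[of "dlist L'"]
      by (auto simp: dlist_d_odds dlist_data_snd)
    have len: "dlen ?a + dlen ?b = dlen L'"
    proof -
      obtain m where "dlen L' = Suc m" using False by (cases L') auto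
      then show ?thesis by (simp add: dlist_d_odds dlist_data_snd length_odds)
    qed
    have prem: "set (dlist ?a) \<subseteq> set (dlist L)" "dlen ?a \<le> dlen L"
      "set (dlist ?b) \<subseteq> set (dlist L)" "dlen ?b \<le> dlen L"
      using sub len 1(4,5) by auto
    have IH: "t_solve B ?a + Z \<le> 2 * dlen ?a * Z" "t_solve B ?b + Z \<le> 2 * dlen ?b * Z"
      using 1(1)[OF False 1(3) prem(1,2)] 1(2)[OF False 1(3) prem(3,4)] ne by auto
    have "pairs L' \<le> dlen L' * Suc P" using 1(4) P by (intro pairs_le) auto
    also have "\<dots> \<le> dlen L * Suc P" using 1(5) by (intro mult_right_mono) auto
    finally have p: "pairs L' \<le> dlen L * Suc P" .
    have Xs: "pairs (d_solve B ?a) \<le> X" "pairs (d_solve B ?b) \<le> X"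
      by (rule 1(3)[OF prem(1,2)] 1(3)[OF prem(3,4)])+
    have "pairs (d_solve B L') \<le> X" by (rule 1(3)[OF 1(4,5)])
    then have "pairs (d_comb B (d_solve B ?a) (d_solve B ?b) Atom) \<le> X"
      using False by (simp add: d_solve.simps[of B L'])
    then have "t_comb B (d_solve B ?a) (d_solve B ?b) Atom
        \<le> dlen (d_solve B ?a) * (40 + X * (100 + 1000 * (3 * X + 1))) + 10"
      by (intro t_comb_le Xs)
    also have "\<dots> \<le> X * (40 + X * (100 + 1000 * (3 * X + 1))) + 10"
      using Xs(1) dlen_le_pairs[of "d_solve B ?a"] by (intro add_mono mult_right_mono) auto
    finally have "100 + 300 * (pairs L' + 1) + t_comb B (d_solve B ?a) (d_solve B ?b) Atom \<le> Z"
      unfolding Z by (rule t_solve_step[OF p])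
    then have "t_solve B L' \<le> Z + t_solve B ?a + t_solve B ?b"
      using False by (simp add: t_solve.simps[of B L'])
    then have "t_solve B L' + Z \<le> 2 * dlen ?a * Z + 2 * dlen ?b * Z" using IH by linarith
    also have "\<dots> = 2 * dlen L' * Z" unfolding len[symmetric] by (simp add: algebra_simps)
    finally show ?thesis by simp
  qed
qed

section \<open>Counting states\<close>

definition dlists :: "data set \<Rightarrow> nat \<Rightarrow> data set" where
  "dlists A l = {d. set (dlist d) \<subseteq> A \<and> dlen d \<le> l}"

text \<open>Both parts may be positive; admitting unreduced pairs makes the count at most quadratic
  in \<open>\<beta> + 1\<close>.\<close>

definition entries :: "nat \<Rightarrow> data set" where
  "entries \<beta> = (\<lambda>(p, q). Pair (enc_nat p) (enc_nat q)) ` ({..\<beta>} \<times> {..\<beta>})"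

definition states :: "nat \<Rightarrow> nat \<Rightarrow> nat \<Rightarrow> data set" where
  "states W l \<beta> = (\<lambda>(w, v). Pair (enc_nat w) v) ` ({..W} \<times> dlists (entries \<beta>) l)"

lemma sum_powers_le: "(\<Sum>i\<le>n. a ^ i) \<le> (a + 1 :: nat) ^ n"
proof (induction n)
  case (Suc n)
  have "a ^ n \<le> (a + 1) ^ n" by (rule power_mono) auto
  then have "(\<Sum>i\<le>n. a ^ i) + a * a ^ n \<le> (a + 1) ^ n + a * (a + 1) ^ n"
    by (intro add_mono[OF Suc] mult_left_mono) auto
  then show ?case by simp
qed simp

lemma dlists_eq: "dlists A l = dl ` {xs. set xs \<subseteq> A \<and> length xs \<le> l}"
proof
  show "dlists A l \<subseteq> dl ` {xs. set xs \<subseteq> A \<and> length xs \<le> l}"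
    unfolding dlists_def by (auto intro!: image_eqI[where f = dl, OF dl_dlist[symmetric]])
qed (auto simp: dlists_def)

lemma
  assumes "finite A"
  shows finite_dlists: "finite (dlists A l)" and card_dlists: "card (dlists A l) \<le> (card A + 1) ^ l"
proof -
  have fin: "finite {xs. set xs \<subseteq> A \<and> length xs \<le> l}" by (rule finite_lists_length_le[OF assms])
  then show "finite (dlists A l)" by (simp add: dlists_eq)
  have "card (dlists A l) \<le> card {xs. set xs \<subseteq> A \<and> length xs \<le> l}"
    unfolding dlists_eq by (rule card_image_le[OF fin])
  also have "\<dots> = (\<Sum>i\<le>l. card A ^ i)" by (rule card_lists_length_le[OF assms])
  also have "\<dots> \<le> (card A + 1) ^ l" by (rule sum_powers_le)
  finally show "card (dlists A l) \<le> (card A + 1) ^ l" .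
qed

lemma dlists_mono: "A \<subseteq> B \<Longrightarrow> k \<le> l \<Longrightarrow> dlists A k \<subseteq> dlists B l"
  by (auto simp: dlists_def)

lemma finite_entries: "finite (entries \<beta>)"
  by (simp add: entries_def)

lemma card_entries: "card (entries \<beta>) \<le> (\<beta> + 1) * (\<beta> + 1)"
proof -
  have "card (entries \<beta>) \<le> card ({..\<beta>} \<times> {..\<beta>})" unfolding entries_def by (rule card_image_le) simp
  then show ?thesis by (simp add: card_cartesian_product)
qed

lemma entries_mono: "\<beta> \<le> \<gamma> \<Longrightarrow> entries \<beta> \<subseteq> entries \<gamma>"
  by (auto simp: entries_def)

definition state_bound :: "nat \<Rightarrow> nat \<Rightarrow> nat \<Rightarrow> nat" where
  "state_bound W l \<beta> = (W + 1) * ((\<beta> + 1) * (\<beta> + 1) + 1) ^ l"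

lemma finite_states: "finite (states W l \<beta>)"
  by (simp add: states_def finite_dlists finite_entries)

lemma card_states: "card (states W l \<beta>) \<le> state_bound W l \<beta>"
proof -
  have "card (states W l \<beta>) \<le> card ({..W} \<times> dlists (entries \<beta>) l)"
    unfolding states_def by (rule card_image_le) (simp add: finite_dlists finite_entries)
  also have "\<dots> = (W + 1) * card (dlists (entries \<beta>) l)" by (simp add: card_cartesian_product)
  also have "\<dots> \<le> state_bound W l \<beta>"
    unfolding state_bound_def
  proof (rule mult_left_mono)
    have "card (dlists (entries \<beta>) l) \<le> (card (entries \<beta>) + 1) ^ l"
      by (rule card_dlists[OF finite_entries])
    also have "\<dots> \<le> ((\<beta> + 1) * (\<beta> + 1) + 1) ^ l"
      using card_entries[of \<beta>] by (intro power_mono) auto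
    finally show "card (dlists (entries \<beta>) l) \<le> ((\<beta> + 1) * (\<beta> + 1) + 1) ^ l" .
  qed simp
  finally show ?thesis .
qed

lemma pairs_states:
  assumes "s \<in> states W l \<beta>"
  shows "pairs s \<le> W + 1 + l * (2 * \<beta> + 2)"
proof -
  obtain w v where s: "s = Pair (enc_nat w) v" "w \<le> W" "set (dlist v) \<subseteq> entries \<beta>" "dlen v \<le> l"
    using assms by (auto simp: states_def dlists_def)
  have "pairs v \<le> dlen v * Suc (2 * \<beta> + 1)"
    using s(3) by (intro pairs_le) (auto simp: entries_def subset_iff)
  also have "\<dots> \<le> l * Suc (2 * \<beta> + 1)" using s(4) by (intro mult_right_mono) auto
  finally show ?thesis using s by simp
qed

lemma d_norm_entries:
  "unary p \<Longrightarrow> unary q \<Longrightarrow> dlen p \<le> \<beta> \<Longrightarrow> dlen q \<le> \<beta> \<Longrightarrow> d_norm p q \<in> entries \<beta>"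
proof (induction p q rule: d_norm.induct)
  case (1 a p b q)
  then show ?case by (auto simp: unary_def)
next
  case ("2_1" q)
  then show ?case using unary_eq_enc_nat[of Atom] unary_eq_enc_nat[of q]
    by (auto simp: entries_def intro!: image_eqI[of _ _ "(0, dlen q)"])
next
  case ("2_2" p)
  then show ?case using unary_eq_enc_nat[of Atom] unary_eq_enc_nat[of p]
    by (auto simp: entries_def intro!: image_eqI[of _ _ "(dlen p, 0)"])
qed

lemma dlen_enc_nat [simp]: "dlen (enc_nat n) = n"
  by (induction n) auto

lemma unary_enc_nat [simp]: "unary (enc_nat n)"
  by (induction n) (auto simp: unary_def)

lemma d_addvec_dlists:
  "x \<in> dlists (entries \<beta>) l \<Longrightarrow> y \<in> dlists (entries \<gamma>) l \<Longrightarrow> d_addvec x y \<in> dlists (entries (\<beta> + \<gamma>)) l"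
proof (induction x y arbitrary: l rule: d_addvec.induct)
  case (1 y)
  then show ?case using dlists_mono[OF entries_mono[of \<gamma> "\<beta> + \<gamma>"], of l l] by auto
next
  case (2 a x)
  then show ?case using dlists_mono[OF entries_mono[of \<beta> "\<beta> + \<gamma>"], of l l] by auto
next
  case (3 a x b y)
  then obtain m where m: "l = Suc m" by (cases l) (auto simp: dlists_def)
  have "x \<in> dlists (entries \<beta>) m" "y \<in> dlists (entries \<gamma>) m" "a \<in> entries \<beta>" "b \<in> entries \<gamma>"
    using 3(2,3) m by (auto simp: dlists_def)
  moreover from this have "d_norm (d_app (data_fst a) (data_fst b)) (d_app (data_snd a) (data_snd b))
      \<in> entries (\<beta> + \<gamma>)"
    by (intro d_norm_entries) (auto simp: entries_def unary_d_app)
  ultimately show ?case using 3(1)[of m] m by (auto simp: dlists_def)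
qed

text \<open>Bounds on weight and entries add up, but the number \<open>l\<close> of coordinates, the
  exponent in the count of states, stays.\<close>

lemma d_add_states:
  assumes "s \<in> states W l \<beta>" "t \<in> states W' l \<gamma>"
  shows "d_add s t \<in> states (W + W') l (\<beta> + \<gamma>)"
proof -
  obtain w v where s: "s = Pair (enc_nat w) v" "w \<le> W" "v \<in> dlists (entries \<beta>) l"
    using assms by (auto simp: states_def)
  obtain w' v' where t: "t = Pair (enc_nat w') v'" "w' \<le> W'" "v' \<in> dlists (entries \<gamma>) l"
    using assms by (auto simp: states_def)
  have "d_app (enc_nat w) (enc_nat w') = enc_nat (w + w')"
    using unary_eq_enc_nat[OF unary_d_app[of "enc_nat w" "enc_nat w'"]] by simp
  then show ?thesis using s t d_addvec_dlists[of v \<beta> l v' \<gamma>]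
    by (auto simp: d_add_def states_def intro!: image_eqI[of _ _ "(w + w', d_addvec v v')"])
qed

text \<open>The box test replaces whatever entry bound has accumulated by the fixed radius.\<close>

lemma states_in_box:
  assumes "s \<in> states W l \<beta>" "in_box B (data_snd s)" "st_w s \<le> W'" "dlen B \<le> \<gamma>"
  shows "s \<in> states W' l \<gamma>"
proof -
  obtain w v where s: "s = Pair (enc_nat w) v" "set (dlist v) \<subseteq> entries \<beta>" "dlen v \<le> l"
    using assms by (auto simp: states_def dlists_def)
  have "e \<in> entries \<gamma>" if "e \<in> set (dlist v)" for e
    using that s assms(2,4) by (fastforce simp: entries_def in_box_def)
  then show ?thesis using s assms(3)
    by (auto simp: states_def dlists_def intro!: image_eqI[of _ _ "(w, v)"])
qed

text \<open>Each of the at most \<open>k\<close> vertices adds at most one unit to a coordinate and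
  to the weight, and has at most \<open>k\<close> leaves; so \<open>k\<close> bounds all three
  parameters.\<close>

lemma d_option_states:
  assumes one: "one = pos_one \<or> one = neg_one" and k: "dlen a \<le> k"
  shows "d_option one a \<in> states k k k"
proof -
  have "one \<in> entries 1"
    using one by (auto simp: pos_one_def neg_one_def entries_def
        intro: image_eqI[of _ _ "(1, 0)"] image_eqI[of _ _ "(0, 1)"])
  then have leaf: "d_leafvec one v a \<in> dlists (entries 1) k" for v
    using leaves_le[of v a] k by (auto simp: dlists_def d_leafvec_def)
  have "d_vecs one a' a \<in> dlists (entries (dlen a')) k" for a'
  proof (induction a')
    case (Pair x a')
    then show ?case using d_addvec_dlists[OF leaf Pair(2)] by simp
  qed (auto simp: dlists_def)
  then have v: "d_vecs one a a \<in> dlists (entries k) k"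
    using dlists_mono[OF entries_mono[OF k], of k k] by auto
  have "unary (data_fst one)" "dlen (data_fst one) \<le> 1"
    using one by (auto simp: pos_one_def neg_one_def unary_def)
  then have "unary (d_wcount one a a)" and "dlen (d_wcount one a a) \<le> 1 * dlen a"
    unfolding dlen_d_wcount by (simp_all only: unary_d_wcount mult_le_mono length_filter_le)
  then have "d_wcount one a a = enc_nat (dlen (d_wcount one a a))" "dlen (d_wcount one a a) \<le> k"
    using unary_eq_enc_nat k by auto
  then show ?thesis using v
    by (auto simp: d_option_def states_def intro!: image_eqI[of _ _ "(dlen (d_wcount one a a), d_vecs one a a)"])
qed

section \<open>Doubly exponential bounds\<close>

definition sexp :: "(nat \<Rightarrow> nat) \<Rightarrow> bool" where
  "sexp h \<longleftrightarrow> (\<exists>a b. \<forall>k. h k \<le> 2 ^ (a * k ^ 2 + b))"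

definition dexp :: "(nat \<Rightarrow> nat) \<Rightarrow> bool" where
  "dexp g \<longleftrightarrow> (\<exists>a b. \<forall>k. g k \<le> 2 ^ (2 ^ (a * k ^ 2 + b)))"

text \<open>\<open>n + 1\<close> keeps the polynomial factor positive at
  \<open>n = 0\<close>.\<close>

definition fpt :: "(nat \<Rightarrow> nat \<Rightarrow> nat) \<Rightarrow> bool" where
  "fpt h \<longleftrightarrow> (\<exists>g d. dexp g \<and> (\<forall>k n. h k n \<le> g k * (n + 1) ^ d))"

lemma sexp_id: "sexp (\<lambda>k. k)"
proof -
  have "k \<le> 2 ^ (1 * k ^ 2 + 0)" for k :: nat
  proof -
    have "k \<le> 2 ^ k" by (simp add: less_imp_le)
    also have "\<dots> \<le> 2 ^ (1 * k ^ 2 + 0)" by (intro power_increasing) (auto simp: power2_eq_square)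
    finally show ?thesis .
  qed
  then show ?thesis unfolding sexp_def by blast
qed

text \<open>The origin of the quadratic exponent: \<open>(k + 1) ^ k\<close> bounds the number of
  maps of a block, and \<open>k + 1 \<le> 2 ^ k\<close>.\<close>

lemma sexp_power_self: "sexp (\<lambda>k. (k + 1) ^ k)"
proof -
  have "(k + 1) ^ k \<le> 2 ^ (1 * k ^ 2 + 0)" for k :: nat
  proof -
    have "k + 1 \<le> 2 ^ k" by (metis less_exp Suc_leI add.commute plus_1_eq_Suc)
    then have "(k + 1) ^ k \<le> (2 ^ k) ^ k" by (rule power_mono) simp
    then show ?thesis by (simp add: power_mult[symmetric] power2_eq_square)
  qed
  then show ?thesis unfolding sexp_def by blast
qed

lemma dexp_of_sexp: "sexp h \<Longrightarrow> dexp h"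
  unfolding sexp_def dexp_def by (meson le_trans less_exp less_imp_le)

lemma dexp_const: "dexp (\<lambda>_. c)"
proof -
  have "c \<le> 2 ^ 2 ^ (0 * k ^ 2 + c)" for k :: nat
    by simp (meson le_trans less_exp less_imp_le)
  then show ?thesis unfolding dexp_def by blast
qed

text \<open>A singly exponential power merely adds to the inner exponent, so counting lists of
  \<open>(k + 1) ^ k\<close> vectors stays within a double exponential in
  \<open>k ^ 2\<close>.\<close>

lemma dexp_power:
  assumes "dexp g" "sexp h"
  shows "dexp (\<lambda>k. g k ^ h k)"
proof -
  obtain a b where g: "\<And>k. g k \<le> 2 ^ (2 ^ (a * k ^ 2 + b))" using assms(1) by (auto simp: dexp_def)
  obtain c d where h: "\<And>k. h k \<le> 2 ^ (c * k ^ 2 + d)" using assms(2) by (auto simp: sexp_def)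
  have "g k ^ h k \<le> 2 ^ (2 ^ ((a + c) * k ^ 2 + (b + d)))" for k
  proof -
    have "g k ^ h k \<le> (2 ^ (2 ^ (a * k ^ 2 + b))) ^ h k" by (rule power_mono[OF g]) simp
    also have "\<dots> \<le> (2 ^ (2 ^ (a * k ^ 2 + b))) ^ (2 ^ (c * k ^ 2 + d))"
      by (rule power_increasing[OF h]) simp
    also have "\<dots> = 2 ^ (2 ^ ((a + c) * k ^ 2 + (b + d)))"
      by (simp add: power_mult[symmetric] power_add[symmetric] algebra_simps)
    finally show ?thesis .
  qed
  then show ?thesis unfolding dexp_def by blast
qed

lemma dexp_mult:
  assumes "dexp g" "dexp h"
  shows "dexp (\<lambda>k. g k * h k)"
proof -
  obtain a b where g: "\<And>k. g k \<le> 2 ^ (2 ^ (a * k ^ 2 + b))" using assms(1) by (auto simp: dexp_def)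
  obtain c d where h: "\<And>k. h k \<le> 2 ^ (2 ^ (c * k ^ 2 + d))" using assms(2) by (auto simp: dexp_def)
  have "g k * h k \<le> 2 ^ (2 ^ ((a + c) * k ^ 2 + (b + d + 1)))" for k
  proof -
    let ?e = "2 ^ ((a + c) * k ^ 2 + (b + d)) :: nat"
    have "g k * h k \<le> 2 ^ (2 ^ (a * k ^ 2 + b)) * 2 ^ (2 ^ (c * k ^ 2 + d))" using g h by (intro mult_mono) auto
    also have "\<dots> \<le> 2 ^ ?e * 2 ^ ?e"
      by (intro mult_mono power_increasing) (auto simp: algebra_simps)
    also have "\<dots> = 2 ^ (2 ^ ((a + c) * k ^ 2 + (b + d + 1)))"
      by (simp add: power_add[symmetric] mult_2)
    finally show ?thesis .
  qed
  then show ?thesis unfolding dexp_def by blast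
qed

lemma dexp_mono: "dexp h \<Longrightarrow> (\<And>k. g k \<le> h k) \<Longrightarrow> dexp g"
  unfolding dexp_def by (meson le_trans)

text \<open>Reduces closure under sums to closure under products.\<close>

lemma add_le_mult_Suc: "x + y \<le> Suc x * Suc y" for x y :: nat
  by simp

lemma dexp_Suc:
  assumes "dexp g"
  shows "dexp (\<lambda>k. Suc (g k))"
proof -
  obtain a b where g: "\<And>k. g k \<le> 2 ^ (2 ^ (a * k ^ 2 + b))" using assms by (auto simp: dexp_def)
  have "Suc (g k) \<le> 2 * 2 ^ (2 ^ (a * k ^ 2 + b))" for k
    using g[of k] one_le_power[of "2::nat" "2 ^ (a * k ^ 2 + b)"] by linarith
  moreover have "dexp (\<lambda>k. 2 * 2 ^ (2 ^ (a * k ^ 2 + b)))"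
    by (rule dexp_mult[OF dexp_const]) (auto simp: dexp_def)
  ultimately show ?thesis by (rule dexp_mono[rotated])
qed

lemma dexp_add: "dexp g \<Longrightarrow> dexp h \<Longrightarrow> dexp (\<lambda>k. g k + h k)"
  by (rule dexp_mono[OF dexp_mult[OF dexp_Suc dexp_Suc] add_le_mult_Suc])

lemma fpt_of_dexp: "dexp g \<Longrightarrow> fpt (\<lambda>k n. g k)"
  unfolding fpt_def by (intro exI[of _ g] exI[of _ 0]) auto

lemma fpt_n: "fpt (\<lambda>k n. n)"
  unfolding fpt_def using dexp_const[of 1] by (intro exI[of _ "\<lambda>_. 1"] exI[of _ 1]) auto

lemma fpt_mult:
  assumes "fpt g" "fpt h"
  shows "fpt (\<lambda>k n. g k n * h k n)"
proof -
  obtain g' d where g: "dexp g'" "\<And>k n. g k n \<le> g' k * (n + 1) ^ d" using assms(1) by (auto simp: fpt_def)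
  obtain h' e where h: "dexp h'" "\<And>k n. h k n \<le> h' k * (n + 1) ^ e" using assms(2) by (auto simp: fpt_def)
  have "g k n * h k n \<le> (g' k * h' k) * (n + 1) ^ (d + e)" for k n
    using mult_mono[OF g(2)[of k n] h(2)[of k n]] by (simp add: power_add algebra_simps)
  then show ?thesis unfolding fpt_def using dexp_mult[OF g(1) h(1)] by blast
qed

lemma fpt_add:
  assumes "fpt g" "fpt h"
  shows "fpt (\<lambda>k n. g k n + h k n)"
proof -
  obtain g' d where g: "dexp g'" "\<And>k n. g k n \<le> g' k * (n + 1) ^ d" using assms(1) by (auto simp: fpt_def)
  obtain h' e where h: "dexp h'" "\<And>k n. h k n \<le> h' k * (n + 1) ^ e" using assms(2) by (auto simp: fpt_def)
  have "g k n + h k n \<le> (g' k + h' k) * (n + 1) ^ (d + e)" for k n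
  proof -
    have "g k n \<le> g' k * (n + 1) ^ (d + e)"
      by (rule order_trans[OF g(2)]) (intro mult_left_mono power_increasing, auto)
    moreover have "h k n \<le> h' k * (n + 1) ^ (d + e)"
      by (rule order_trans[OF h(2)]) (intro mult_left_mono power_increasing, auto)
    ultimately show ?thesis by (simp add: add_mult_distrib)
  qed
  then show ?thesis unfolding fpt_def using dexp_add[OF g(1) h(1)] by blast
qed

section \<open>Total running time\<close>

definition num_opts :: "nat \<Rightarrow> nat" where
  "num_opts k = (k + 1) ^ k"

text \<open>\<open>num_opts k\<close> states, each with the size bound of
  \<open>pairs_states\<close> for parameters \<open>k\<close> and one list cell.\<close>

definition opts_pairs :: "nat \<Rightarrow> nat" where
  "opts_pairs k = num_opts k * Suc (k + 1 + k * (2 * k + 2))"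

text \<open>The number of possible offers times the size of one. Counting all possible offers,
  present or not, makes the radius depend on \<open>k\<close> alone.\<close>

definition box_bound :: "nat \<Rightarrow> nat" where
  "box_bound k = (state_bound k k k + 1) ^ num_opts k * opts_pairs k"

definition block_time :: "nat \<Rightarrow> nat \<Rightarrow> nat" where
  "block_time k n = (let P = k * (2 * n + 2); PA = (k + 1) ^ k * (P + 1) in
     (k * (20 + 300 * (n + PA + 1) * (k * (n + 1) + 1)) + 10) +
     (num_opts k * (60 + 300 * (P + 1) * (P + 1) + 1000 * (P + 3) * (P + 1)
       + P * (100 + 300 * (P + 1) + 300 * (3 * P + P * (3 * P) + 1))) + 10))"

definition types_time :: "nat \<Rightarrow> nat \<Rightarrow> nat" where
  "types_time k n = 100 + 2 * (n * (100 + 300 * (n + 1) * (n * (n + 3) + 1)) + 10)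
     + 2 * (n * (50 + block_time k n + 100 * (n * Suc (opts_pairs k) + 1)) + 10)"

text \<open>The first summand is the unfiltered offer of a single component, the second the number
  of states in the box times the size of one. Weights reach \<open>k * n\<close> because each of at
  most \<open>n\<close> components adds at most \<open>k\<close>.\<close>

definition solve_pairs :: "nat \<Rightarrow> nat \<Rightarrow> nat" where
  "solve_pairs k n = opts_pairs k
     + state_bound (k * n) k (box_bound k) * Suc (k * n + 1 + k * (2 * box_bound k + 2))"

definition solve_time :: "nat \<Rightarrow> nat \<Rightarrow> nat" where
  "solve_time k n = (let X = solve_pairs k n in
     2 * n * (110 + 300 * (n * Suc (opts_pairs k) + 1) + X * (40 + X * (100 + 1000 * (3 * X + 1)))) + 30)"

definition total_time :: "nat \<Rightarrow> nat \<Rightarrow> nat" where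
  "total_time k n = types_time k n + 100 + 300 * (n * Suc (opts_pairs k) + 1) + solve_time k n
     + 200 * (solve_pairs k n + 1)"

lemma fpt_total_time: "fpt total_time"
proof -
  have s: "dexp num_opts" "sexp num_opts"
    unfolding num_opts_def using sexp_power_self dexp_of_sexp by blast+
  have id: "dexp (\<lambda>k. k)" using sexp_id dexp_of_sexp by blast
  have o: "dexp opts_pairs" unfolding opts_pairs_def
    by (intro dexp_add dexp_mult dexp_Suc dexp_const s id)
  have b: "dexp box_bound" unfolding box_bound_def state_bound_def
    by (intro dexp_add dexp_mult dexp_Suc dexp_const dexp_power s id sexp_id o)
  have sb: "dexp (\<lambda>k. ((box_bound k + 1) * (box_bound k + 1) + 1) ^ k)"
    by (intro dexp_add dexp_mult dexp_const dexp_power sexp_id b)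
  have c: "fpt (\<lambda>k n. c)" for c by (rule fpt_of_dexp[OF dexp_const])
  have Suc: "fpt (\<lambda>k n. Suc (g k n))" if "fpt g" for g
    using fpt_add[OF that c[of 1]] by simp
  note I = fpt_add fpt_mult Suc c fpt_n fpt_of_dexp[OF id] fpt_of_dexp[OF o] fpt_of_dexp[OF b]
    fpt_of_dexp[OF s(1)] fpt_of_dexp[OF s(1)[unfolded num_opts_def]] fpt_of_dexp[OF sb]
  have sp: "fpt solve_pairs" unfolding solve_pairs_def state_bound_def by (intro I)
  have st: "fpt solve_time" unfolding solve_time_def Let_def by (intro I sp)
  have bt: "fpt block_time" unfolding block_time_def Let_def by (intro I)
  have tt: "fpt types_time" unfolding types_time_def by (intro I bt)
  show ?thesis unfolding total_time_def by (intro I tt st sp)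
qed

section \<open>Size bounds for blocks, offers and states\<close>

lemma block_size:
  assumes b: "blocks_upto G (card (verts G)) uss" and G: "input_graph G"
    and k: "\<And>C. C \<in> components G \<Longrightarrow> card C \<le> k" and us: "us \<in> set uss"
  shows "length us \<le> k"
proof -
  have simple: "simple_graph G" and V: "verts G = {..<card (verts G)}"
    using G by (auto simp: input_graph_def)
  have dist: "distinct (concat uss)" and set: "set (concat uss) = verts G" and ne: "us \<noteq> []"
    and reach: "\<And>u x. u \<in> set us \<Longrightarrow> x \<in> set us \<Longrightarrow> (u, x) \<in> (adj G)\<^sup>*"
    using b us V unfolding blocks_upto_def closed_blocks_def by (metis, metis, metis, metis)
  obtain u where u: "u \<in> set us" using ne by (cases us) auto
  have uV: "u \<in> verts G" using u us set[symmetric] by auto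
  let ?C = "{x. (u, x) \<in> (adj G)\<^sup>*}"
  have "x \<in> verts G" if "(u, x) \<in> (adj G)\<^sup>*" for x
    using that by (induction rule: rtrancl_induct) (use uV simple_adj[OF simple] in auto)
  then have "?C \<subseteq> verts G" by blast
  then have fin: "finite ?C" using simple by (meson finite_subset simple_graph_def)
  have "set us \<subseteq> ?C" using reach[OF u] by blast
  then have "card (set us) \<le> card ?C" by (rule card_mono[OF fin])
  also have "\<dots> \<le> k" using uV by (intro k) (auto simp: components_def)
  also have "card (set us) = length us" using dist us by (simp add: distinct_card distinct_concat_iff)
  finally show ?thesis .
qed

lemma length_le_concat: "[] \<notin> set uss \<Longrightarrow> length uss \<le> length (concat uss)"
proof (induction uss)
  case (Cons us uss)
  then show ?case by (cases us) auto
qed simp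

lemma length_blocks:
  assumes "blocks_upto G (card (verts G)) uss"
  shows "length uss \<le> card (verts G)"
proof -
  have d: "distinct (concat uss)" "set (concat uss) = {..<card (verts G)}" "[] \<notin> set uss"
    using assms by (auto simp: blocks_upto_def closed_blocks_def simp del: set_concat)
  have "length uss \<le> length (concat uss)" by (rule length_le_concat[OF d(3)])
  also have "\<dots> = card (set (concat uss))" using d(1) by (rule distinct_card[symmetric])
  finally show ?thesis by (simp add: d(2) del: set_concat)
qed

lemma block_bounds:
  assumes one: "one = pos_one \<or> one = neg_one" and k: "dlen b \<le> k"
    and n: "\<And>u. u \<in> set (dlist b) \<Longrightarrow> pairs u \<le> n"
  shows "block_opts M one b \<in> dlists (states k k k) (num_opts k)"
    and "t_assigns M b b + t_opts one (d_assigns M b b) \<le> block_time k n"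
proof -
  let ?as = "d_assigns M b b" and ?P = "k * (2 * n + 2)"
  have "dlen ?as \<le> dlen b ^ dlen b" by (rule dlen_d_assigns)
  also have "\<dots> \<le> (k + 1) ^ dlen b" using k by (intro power_mono) auto
  also have "\<dots> \<le> (k + 1) ^ k" using k by (intro power_increasing) auto
  finally have len: "dlen ?as \<le> num_opts k" by (simp add: num_opts_def)
  have a: "pairs a \<le> ?P" "dlen a \<le> k" if "a \<in> set (dlist ?as)" for a
  proof -
    have "pairs a \<le> dlen b * (2 * n + 2)" "dlen a = dlen b" using pairs_assignment[OF that n n] by auto
    then show "pairs a \<le> ?P" "dlen a \<le> k" using k mult_right_mono[OF k, of "2 * n + 2"] by auto
  qed
  show "block_opts M one b \<in> dlists (states k k k) (num_opts k)"
    unfolding dlists_def block_opts_def d_opts_def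
    using d_option_states[OF one a(2)] order_trans[OF length_filter_le len] by auto
  have "pairs one = 2" using one by (auto simp: pos_one_def neg_one_def)
  from t_opts_le[OF this a(1)]
  have "t_opts one ?as \<le> dlen ?as * (60 + 300 * (?P + 1) * (?P + 1) + 1000 * (?P + 3) * (?P + 1)
      + ?P * (100 + 300 * (?P + 1) + 300 * (3 * ?P + ?P * (3 * ?P) + 1))) + 10" .
  also have "\<dots> \<le> num_opts k * (60 + 300 * (?P + 1) * (?P + 1) + 1000 * (?P + 3) * (?P + 1)
      + ?P * (100 + 300 * (?P + 1) + 300 * (3 * ?P + ?P * (3 * ?P) + 1))) + 10"
    by (intro add_right_mono mult_right_mono len) simp
  finally have 1: "t_opts one ?as \<le> \<dots>" .
  have "t_assigns M b b \<le> dlen b * (20 + 300 * (n + (k + 1) ^ k * (?P + 1) + 1) * (k * (n + 1) + 1)) + 10"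
    using t_assigns_le[OF n n k k refl] by simp
  also have "\<dots> \<le> k * (20 + 300 * (n + (k + 1) ^ k * (?P + 1) + 1) * (k * (n + 1) + 1)) + 10"
    by (intro add_right_mono mult_right_mono k) simp
  finally show "t_assigns M b b + t_opts one ?as \<le> block_time k n"
    unfolding block_time_def Let_def using 1 by (rule add_mono)
qed

lemma pairs_opts:
  assumes "\<tau> \<in> dlists (states k k k) (num_opts k)"
  shows "pairs \<tau> \<le> opts_pairs k"
proof -
  have "pairs \<tau> \<le> dlen \<tau> * Suc (k + 1 + k * (2 * k + 2))"
    using assms by (intro pairs_le pairs_states[of _ k k k]) (auto simp: dlists_def)
  also have "\<dots> \<le> num_opts k * Suc (k + 1 + k * (2 * k + 2))"
    using assms by (intro mult_right_mono) (auto simp: dlists_def)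
  finally show ?thesis by (simp add: opts_pairs_def)
qed

lemma d_bound_le:
  assumes "set (dlist L) \<subseteq> dlists (states k k k) (num_opts k)" "grouped (dlist L)"
  shows "dlen (d_bound L) \<le> box_bound k"
proof -
  let ?T = "dlists (states k k k) (num_opts k)"
  have fin: "finite ?T" by (rule finite_dlists[OF finite_states])
  have "dlen (d_bound L) = (\<Sum>\<tau>\<in>set (dlist L). pairs \<tau>)" by (rule dlen_d_bound[OF assms(2)])
  also have "\<dots> \<le> (\<Sum>\<tau>\<in>?T. pairs \<tau>)" by (rule sum_mono2[OF fin assms(1)]) simp
  also have "\<dots> \<le> card ?T * opts_pairs k" using sum_bounded_above[of ?T pairs] pairs_opts by simp
  also have "\<dots> \<le> (state_bound k k k + 1) ^ num_opts k * opts_pairs k"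
  proof (rule mult_right_mono)
    have "card ?T \<le> (card (states k k k) + 1) ^ num_opts k" by (rule card_dlists[OF finite_states])
    also have "\<dots> \<le> (state_bound k k k + 1) ^ num_opts k"
      using card_states[of k k k] by (intro power_mono) auto
    finally show "card ?T \<le> (state_bound k k k + 1) ^ num_opts k" .
  qed simp
  finally show ?thesis by (simp add: box_bound_def)
qed

text \<open>Three sources bound a state: closure under addition its number of coordinates, the box
  test its entries, and the choice behind it, by soundness, its weight. Absence of duplicates turns
  the number of states into a length.\<close>

lemma d_solve_pairs_le:
  assumes L: "set (dlist L) \<subseteq> dlists (states k k k) (num_opts k)" "dlen L \<le> n"
    and B: "dlen B \<le> box_bound k"
  shows "pairs (d_solve B L) \<le> solve_pairs k n"
proof (cases "data_snd L = Atom")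
  case True
  then have "d_solve B L = data_fst L" by (simp add: d_solve.simps)
  moreover have "pairs (data_fst L) \<le> opts_pairs k" using L pairs_opts by (cases L) auto
  ultimately show ?thesis by (simp add: solve_pairs_def)
next
  case False
  let ?W = "states (k * n) k (box_bound k)"
  have eq: "d_solve B L = d_comb B (d_solve B (d_odds L)) (d_solve B (d_odds (data_snd L))) Atom"
    using False by (simp add: d_solve.simps)
  have dist: "distinct (dlist (d_solve B L))" unfolding eq by (rule distinct_d_comb) simp
  have "s \<in> ?W" if s: "s \<in> set (dlist (d_solve B L))" for s
  proof -
    have "\<forall>\<tau>\<in>set (dlist L). \<forall>s\<in>set (dlist \<tau>). \<exists>W \<beta>. s \<in> states W k \<beta>"
      using L(1) by (auto simp: dlists_def)
    \<comment> \<open>\<open>W\<close> and \<open>\<beta>\<close> are uncontrolled here; what this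
      step retains is the shape with at most \<open>k\<close> coordinates.\<close>
    then have "\<exists>W \<beta>. s \<in> states W k \<beta>"
      by (rule d_solve_invariant[of "\<lambda>s. \<exists>W \<beta>. s \<in> states W k \<beta>", rotated, OF _ s])
        (use d_add_states in blast)
    then obtain W \<beta> where 1: "s \<in> states W k \<beta>" by blast
    have 2: "in_box B (data_snd s)" using s unfolding eq set_d_comb by auto
    obtain ch where ch: "choice ch (dlist L)" "st_w s = tot_w ch" using d_solve_sound[OF s] by blast
    have "st_w c \<le> k" if "c \<in> set ch" for c
    proof -
      obtain i where i: "i < length ch" "c = ch ! i" using \<open>c \<in> set ch\<close> unfolding in_set_conv_nth by blast
      then have "c \<in> set (dlist (dlist L ! i))" "dlist L ! i \<in> set (dlist L)"
        using ch(1) by (auto simp: choice_def list_all2_conv_all_nth)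
      then have "c \<in> states k k k" using L(1) by (auto simp: dlists_def)
      then show ?thesis by (auto simp: states_def)
    qed
    then have "tot_w ch \<le> length ch * k"
      unfolding tot_w_def by (induction ch) (auto intro!: add_mono)
    also have "length ch = dlen L" using ch(1) by (simp add: choice_def list_all2_lengthD)
    also have "dlen L * k \<le> k * n" using L(2) by simp
    finally have "st_w s \<le> k * n" using ch(2) by simp
    then show ?thesis using states_in_box[OF 1 2 _ B] by blast
  qed
  then have sub: "set (dlist (d_solve B L)) \<subseteq> ?W" by blast
  have "pairs (d_solve B L) \<le> dlen (d_solve B L) * Suc (k * n + 1 + k * (2 * box_bound k + 2))"
    using sub by (intro pairs_le pairs_states) auto
  also have "\<dots> \<le> state_bound (k * n) k (box_bound k) * Suc (k * n + 1 + k * (2 * box_bound k + 2))"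
  proof (rule mult_right_mono)
    have "dlen (d_solve B L) = card (set (dlist (d_solve B L)))"
      using dist by (rule distinct_card[symmetric])
    also have "\<dots> \<le> card ?W" by (rule card_mono[OF finite_states sub])
    also have "\<dots> \<le> state_bound (k * n) k (box_bound k)" by (rule card_states)
    finally show "dlen (d_solve B L) \<le> state_bound (k * n) k (box_bound k)" .
  qed simp
  finally show ?thesis by (simp add: solve_pairs_def)
qed

lemma t_optimum_le:
  assumes L: "set (dlist L) \<subseteq> dlists (states k k k) (num_opts k)" "dlen L \<le> n" "grouped (dlist L)"
  shows "t_optimum L \<le> 100 + 300 * (n * Suc (opts_pairs k) + 1) + solve_time k n
     + 200 * (solve_pairs k n + 1)"
proof -
  let ?B = "d_bound L" and ?X = "solve_pairs k n" and ?P = "opts_pairs k"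
  let ?Z = "\<lambda>m. 110 + 300 * (m * Suc ?P + 1) + ?X * (40 + ?X * (100 + 1000 * (3 * ?X + 1)))"
  have B: "dlen ?B \<le> box_bound k" by (rule d_bound_le[OF L(1,3)])
  have X: "pairs (d_solve ?B L') \<le> ?X" if "set (dlist L') \<subseteq> set (dlist L)" "dlen L' \<le> dlen L" for L'
    using that L(1,2) by (intro d_solve_pairs_le B) auto
  have P: "pairs \<tau> \<le> ?P" if "\<tau> \<in> set (dlist L)" for \<tau> using L(1) that by (intro pairs_opts) auto
  have "t_solve ?B L \<le> 2 * dlen L * ?Z (dlen L) + 30"
    using t_solve_le[OF X P refl subset_refl le_refl] by blast
  also have "\<dots> \<le> 2 * n * ?Z n + 30"
    using L(2) by (intro add_right_mono mult_mono add_left_mono) auto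
  also have "\<dots> = solve_time k n" by (simp only: solve_time_def Let_def)
  finally have 1: "t_solve ?B L \<le> solve_time k n" .
  have "pairs L \<le> dlen L * Suc ?P" by (rule pairs_le[OF P])
  also have "\<dots> \<le> n * Suc ?P" using L(2) by (rule mult_right_mono) simp
  finally have 2: "300 * (pairs L + 1) \<le> 300 * (n * Suc ?P + 1)" by (intro mult_left_mono add_right_mono) simp_all
  have 3: "200 * (pairs (d_solve ?B L) + 1) \<le> 200 * (?X + 1)" using X[OF subset_refl le_refl] by simp
  show ?thesis unfolding t_optimum_def using 1 2 3 by linarith
qed

lemma t_build_enc_graph_le:
  assumes "card (verts G) \<le> n"
  shows "t_build (enc_graph G) (enc_graph G) Atom Atom
    \<le> n * (100 + 300 * (n + 1) * (n * (n + 3) + 1)) + 10"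
proof -
  have len: "dlen (enc_graph G) = card (verts G)" by (simp add: dlist_enc_graph)
  have "t_build (enc_graph G) (enc_graph G) Atom Atom
      \<le> dlen (enc_graph G) * (100 + 300 * (n + 1) * (n * (n + 3) + 1)) + 10"
    by (rule t_build_le) (use assms mult_right_mono[OF assms, of "n + 3"] in \<open>simp_all add: len\<close>)
  also have "\<dots> \<le> n * (100 + 300 * (n + 1) * (n * (n + 3) + 1)) + 10"
    unfolding len by (intro add_right_mono mult_right_mono assms) simp
  finally show ?thesis .
qed

lemma add_pairs_le:
  fixes a b c d x y :: nat
  shows "a \<le> x \<Longrightarrow> b \<le> x \<Longrightarrow> c \<le> y \<Longrightarrow> d \<le> y \<Longrightarrow> 100 + a + b + c + d \<le> 100 + 2 * x + 2 * y"
  by simp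

theorem t_mcsf_le:
  assumes G: "input_graph G1" "input_graph G2"
    and k: "\<And>C. C \<in> components G1 \<union> components G2 \<Longrightarrow> card C \<le> k"
    and n: "n = card (verts G1) + card (verts G2)"
  shows "t_mcsf (enc_graph G1) (enc_graph G2) \<le> total_time k n"
proof -
  let ?M1 = "enc_graph G1" and ?M2 = "enc_graph G2"
  let ?L = "d_types ?M1 ?M2" and ?P = "opts_pairs k" and ?T = "dlists (states k k k) (num_opts k)"
  obtain uss1 uss2 where uss: "blocks_upto G1 (card (verts G1)) uss1" "blocks_upto G2 (card (verts G2)) uss2"
    "d_build ?M1 ?M1 Atom Atom = dl (map enc_block uss1)" "d_build ?M2 ?M2 Atom Atom = dl (map enc_block uss2)"
    "mset (dlist ?L) = mset (map (\<lambda>us. block_opts ?M1 pos_one (enc_block us)) uss1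
        @ map (\<lambda>us. block_opts ?M2 neg_one (enc_block us)) uss2)"
    and grp: "grouped (dlist ?L)"
    using d_types_structure[of G1 G2] by metis
  have len: "length uss1 \<le> card (verts G1)" "length uss2 \<le> card (verts G2)"
    using length_blocks uss(1,2) by auto
  \<comment> \<open>The list for the second graph is the starting value for the first, so one bound
    has to cover both together.\<close>
  have "length uss1 + length uss2 \<le> n" using len n by simp
  then have lenn: "length uss1 * Suc ?P + length uss2 * Suc ?P \<le> n * Suc ?P"
    unfolding add_mult_distrib[symmetric] by (rule mult_right_mono) simp
  have b1: "dlen (enc_block us) \<le> k" "\<And>u. u \<in> set (dlist (enc_block us)) \<Longrightarrow> pairs u \<le> n"
    if us: "us \<in> set uss1" for us
  proof -
    show "dlen (enc_block us) \<le> k" using block_size[OF uss(1) G(1) _ us] k by simp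
    have "set us \<subseteq> set (concat uss1)" using us by auto
    then have "u < card (verts G1)" if "u \<in> set us" for u
      using uss(1) that unfolding blocks_upto_def by blast
    then show "pairs u \<le> n" if "u \<in> set (dlist (enc_block us))" for u
      using that n by fastforce
  qed
  have b2: "dlen (enc_block us) \<le> k" "\<And>u. u \<in> set (dlist (enc_block us)) \<Longrightarrow> pairs u \<le> n"
    if us: "us \<in> set uss2" for us
  proof -
    show "dlen (enc_block us) \<le> k" using block_size[OF uss(2) G(2) _ us] k by simp
    have "set us \<subseteq> set (concat uss2)" using us by auto
    then have "u < card (verts G2)" if "u \<in> set us" for u
      using uss(2) that unfolding blocks_upto_def by blast
    then show "pairs u \<le> n" if "u \<in> set (dlist (enc_block us))" for u
      using that n by fastforce
  qed
  have bb1: "block_opts ?M1 pos_one (enc_block us) \<in> ?T"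
    "t_assigns ?M1 (enc_block us) (enc_block us) + t_opts pos_one (d_assigns ?M1 (enc_block us) (enc_block us))
      \<le> block_time k n" if "us \<in> set uss1" for us
    using block_bounds[of pos_one "enc_block us" k n ?M1, OF _ b1[OF that]] by blast+
  have bb2: "block_opts ?M2 neg_one (enc_block us) \<in> ?T"
    "t_assigns ?M2 (enc_block us) (enc_block us) + t_opts neg_one (d_assigns ?M2 (enc_block us) (enc_block us))
      \<le> block_time k n" if "us \<in> set uss2" for us
    using block_bounds[of neg_one "enc_block us" k n ?M2, OF _ b2[OF that]] by blast+
  have setL: "set (dlist ?L) = (\<lambda>us. block_opts ?M1 pos_one (enc_block us)) ` set uss1
        \<union> (\<lambda>us. block_opts ?M2 neg_one (enc_block us)) ` set uss2"
    using arg_cong[OF uss(5), of set_mset] by simp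
  have LT: "set (dlist ?L) \<subseteq> ?T" unfolding setL using bb1(1) bb2(1) by blast
  have "dlen ?L = length uss1 + length uss2" using arg_cong[OF uss(5), of size] by simp
  then have Ln: "dlen ?L \<le> n" using len n by simp
  have o: "t_optimum ?L \<le> 100 + 300 * (n * Suc ?P + 1) + solve_time k n + 200 * (solve_pairs k n + 1)"
    by (rule t_optimum_le[OF LT Ln grp])
  let ?b1 = "dl (map enc_block uss1)" and ?b2 = "dl (map enc_block uss2)"
  let ?L2 = "d_optlists ?M2 neg_one ?b2 Atom"
  have p1: "pairs (block_opts ?M1 pos_one b) \<le> ?P" "t_assigns ?M1 b b + t_opts pos_one (d_assigns ?M1 b b) \<le> block_time k n"
    if "b \<in> set (dlist ?b1)" for b
    using that pairs_opts[OF bb1(1)] bb1(2) by auto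
  have p2: "pairs (block_opts ?M2 neg_one b) \<le> ?P" "t_assigns ?M2 b b + t_opts neg_one (d_assigns ?M2 b b) \<le> block_time k n"
    if "b \<in> set (dlist ?b2)" for b
    using that pairs_opts[OF bb2(1)] bb2(2) by auto
  have L2: "pairs ?L2 \<le> length uss2 * Suc ?P" using pairs_d_optlists[OF p2(1), of ?b2 Atom] by simp
  let ?c = "50 + block_time k n + 100 * (n * Suc ?P + 1)"
  have "t_optlists ?M2 neg_one ?b2 Atom \<le> dlen ?b2 * ?c + 10"
    by (rule t_optlists_le[OF p2]) (use lenn in auto)
  also have "\<dots> \<le> n * ?c + 10" using len n by (intro add_right_mono mult_right_mono) auto
  finally have o2: "t_optlists ?M2 neg_one ?b2 Atom \<le> n * ?c + 10" .
  have "t_optlists ?M1 pos_one ?b1 ?L2 \<le> dlen ?b1 * ?c + 10"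
    by (rule t_optlists_le[OF p1]) (use lenn L2 in auto)
  also have "\<dots> \<le> n * ?c + 10" using len n by (intro add_right_mono mult_right_mono) auto
  finally have o1: "t_optlists ?M1 pos_one ?b1 ?L2 \<le> n * ?c + 10" .
  have "t_build ?M1 ?M1 Atom Atom \<le> n * (100 + 300 * (n + 1) * (n * (n + 3) + 1)) + 10"
    "t_build ?M2 ?M2 Atom Atom \<le> n * (100 + 300 * (n + 1) * (n * (n + 3) + 1)) + 10"
    by (rule t_build_enc_graph_le; simp add: n)+
  then have "t_types ?M1 ?M2 \<le> types_time k n"
    unfolding t_types_def types_time_def uss(3,4) by (intro add_pairs_le o1 o2)
  then show ?thesis unfolding t_mcsf_def total_time_def using o by linarith
qed

section \<open>Main theorem\<close>

lemma runs_withinI: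
  assumes total: "\<And>k n. h k n \<le> g k * (n + 1) ^ d" and g: "\<And>k. g k * 2 ^ d \<le> 2 ^ (2 ^ (a * k ^ 2 + b))"
    and t: "\<And>k. (\<And>C. C \<in> components G1 \<union> components G2 \<Longrightarrow> card C \<le> k) \<Longrightarrow>
      t \<le> h k (card (verts G1) + card (verts G2))"
  shows "runs_within (\<lambda>k n. 2 powr (2 powr real (a * k ^ 2 + b)) * real (max 1 n) ^ d) t G1 G2"
  unfolding runs_within_def
proof (intro allI impI)
  fix k assume k: "\<forall>C\<in>components G1 \<union> components G2. card C \<le> k"
  let ?n = "card (verts G1) + card (verts G2)"
  let ?m = "max 1 ?n"
  have "t \<le> g k * (?n + 1) ^ d" using t[of k] k total[of k ?n] by (meson le_trans)
  \<comment> \<open>Passing from \<open>n + 1\<close> to \<open>max 1 n\<close> costs a factor 2 per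
    power; the resulting \<open>2 ^ d\<close> is absorbed into the double exponential by the
    hypothesis on \<open>g\<close>.\<close>
  also have "\<dots> \<le> g k * (2 * ?m) ^ d"
  proof (intro mult_left_mono power_mono)
    show "?n + 1 \<le> 2 * ?m" by (simp add: max_def)
  qed auto
  also have "\<dots> = (g k * 2 ^ d) * ?m ^ d" by (simp only: power_mult_distrib mult.assoc)
  also have "\<dots> \<le> 2 ^ (2 ^ (a * k ^ 2 + b)) * ?m ^ d" by (rule mult_right_mono[OF g]) simp
  finally have "real t \<le> real (2 ^ (2 ^ (a * k ^ 2 + b)) * ?m ^ d)" by (simp only: of_nat_le_iff)
  also have "\<dots> = 2 powr (2 powr real (a * k ^ 2 + b)) * real ?m ^ d"
  proof -
    have "(2 :: real) powr real (a * k ^ 2 + b) = real (2 ^ (a * k ^ 2 + b))"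
      by (simp only: powr_realpow of_nat_power of_nat_numeral zero_less_numeral)
    then have "2 powr (2 powr real (a * k ^ 2 + b)) = (2 :: real) ^ (2 ^ (a * k ^ 2 + b))"
      by (simp only: powr_realpow zero_less_numeral)
    then show ?thesis by (simp only: of_nat_mult of_nat_power of_nat_numeral)
  qed
  finally show "real t \<le> 2 powr (2 powr real (a * k ^ 2 + b)) * real ?m ^ d" .
qed

text \<open>Bounds the comparison in the decision program, whose cost is linear in the
  optimum.\<close>

lemma mcsf_optimum_le: "simple_graph G1 \<Longrightarrow> mcsf_optimum G1 G2 \<le> card (verts G1)"
  unfolding mcsf_optimum_def
proof (rule Max.boundedI)
  assume G: "simple_graph G1"
  show "finite {card (verts H) |H. common_star_forest G1 G2 H}"
    by (rule finite_common_star_forest_sizes[OF G])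
  show "{card (verts H) |H. common_star_forest G1 G2 H} \<noteq> {}"
    using zero_common_star_forest_size by blast
  fix w assume "w \<in> {card (verts H) |H. common_star_forest G1 G2 H}"
  then obtain H where H: "w = card (verts H)" "common_star_forest G1 G2 H" by blast
  then have "subgraph_of H G1" by (simp add: common_star_forest_def)
  then show "w \<le> card (verts G1)" using G H(1) unfolding subgraph_of_def simple_graph_def
    by (metis card_inj_on_le)
qed

lemma mcsf_decision_iff:
  assumes "simple_graph G1"
  shows "mcsf_decision G1 G2 h \<longleftrightarrow> h \<le> mcsf_optimum G1 G2"
proof -
  let ?W = "{card (verts H) |H. common_star_forest G1 G2 H}"
  have "mcsf_decision G1 G2 h \<longleftrightarrow> (\<exists>w\<in>?W. h \<le> w)" unfolding mcsf_decision_def by blast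
  also have "\<dots> \<longleftrightarrow> h \<le> Max ?W"
    using finite_common_star_forest_sizes[OF assms, of G2] zero_common_star_forest_size[of G1 G2]
    by (subst Max_ge_iff) auto
  finally show ?thesis unfolding mcsf_optimum_def .
qed

theorem theorem19:
  shows "\<exists>f :: nat \<Rightarrow> real. \<exists>d :: nat. f \<in> O(\<lambda>k. real k ^ 2) \<and>
    (\<exists>P. optimizes_within P (\<lambda>k n. 2 powr (2 powr f k) * real (max 1 n) ^ d)) \<and>
    (\<exists>P. decides_within P (\<lambda>k n. 2 powr (2 powr f k) * real (max 1 n) ^ d))"
proof -
  \<comment> \<open>The summand \<open>20 * n + 50\<close> covers the surcharges of both main
    functions, so the two programs share \<open>f\<close> and \<open>d\<close>.\<close>
  let ?h = "\<lambda>k n. total_time k n + (20 * n + 50)"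
  have c: "fpt (\<lambda>k n. c)" for c by (rule fpt_of_dexp[OF dexp_const])
  have "fpt ?h" by (intro fpt_add fpt_mult c fpt_n fpt_total_time)
  then obtain g d where g: "dexp g" and h: "\<And>k n. ?h k n \<le> g k * (n + 1) ^ d"
    unfolding fpt_def by blast
  have "dexp (\<lambda>k. g k * 2 ^ d)" by (rule dexp_mult[OF g dexp_const])
  then obtain a b where ab: "\<And>k. g k * 2 ^ d \<le> 2 ^ (2 ^ (a * k ^ 2 + b))" unfolding dexp_def by blast
  let ?f = "\<lambda>k. real (a * k ^ 2 + b)"
  let ?T = "\<lambda>k n. 2 powr (2 powr ?f k) * real (max 1 n) ^ d"
  have "?f \<in> O(\<lambda>k. real k ^ 2)"
  proof (rule bigoI)
    show "\<forall>\<^sub>F k in at_top. norm (?f k) \<le> real (a + b) * norm (real k ^ 2)"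
    proof (rule eventually_sequentiallyI[of 1])
      fix k :: nat assume "1 \<le> k"
      \<comment> \<open>The constant is absorbed by the square from \<open>k = 1\<close> on; at 0
        the square vanishes.\<close>
      then have "b * 1 \<le> b * k ^ 2" by (intro mult_left_mono) auto
      then have "a * k ^ 2 + b \<le> (a + b) * k ^ 2" by (simp add: add_mult_distrib)
      then have "real (a * k ^ 2 + b) \<le> real ((a + b) * k ^ 2)" by (simp only: of_nat_le_iff)
      then show "norm (?f k) \<le> real (a + b) * norm (real k ^ 2)" by simp
    qed
  qed
  moreover have "optimizes_within (prog opt_main) ?T"
    unfolding optimizes_within_def
  proof (intro allI impI)
    fix G1 G2 assume G: "input_graph G1 \<and> input_graph G2"
    obtain t where t: "t \<le> t_mcsf (enc_graph G1) (enc_graph G2) + 20"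
      "computes_in (prog opt_main) (Pair (enc_graph G1) (enc_graph G2)) (enc_nat (mcsf_optimum G1 G2)) t"
      using opt_main[of "enc_graph G1" "enc_graph G2"] d_mcsf_correct G by metis
    have "runs_within ?T t G1 G2"
    proof (rule runs_withinI[OF h ab])
      fix k assume "\<And>C. C \<in> components G1 \<union> components G2 \<Longrightarrow> card C \<le> k"
      then show "t \<le> ?h k (card (verts G1) + card (verts G2))"
        using t_mcsf_le[of G1 G2 k] G t(1) by fastforce
    qed
    then show "\<exists>t. computes_in (prog opt_main) (Pair (enc_graph G1) (enc_graph G2))
        (enc_nat (mcsf_optimum G1 G2)) t \<and> runs_within ?T t G1 G2" using t(2) by blast
  qed
  moreover have "decides_within (prog dec_main) ?T"
    unfolding decides_within_def
  proof (intro allI impI)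
    fix G1 G2 h assume G: "input_graph G1 \<and> input_graph G2"
    then have simple: "simple_graph G1" by (simp add: input_graph_def)
    have d: "d_mcsf (enc_graph G1) (enc_graph G2) = enc_nat (mcsf_optimum G1 G2)"
      using d_mcsf_correct G by blast
    obtain t where t: "t \<le> t_mcsf (enc_graph G1) (enc_graph G2) + 20 * mcsf_optimum G1 G2 + 50"
      "computes_in (prog dec_main) (Pair (Pair (enc_graph G1) (enc_graph G2)) (enc_nat h))
        (enc_bool (mcsf_decision G1 G2 h)) t"
      using dec_main[of "enc_graph G1" "enc_graph G2" "enc_nat h"]
      by (auto simp: d mcsf_decision_iff[OF simple])
    have "runs_within ?T t G1 G2"
    proof (rule runs_withinI[OF _ ab])
      fix k assume "\<And>C. C \<in> components G1 \<union> components G2 \<Longrightarrow> card C \<le> k"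
      then show "t \<le> ?h k (card (verts G1) + card (verts G2))"
        using t_mcsf_le[of G1 G2 k] G t(1) mcsf_optimum_le[OF simple, of G2] by fastforce
    qed (rule \<open>\<And>k n. ?h k n \<le> g k * (n + 1) ^ d\<close>)
    then show "\<exists>t. computes_in (prog dec_main) (Pair (Pair (enc_graph G1) (enc_graph G2)) (enc_nat h))
        (enc_bool (mcsf_decision G1 G2 h)) t \<and> runs_within ?T t G1 G2" using t(2) by blast
  qed
  ultimately show ?thesis by blast
qed

end
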